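(* Let $E$ and $F$ be Banach lattices. Then the following statements are equivalent: (1) For all operators $S, T : E \to F$ such that $0 \leq S \leq T$ and $T$ is Lwcc, the operator $S$ is Lwcc. (2) At least one of the following conditions holds: (a) $E^{a}$ is discrete; (b) $F$ is order continuous.
   Context: Operators are bounded linear maps. For operators $S,T : E\to F$ between Banach lattices, $0\le S\le T$ means $0 \le S(x) \le T(x)$ for every $x \in E$ with $x\ge 0$. A Banach lattice is called order continuous if its norm is order continuous, i.e. $\|x_\alpha\| \to 0$ for every net $x_\alpha \downarrow 0$. $E^{a}$ denotes the order continuous part of $E$, i.e. the largest closed order ideal of $E$ on which the norm is order continuous; equivalently, $E^{a}$ is the set of all $x\in E$ such that every monotone sequence in $[0,|x|]$ is norm convergent. In a vector lattice, an element $x > 0$ is discrete (an atom) if the order ideal generated by $x$ equals the linear span of $x$. A vector lattice is discrete if it admits a complete disjoint system of discrete elements, i.e. there is a family of pairwise disjoint discrete elements such that the only element disjoint from all of them is $0$ (the zero lattice is discrete, with the empty family). A nonempty bounded subset $A$ of a Banach lattice $E$ is L-weakly compact if $\|x_n\|\to 0$ for every disjoint sequence $(x_n)$ contained in the solid hull of $A$; a sequence is L-weakly compact if its set of terms is. An operator $T : E \to F$ between Banach lattices is Lwcc if $\|T(x_n)\| \to 0$ for every weakly null sequence $(x_n)$ of $E$ that is L-weakly compact (equivalently, $T$ maps L-weakly compact subsets of $E$ to relatively norm compact subsets of $F$). *)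

theory Defs
  imports "HOL-Analysis.Analysis" "HOL-Library.Lattice_Algebras"
begin

section \<open>Banach lattices\<close>

text \<open>Real Banach lattices; the lattice modulus is \<open>\<bar>x\<bar> = sup x (- x)\<close>.\<close>

class banach_lattice = banach + ordered_real_vector + lattice_ab_group_add_abs +
  assumes norm_mono_abs: "\<bar>x\<bar> \<le> \<bar>y\<bar> \<Longrightarrow> norm x \<le> norm y"

text \<open>
  Below, a vector lattice is given by a carrier \<open>L\<close>, which is either \<open>UNIV\<close> or an order ideal
  of the ambient Banach lattice.
\<close>

definition order_ideal_in :: "'a::banach_lattice set \<Rightarrow> 'a set \<Rightarrow> bool" where
  "order_ideal_in L I \<longleftrightarrow>
     I \<subseteq> L \<and> subspace I \<and> (\<forall>x\<in>I. \<forall>y\<in>L. \<bar>y\<bar> \<le> \<bar>x\<bar> \<longrightarrow> y \<in> I)"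

definition lattice_disjoint :: "'a::banach_lattice \<Rightarrow> 'a \<Rightarrow> bool" where
  "lattice_disjoint x y \<longleftrightarrow> inf \<bar>x\<bar> \<bar>y\<bar> = 0"


section \<open>Order continuity\<close>

text \<open>
  A net is a function \<open>x\<close> on a nonempty index set \<open>I\<close> directed by the preorder \<open>le\<close>;
  \<open>x \<down> 0\<close> means that it is decreasing and has infimum \<open>0\<close> in \<open>L\<close>.
\<close>

definition net_decreasing_to_zero ::
    "'a::banach_lattice set \<Rightarrow> 'i set \<Rightarrow> ('i \<Rightarrow> 'i \<Rightarrow> bool) \<Rightarrow> ('i \<Rightarrow> 'a) \<Rightarrow> bool" where
  "net_decreasing_to_zero L I le x \<longleftrightarrow>
     I \<noteq> {} \<and> reflp_on I le \<and> transp_on I le \<and>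
     (\<forall>i\<in>I. \<forall>j\<in>I. \<exists>k\<in>I. le i k \<and> le j k) \<and>
     x ` I \<subseteq> L \<and>
     (\<forall>i\<in>I. \<forall>j\<in>I. le i j \<longrightarrow> x j \<le> x i) \<and>
     (\<forall>i\<in>I. 0 \<le> x i) \<and>
     (\<forall>z\<in>L. (\<forall>i\<in>I. z \<le> x i) \<longrightarrow> z \<le> 0)"

text \<open>
  Index sets are taken inside the type \<open>'a\<close>, since a definition cannot quantify over types.
  This loses nothing: if \<open>x\<close> is any net with \<open>x \<down> 0\<close>, its range, indexed by itself and directed
  by \<open>\<ge>\<close>, is such a net as well, and the two converge in norm to \<open>0\<close> simultaneously.
\<close>

definition order_continuous_norm_on :: "'a::banach_lattice set \<Rightarrow> bool" where
  "order_continuous_norm_on L \<longleftrightarrow>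
     (\<forall>(I :: 'a set) le x. net_decreasing_to_zero L I le x \<longrightarrow>
        (\<forall>e>0. \<exists>i\<in>I. \<forall>j\<in>I. le i j \<longrightarrow> norm (x j) < e))"

text \<open>The set \<open>E\<^sup>a\<close>; a largest ideal of this kind exists in every Banach lattice.\<close>

definition order_continuous_part :: "'a::banach_lattice set" where
  "order_continuous_part =
     (GREATEST J. order_ideal_in UNIV J \<and> closed J \<and> order_continuous_norm_on J)"


section \<open>Discrete vector lattices\<close>

definition discrete_element :: "'a::banach_lattice set \<Rightarrow> 'a \<Rightarrow> bool" where
  "discrete_element L x \<longleftrightarrow> x \<in> L \<and> 0 < x \<and> order_ideal_in L hull {x} = span {x}"

text \<open>
  A disjoint system can be taken to be a set, because pairwise disjoint nonzero elements are distinct.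
\<close>

definition discrete_vector_lattice :: "'a::banach_lattice set \<Rightarrow> bool" where
  "discrete_vector_lattice L \<longleftrightarrow>
     (\<exists>D. (\<forall>d\<in>D. discrete_element L d) \<and> pairwise lattice_disjoint D \<and>
          (\<forall>y\<in>L. (\<forall>d\<in>D. lattice_disjoint y d) \<longrightarrow> y = 0))"


section \<open>Lwcc operators\<close>

definition solid_hull :: "'a::banach_lattice set \<Rightarrow> 'a set" where
  "solid_hull A = {y. \<exists>x\<in>A. \<bar>y\<bar> \<le> \<bar>x\<bar>}"

definition L_weakly_compact :: "'a::banach_lattice set \<Rightarrow> bool" where
  "L_weakly_compact A \<longleftrightarrow>
     A \<noteq> {} \<and> bounded A \<and>
     (\<forall>x :: nat \<Rightarrow> 'a. (\<forall>n. x n \<in> solid_hull A) \<and>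
        (\<forall>m n. m \<noteq> n \<longrightarrow> lattice_disjoint (x m) (x n)) \<longrightarrow>
        (\<lambda>n. norm (x n)) \<longlonglongrightarrow> 0)"

definition weakly_null :: "(nat \<Rightarrow> 'a::real_normed_vector) \<Rightarrow> bool" where
  "weakly_null x \<longleftrightarrow> (\<forall>f :: 'a \<Rightarrow> real. bounded_linear f \<longrightarrow> (\<lambda>n. f (x n)) \<longlonglongrightarrow> 0)"

definition Lwcc :: "('a::banach_lattice \<Rightarrow> 'b::banach_lattice) \<Rightarrow> bool" where
  "Lwcc T \<longleftrightarrow> bounded_linear T \<and>
     (\<forall>x. weakly_null x \<and> L_weakly_compact (range x) \<longrightarrow> (\<lambda>n. norm (T (x n))) \<longlonglongrightarrow> 0)"

text \<open>The order of operators, which is not the pointwise order of functions.\<close>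

definition operator_le :: "('a::banach_lattice \<Rightarrow> 'b::banach_lattice) \<Rightarrow> ('a \<Rightarrow> 'b) \<Rightarrow> bool" where
  "operator_le S T \<longleftrightarrow> (\<forall>x\<ge>0. S x \<le> T x)"

end

theory Submission
  imports Defs
begin

text \<open>
  Both conditions of (2) are statements about elements \<open>x\<close> for which every increasing sequence in
  \<open>[0, \<bar>x\<bar>]\<close> converges in norm. These elements form the ideal \<open>E\<^sup>a\<close>, and \<open>F\<close> is order
  continuous iff all its elements are of this kind. L-weakly compact sets live in \<open>E\<^sup>a\<close> and are,
  up to an arbitrarily small error in norm, order bounded there
  (\<open>L_weakly_compact_almost_order_bounded\<close>); so only order intervals \<open>[-u, u]\<close> with \<open>u \<in> E\<^sup>a\<close> matter.

  If \<open>E\<^sup>a\<close> is discrete, the band projections onto finitely many atoms approximate the identity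
  uniformly on \<open>[-u, u]\<close>, and each coordinate of a weakly null sequence tends to 0. Hence weakly
  null L-weakly compact sequences are norm null (\<open>discrete_weakly_null_tendsto\<close>), and every
  operator on \<open>E\<close> is Lwcc.

  If \<open>F\<close> is order continuous, smallness in \<open>F\<close> can be tested with one positive functional \<open>\<phi>\<close> on
  \<open>F\<close> adapted to the sequence (\<open>small_functional_dominated\<close>). Then \<open>S\<close> and \<open>T\<close> are compared as
  finitely additive measures \<open>\<sigma> \<le> \<tau>\<close> on pairs of order projections \<open>(P, B)\<close> of \<open>E\<^sup>a\<close> and \<open>F\<close>,
  where \<open>\<sigma>(P, B) = \<phi> (B (S (P u)))\<close> and \<open>\<tau>(P, B) = \<phi> (B (T (P u)))\<close>. As in the proof of the
  Radon--Nikodym theorem by energy maximization, a density that is constant on the cells of a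
  finite grid nearly reproduces \<open>\<sigma>\<close> from \<open>\<tau>\<close>. It yields an operator
  \<open>R = \<Sum> c\<^sub>i\<^sub>j B\<^sub>j T P\<^sub>i\<close> that is close to \<open>S\<close> on \<open>[0, u]\<close> (\<open>approximation\<close>); and \<open>R\<close> maps weakly null
  L-weakly compact sequences to norm null ones, since \<open>T\<close> does and the projections \<open>P\<^sub>i\<close> preserve
  such sequences.

  If both conditions fail, choose \<open>u > 0\<close> in \<open>E\<^sup>a\<close> without atoms below it and a positive functional
  \<open>g\<close> that is strictly positive on \<open>[0, u]\<close>. Halving components repeatedly gives a Rademacher
  sequence \<open>r\<^sub>n\<close> in \<open>[-u, u]\<close>; it is weakly null, and so are, in the weak* sense, the functionals
  \<open>h\<^sub>n(x) = g(r\<^sub>n x)\<close>. With a disjoint sequence \<open>f\<^sub>n\<close> in some \<open>[0, b] \<subseteq> F\<close> whose norms stay away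
  from 0, the operator \<open>S x = g(x) b + \<Sum> h\<^sub>n(x) f\<^sub>n\<close> satisfies \<open>0 \<le> S \<le> 2 g \<otimes> b\<close>, an operator of
  rank one; but \<open>\<bar>S r\<^sub>n\<bar> \<ge> g(u) f\<^sub>n\<close>, so \<open>S\<close> is not Lwcc (\<open>dominated_not_Lwcc\<close>).
\<close>

section \<open>Vector lattice inequalities\<close>

\<comment> \<open>These rules would destroy the differences \<open>x - inf x y\<close> on which the calculations below rely.\<close>
declare neg_inf_eq_sup [simp del] neg_sup_eq_inf [simp del]
  diff_inf_eq_sup [simp del] diff_sup_eq_inf [simp del]

text \<open>
  Lattice-ordered groups are distributive: with \<open>r\<close> the right-hand side, \<open>r - inf y z\<close> is the
  supremum of \<open>r - y\<close> and \<open>r - z\<close>, and both are at most the positive part of \<open>x - inf y z\<close>.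
\<close>

instance banach_lattice \<subseteq> distrib_lattice
proof
  fix x y z :: 'a
  let ?r = "inf (sup x y) (sup x z)"
  have "?r - inf y z \<le> sup (?r - y) (?r - z)"
    by (simp add: diff_inf_eq_sup add_sup_distrib_left)
  also have "\<dots> \<le> sup (sup x y - y) (sup x z - z)"
    by (intro sup_mono diff_right_mono) auto
  also have "\<dots> \<le> pprt (x - inf y z)"
  proof (intro sup_least)
    have "sup x y - y = pprt (x - y)" for y
      by (simp add: pprt_def add_sup_distrib_right diff_conv_add_uminus del: add_uminus_conv_diff)
    moreover have "pprt (x - y) \<le> pprt (x - inf y z)" "pprt (x - z) \<le> pprt (x - inf y z)"
      by (intro pprt_mono diff_left_mono inf_le1 inf_le2)+
    ultimately show "sup x y - y \<le> pprt (x - inf y z)" "sup x z - z \<le> pprt (x - inf y z)" by auto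
  qed
  also have "\<dots> = sup x (inf y z) - inf y z"
    by (simp add: pprt_def add_sup_distrib_right diff_conv_add_uminus del: add_uminus_conv_diff)
  finally have "?r \<le> sup x (inf y z)" by simp
  then show "sup x (inf y z) = ?r" by (intro order.antisym) (auto intro: le_supI2 le_infI1)
qed

lemma pprt_diff: "pprt x - pprt (- x) = (x::'a::banach_lattice)"
  by (metis diff_minus_eq_add pprt_neg prts)

lemma abs_eq_pprt_add: "\<bar>x\<bar> = pprt x + pprt (- x)" for x :: "'a::banach_lattice"
  by (simp add: abs_prts pprt_neg)

lemma pprt_le_abs: "pprt x \<le> \<bar>x\<bar>" "pprt (- x) \<le> \<bar>x\<bar>" for x :: "'a::banach_lattice"
  by (auto simp: abs_eq_pprt_add)

lemma inf_pprt_pprt_minus: "inf (pprt x) (pprt (- x)) = 0" for x :: "'a::banach_lattice"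
proof -
  have "inf (pprt x) (pprt (- x)) = inf (x + pprt (- x)) (0 + pprt (- x))"
    using pprt_diff[of x] by (metis add.commute add_0 diff_add_cancel)
  also have "\<dots> = nprt x + pprt (- x)" by (simp only: add_inf_distrib_right[symmetric] nprt_def)
  finally show ?thesis by (simp add: pprt_neg)
qed

lemma scaleR_inf: "0 \<le> t \<Longrightarrow> t *\<^sub>R inf x y = inf (t *\<^sub>R x) (t *\<^sub>R (y::'a::banach_lattice))"
proof (cases "t = 0")
  case False
  assume "0 \<le> t" with False have t: "0 < t" by simp
  have "inverse t *\<^sub>R inf (t *\<^sub>R x) (t *\<^sub>R y) \<le> inf x y"
    using t by (intro le_infI) (auto simp: pos_divideR_le_eq)
  then have "t *\<^sub>R (inverse t *\<^sub>R inf (t *\<^sub>R x) (t *\<^sub>R y)) \<le> t *\<^sub>R inf x y"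
    using t by (intro scaleR_left_mono) auto
  then show ?thesis
    using t by (intro order.antisym le_infI scaleR_left_mono) auto
qed simp

lemma scaleR_sup: "0 \<le> t \<Longrightarrow> t *\<^sub>R sup x y = sup (t *\<^sub>R x) (t *\<^sub>R (y::'a::banach_lattice))"
  using scaleR_inf[of t "- x" "- y"] by (simp add: sup_eq_neg_inf)

lemma pprt_scaleR: "0 \<le> t \<Longrightarrow> pprt (t *\<^sub>R x) = t *\<^sub>R pprt (x::'a::banach_lattice)"
  by (simp add: pprt_def scaleR_sup)

lemma abs_scaleR: "\<bar>t *\<^sub>R x\<bar> = \<bar>t\<bar> *\<^sub>R \<bar>x::'a::banach_lattice\<bar>"
proof -
  have *: "\<bar>t *\<^sub>R x\<bar> = t *\<^sub>R \<bar>x\<bar>" if "0 \<le> t" for t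
    using that by (simp add: abs_lattice scaleR_sup)
  show ?thesis
    using *[of t] *[of "- t"] by (cases "0 \<le> t") auto
qed

lemma inf_add_pprt_diff: "inf x u + pprt (x - u) = x" for x u :: "'a::banach_lattice"
proof -
  have "pprt (x - u) = x - inf x u"
    by (simp add: pprt_def diff_inf_eq_sup add_sup_distrib_left sup_commute)
  then show ?thesis by simp
qed

lemma inf_add_le: "0 \<le> x \<Longrightarrow> 0 \<le> y \<Longrightarrow> 0 \<le> z \<Longrightarrow> inf (x + y) z \<le> inf x z + inf y (z::'a::banach_lattice)"
  by (simp add: add_inf_distrib_left add_inf_distrib_right)
    (metis add.commute add_increasing add_increasing2 inf_le1 inf_le2 le_inf_iff le_infI1 le_infI2 order_refl)

lemma pprt_add_le: "pprt (x + y) \<le> pprt x + pprt (y::'a::banach_lattice)"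
  by (metis add_mono add_nonneg_nonneg le_sup_iff pprt_def sup_ge1 zero_le_pprt)

lemma abs_sup_diff_le: "\<bar>sup a c - sup b c\<bar> \<le> \<bar>a - b\<bar>" for a b c :: "'a::banach_lattice"
proof -
  have *: "sup a c - sup b c \<le> \<bar>a - b\<bar>" for a b
  proof -
    have "a \<le> b + \<bar>a - b\<bar>" using abs_ge_self[of "a - b"] by (simp add: algebra_simps)
    also have "\<dots> \<le> sup b c + \<bar>a - b\<bar>" by simp
    finally have "sup a c \<le> sup b c + \<bar>a - b\<bar>" by (simp add: add_increasing2)
    then show ?thesis by (simp add: algebra_simps)
  qed
  show ?thesis using *[of a b] *[of b a] by (intro abs_leI) (auto simp: abs_minus_commute)
qed

lemma norm_abs_eq: "norm \<bar>x\<bar> = norm (x::'a::banach_lattice)"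
  by (intro order.antisym norm_mono_abs) auto

lemma norm_mono_nonneg: "0 \<le> x \<Longrightarrow> x \<le> y \<Longrightarrow> norm x \<le> norm (y::'a::banach_lattice)"
  by (intro norm_mono_abs) (metis abs_of_nonneg order_trans)

lemma norm_le_abs: "\<bar>x\<bar> \<le> y \<Longrightarrow> norm x \<le> norm (y::'a::banach_lattice)"
  using norm_mono_nonneg[of "\<bar>x\<bar>" y] by (simp add: norm_abs_eq)

lemma norm_pprt_le: "norm (pprt x) \<le> norm (x::'a::banach_lattice)"
  by (metis norm_abs_eq norm_mono_nonneg pprt_le_abs(1) zero_le_pprt)


lemma twice_inf: "2 *\<^sub>R inf p q = p + q - \<bar>p - q\<bar>" for p q :: "'a::banach_lattice"
proof -
  have "\<bar>p - q\<bar> = pprt (p - q) + pprt (q - p)" by (simp add: abs_eq_pprt_add)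
  then show ?thesis
    using inf_add_pprt_diff[of p q] inf_add_pprt_diff[of q p]
    by (simp add: scaleR_2 inf_commute algebra_simps)
qed

lemma abs_add_self_nonneg: "0 \<le> \<bar>x\<bar> + (x::'a::banach_lattice)"
  using add_right_mono[OF abs_ge_minus_self[of x], of x] by simp

lemma abs_sum_le: "\<bar>sum h A\<bar> \<le> (\<Sum>i\<in>A. \<bar>h i\<bar>)" for h :: "'i \<Rightarrow> 'a::banach_lattice"
proof (induction A rule: infinite_finite_induct)
  case (insert i A)
  have "\<bar>h i + sum h A\<bar> \<le> \<bar>h i\<bar> + \<bar>sum h A\<bar>" by (rule abs_triangle_ineq)
  also have "\<dots> \<le> \<bar>h i\<bar> + (\<Sum>i\<in>A. \<bar>h i\<bar>)" by (rule add_left_mono[OF insert.IH])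
  finally show ?case using insert by simp
qed auto

lemma member_le_sum_lattice:
  fixes f :: "'i \<Rightarrow> 'a::banach_lattice"
  assumes "i \<in> A" "finite A" "\<And>j. j \<in> A \<Longrightarrow> 0 \<le> f j" shows "f i \<le> sum f A"
  using sum_mono2[of A "{i}" f] assms by auto

lemma inf_eq_0_mono: "0 \<le> a \<Longrightarrow> a \<le> a' \<Longrightarrow> 0 \<le> b \<Longrightarrow> b \<le> b' \<Longrightarrow> inf a' b' = 0 \<Longrightarrow> inf a b = (0::'a::banach_lattice)"
  by (metis inf_greatest inf_mono order.antisym)

lemma inf_sum2_eq_0:
  assumes "0 \<le> c" "0 \<le> a" "0 \<le> b" "inf c a = 0" "inf c b = (0::'a::banach_lattice)"
  shows "inf c (a + b) = 0"
proof (rule order.antisym)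
  have "inf (a + b) c \<le> inf a c + inf b c" using assms by (intro inf_add_le)
  then show "inf c (a + b) \<le> 0" using assms by (simp add: inf_commute)
qed (use assms in simp)

lemma inf_sum_eq_0:
  fixes w :: "'i \<Rightarrow> 'a::banach_lattice"
  assumes "0 \<le> v" "\<And>n. n \<in> A \<Longrightarrow> 0 \<le> w n \<and> inf v (w n) = 0"
  shows "inf v (sum w A) = 0"
  using assms(2)
proof (induction A rule: infinite_finite_induct)
  case (insert n A)
  then have "inf v (w n + sum w A) = 0" using assms(1) by (intro inf_sum2_eq_0 sum_nonneg) auto
  then show ?case using insert by simp
qed (use assms(1) in \<open>simp_all add: inf_absorb2\<close>)

lemma inf_disjoint_multiple:
  assumes "0 \<le> w" "0 \<le> b" "inf w b = (0::'a::banach_lattice)" shows "inf w (real n *\<^sub>R b) = 0"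
proof (induction n)
  case (Suc n)
  have "inf (b + real n *\<^sub>R b) w \<le> inf b w + inf (real n *\<^sub>R b) w"
    using assms by (intro inf_add_le scaleR_nonneg_nonneg) auto
  also have "\<dots> = 0" using Suc assms by (simp add: inf_commute)
  finally have "inf w (real (Suc n) *\<^sub>R b) \<le> 0" by (simp add: scaleR_left_distrib inf_commute)
  moreover have "0 \<le> real (Suc n) *\<^sub>R b" using assms by (intro scaleR_nonneg_nonneg) auto
  ultimately show ?case using assms by (intro order.antisym) auto
qed (use assms in \<open>simp add: inf_absorb2\<close>)

text \<open>
  Disjointness survives multiplication by natural numbers, and real factors are dominated by those.
\<close>

lemma inf_scaleR_disjoint:
  fixes a b :: "'a::banach_lattice"
  assumes "0 \<le> a" "0 \<le> b" "inf a b = 0" "0 \<le> s" "0 \<le> t"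
  shows "inf (s *\<^sub>R a) (t *\<^sub>R b) = 0"
proof -
  obtain m n :: nat where mn: "s \<le> real m" "t \<le> real n" using real_arch_simple by metis
  have "inf a (real n *\<^sub>R b) = 0" using assms by (intro inf_disjoint_multiple)
  then have "inf (real n *\<^sub>R b) (real m *\<^sub>R a) = 0"
    using assms by (intro inf_disjoint_multiple scaleR_nonneg_nonneg) (auto simp: inf_commute)
  then have "inf (real m *\<^sub>R a) (real n *\<^sub>R b) = 0" by (simp add: inf_commute)
  then show ?thesis
    by (rule inf_eq_0_mono[rotated 4]) (use assms mn in \<open>auto intro: scaleR_nonneg_nonneg scaleR_right_mono\<close>)
qed

text \<open>
  Sums of disjoint positive elements are suprema.
\<close>

lemma sum_disjoint_le:
  fixes w :: "'i \<Rightarrow> 'a::banach_lattice"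
  assumes "finite A" "0 \<le> u" "\<And>n. n \<in> A \<Longrightarrow> 0 \<le> w n \<and> w n \<le> u"
    and "\<And>m n. m \<in> A \<Longrightarrow> n \<in> A \<Longrightarrow> m \<noteq> n \<Longrightarrow> inf (w m) (w n) = 0"
  shows "sum w A \<le> u"
  using assms
proof (induction A)
  case (insert n A)
  have "inf (w n) (sum w A) = 0" using insert.prems insert.hyps by (intro inf_sum_eq_0) auto
  then have "w n + sum w A = sup (w n) (sum w A)" using add_eq_inf_sup[of "w n" "sum w A"] by simp
  then show ?case using insert by simp
qed simp

text \<open>
  As \<open>\<bar>a\<bar> \<le> \<bar>a + b\<bar> + \<bar>b\<bar>\<close>, and the second summand does not meet \<open>\<bar>a\<bar>\<close>.
\<close>

lemma abs_le_abs_add_disjoint: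
  fixes a b :: "'a::banach_lattice"
  assumes "inf \<bar>a\<bar> \<bar>b\<bar> = 0" shows "\<bar>a\<bar> \<le> \<bar>a + b\<bar>"
proof -
  have "\<bar>a\<bar> \<le> \<bar>a + b\<bar> + \<bar>b\<bar>" using abs_triangle_ineq4[of "a + b" b] by simp
  then have "\<bar>a\<bar> = inf (\<bar>a + b\<bar> + \<bar>b\<bar>) \<bar>a\<bar>" by (simp add: inf_absorb2)
  also have "\<dots> \<le> inf \<bar>a + b\<bar> \<bar>a\<bar> + inf \<bar>b\<bar> \<bar>a\<bar>" by (intro inf_add_le) auto
  also have "\<dots> = inf \<bar>a + b\<bar> \<bar>a\<bar>" using assms by (simp add: inf_commute)
  also have "\<dots> \<le> \<bar>a + b\<bar>" by simp
  finally show ?thesis .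
qed


section \<open>Limits and order\<close>

lemma tendsto_sup_lattice:
  assumes "(f \<longlongrightarrow> (a::'a::banach_lattice)) F" shows "((\<lambda>x. sup (f x) c) \<longlongrightarrow> sup a c) F"
proof -
  have "((\<lambda>x. sup (f x) c - sup a c) \<longlongrightarrow> 0) F"
    using assms[THEN LIM_zero, THEN tendsto_norm_zero]
    by (rule Lim_null_comparison[rotated]) (auto intro!: always_eventually norm_mono_abs abs_sup_diff_le)
  then show ?thesis by (rule LIM_zero_cancel)
qed

lemma tendsto_pprt: "(f \<longlongrightarrow> (a::'a::banach_lattice)) F \<Longrightarrow> ((\<lambda>x. pprt (f x)) \<longlongrightarrow> pprt a) F"
  unfolding pprt_def by (rule tendsto_sup_lattice)

lemma tendsto_inf_both:
  assumes "(f \<longlongrightarrow> (a::'a::banach_lattice)) F" "(h \<longlongrightarrow> b) F"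
  shows "((\<lambda>x. inf (f x) (h x)) \<longlongrightarrow> inf a b) F"
proof -
  have eq: "inf x y = x - pprt (x - y)" for x y :: 'a using inf_add_pprt_diff[of x y] by (simp add: algebra_simps)
  show ?thesis unfolding eq by (intro tendsto_diff tendsto_pprt assms)
qed

lemma tendsto_abs_lattice: "(f \<longlongrightarrow> (a::'a::banach_lattice)) F \<Longrightarrow> ((\<lambda>x. \<bar>f x\<bar>) \<longlongrightarrow> \<bar>a\<bar>) F"
  unfolding abs_eq_pprt_add by (intro tendsto_intros tendsto_pprt)

lemma LIMSEQ_nonneg_lattice:
  assumes "f \<longlonglongrightarrow> (a::'a::banach_lattice)" "\<And>n. n \<ge> N \<Longrightarrow> 0 \<le> f n" shows "0 \<le> a"
proof -
  have "(\<lambda>n. pprt (f n)) \<longlonglongrightarrow> a"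
    using assms(1) by (rule Lim_transform_eventually) (auto simp: eventually_sequentially assms(2) intro!: exI[of _ N])
  with tendsto_pprt[OF assms(1)] have "pprt a = a" using LIMSEQ_unique by blast
  then show ?thesis by (metis zero_le_pprt)
qed

lemma LIMSEQ_le_lattice:
  assumes "f \<longlonglongrightarrow> (a::'a::banach_lattice)" "g \<longlonglongrightarrow> b" "\<And>n. n \<ge> N \<Longrightarrow> f n \<le> g n" shows "a \<le> b"
  using LIMSEQ_nonneg_lattice[OF tendsto_diff[OF assms(2,1)], of N] assms(3) by simp

text \<open>
  The positive cone is closed, and \<open>z\<close> is below the null sequence \<open>y / n\<close>.
\<close>

lemma archimedean_lattice:
  assumes "\<And>n::nat. of_nat n *\<^sub>R z \<le> (y::'a::banach_lattice)" shows "z \<le> 0"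
proof (rule LIMSEQ_le_lattice)
  show "(\<lambda>n. z) \<longlonglongrightarrow> z" by simp
  have "(\<lambda>n. inverse (real (Suc n)) *\<^sub>R y) \<longlonglongrightarrow> 0 *\<^sub>R y"
    by (intro tendsto_scaleR tendsto_const LIMSEQ_inverse_real_of_nat)
  then show "(\<lambda>n. inverse (real (Suc n)) *\<^sub>R y) \<longlonglongrightarrow> 0" by simp
  show "z \<le> inverse (real (Suc n)) *\<^sub>R y" for n
    using assms[of "Suc n"] by (subst pos_le_divideR_eq) auto
qed

section \<open>The order continuous part\<close>

text \<open>
  A description of \<open>E\<^sup>a\<close> by sequences; \<open>order_continuous_part_eq\<close> identifies it with the largest
  closed ideal with order continuous norm.
\<close>

definition oc_elements :: "'a::banach_lattice set" where
  "oc_elements = {x. \<forall>y. incseq y \<and> (\<forall>n. 0 \<le> y n \<and> y n \<le> \<bar>x\<bar>) \<longrightarrow> Cauchy y}"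

lemma oc_elements_convergent:
  assumes "u \<in> oc_elements" "incseq y" "\<And>n. 0 \<le> y n" "\<And>n. y n \<le> u"
  shows "convergent y"
proof -
  have "0 \<le> u" using assms(3,4) order_trans by blast
  with assms show ?thesis by (auto simp: oc_elements_def Cauchy_convergent_iff)
qed

lemma oc_elements_convergent_decreasing:
  assumes "u \<in> oc_elements" "decseq y" "\<And>n. 0 \<le> y n" "\<And>n. y n \<le> u"
  shows "convergent y"
proof -
  have "convergent (\<lambda>n. u - y n)"
    using assms by (intro oc_elements_convergent[of u]) (auto simp: incseq_def decseq_def)
  then have "convergent (\<lambda>n. u - (u - y n))" by (rule convergent_diff[OF convergent_const])
  then show ?thesis by (simp add: algebra_simps)
qed

lemma oc_elements_solid: "x \<in> oc_elements \<Longrightarrow> \<bar>y\<bar> \<le> \<bar>x\<bar> \<Longrightarrow> y \<in> oc_elements"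
  unfolding oc_elements_def mem_Collect_eq by (metis order_trans)

lemma oc_elements_abs_iff: "\<bar>x\<bar> \<in> oc_elements \<longleftrightarrow> x \<in> oc_elements"
  by (simp add: oc_elements_def)

lemma oc_elements_below: "u \<in> oc_elements \<Longrightarrow> 0 \<le> y \<Longrightarrow> y \<le> u \<Longrightarrow> y \<in> oc_elements"
  by (rule oc_elements_solid[of u]) (metis abs_of_nonneg order_trans)+

lemma Cauchy_if_close:
  fixes y :: "nat \<Rightarrow> 'a::real_normed_vector"
  assumes "\<And>e. e > 0 \<Longrightarrow> \<exists>z. Cauchy z \<and> (\<forall>n. norm (y n - z n) < e)"
  shows "Cauchy y"
proof (rule metric_CauchyI)
  fix e :: real assume "e > 0"
  then obtain z where z: "Cauchy z" "\<And>n. norm (y n - z n) < e / 3"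
    using assms[of "e / 3"] by auto
  from metric_CauchyD[OF z(1), of "e / 3"] \<open>e > 0\<close> obtain N
    where N: "\<And>m n. m \<ge> N \<Longrightarrow> n \<ge> N \<Longrightarrow> dist (z m) (z n) < e / 3" by auto
  have "dist (y m) (y n) < e" if "m \<ge> N" "n \<ge> N" for m n
  proof -
    have "dist (y m) (y n) \<le> dist (y m) (z m) + dist (z m) (z n) + dist (z n) (y n)"
      using dist_triangle[of "y m" "y n" "z m"] dist_triangle[of "z m" "y n" "z n"] by linarith
    also have "\<dots> < e" using z(2)[of m] z(2)[of n] N[OF that] by (simp add: dist_norm norm_minus_commute)
    finally show ?thesis .
  qed
  then show "\<exists>M. \<forall>m\<ge>M. \<forall>n\<ge>M. dist (y m) (y n) < e" by blast
qed

text \<open>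
  An increasing sequence below \<open>\<bar>x\<bar> + \<bar>x'\<bar>\<close> is the sum of its truncation at \<open>\<bar>x\<bar>\<close> and of the
  remainder, which is increasing and bounded by \<open>\<bar>x'\<bar>\<close>.
\<close>

lemma oc_elements_add:
  assumes "x \<in> oc_elements" "x' \<in> oc_elements" shows "x + x' \<in> oc_elements"
proof -
  have "Cauchy y" if y: "incseq y" "\<And>n. 0 \<le> y n" "\<And>n. y n \<le> \<bar>x + x'\<bar>" for y
  proof -
    have "convergent (\<lambda>n. inf (y n) \<bar>x\<bar>)"
      using assms(1) y by (intro oc_elements_convergent[of "\<bar>x\<bar>"])
        (auto simp: incseq_def oc_elements_abs_iff intro: le_infI1)
    moreover have "convergent (\<lambda>n. pprt (y n - \<bar>x\<bar>))"
    proof (rule oc_elements_convergent[of "\<bar>x'\<bar>"])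
      have "y n - \<bar>x\<bar> \<le> \<bar>x'\<bar>" for n
        using order_trans[OF y(3) abs_triangle_ineq] by (simp add: algebra_simps)
      then show "pprt (y n - \<bar>x\<bar>) \<le> \<bar>x'\<bar>" for n by (simp add: pprt_def)
    qed (use assms y in \<open>auto simp: incseq_def oc_elements_abs_iff\<close>)
    ultimately have "convergent (\<lambda>n. inf (y n) \<bar>x\<bar> + pprt (y n - \<bar>x\<bar>))" by (rule convergent_add)
    then show ?thesis by (simp add: inf_add_pprt_diff convergent_Cauchy)
  qed
  then show ?thesis by (simp add: oc_elements_def)
qed

lemma subspace_oc_elements: "subspace (oc_elements :: 'a::banach_lattice set)"
proof (rule subspaceI)
  show 0: "(0::'a) \<in> oc_elements"
  proof -
    have "y = (\<lambda>n. 0)" if "\<forall>n. 0 \<le> y n \<and> y n \<le> 0" for y :: "nat \<Rightarrow> 'a"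
      using that by (auto intro: order.antisym)
    moreover have "Cauchy (\<lambda>n::nat. 0 :: 'a)" by (intro convergent_Cauchy convergent_const)
    ultimately show ?thesis by (auto simp: oc_elements_def)
  qed
  fix x :: 'a assume x: "x \<in> oc_elements"
  have n: "of_nat n *\<^sub>R x \<in> oc_elements" for n
    by (induction n) (auto simp: 0 x scaleR_left_distrib oc_elements_add)
  fix t :: real
  obtain n :: nat where "\<bar>t\<bar> \<le> of_nat n" using real_arch_simple by blast
  then show "t *\<^sub>R x \<in> oc_elements"
    by (intro oc_elements_solid[OF n[of n]]) (auto simp: abs_scaleR intro!: scaleR_right_mono)
qed (rule oc_elements_add)

lemmas oc_elements_diff = subspace_diff[OF subspace_oc_elements]
  and oc_elements_scale = subspace_scale[OF subspace_oc_elements]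
  and oc_elements_sum = subspace_sum[OF subspace_oc_elements]
  and oc_elements_0 = subspace_0[OF subspace_oc_elements]

lemma oc_elements_pprt: "x \<in> oc_elements \<Longrightarrow> pprt x \<in> oc_elements"
  by (rule oc_elements_solid[of x]) (auto simp: pprt_le_abs)

text \<open>
  If \<open>f k\<close> is close to \<open>x\<close>, then truncating at \<open>\<bar>f k\<bar>\<close> changes a sequence in \<open>[0, \<bar>x\<bar>]\<close> only
  slightly, uniformly in the index.
\<close>

lemma closed_oc_elements: "closed (oc_elements :: 'a::banach_lattice set)"
proof (unfold closed_sequential_limits, intro allI impI, elim conjE)
  fix f and x :: 'a assume f: "\<forall>n. f n \<in> oc_elements" "f \<longlonglongrightarrow> x"
  have "Cauchy y" if y: "incseq y" "\<And>n. 0 \<le> y n" "\<And>n. y n \<le> \<bar>x\<bar>" for y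
  proof (rule Cauchy_if_close)
    fix e :: real assume "e > 0"
    then obtain k where k: "norm (f k - x) < e"
      using LIMSEQ_D[OF f(2)] by blast
    have "convergent (\<lambda>n. inf (y n) \<bar>f k\<bar>)"
      using f(1) y by (intro oc_elements_convergent[of "\<bar>f k\<bar>"])
        (auto simp: incseq_def oc_elements_abs_iff intro: le_infI1)
    moreover have "norm (y n - inf (y n) \<bar>f k\<bar>) < e" for n
    proof -
      have "y n - \<bar>f k\<bar> \<le> \<bar>x\<bar> - \<bar>f k\<bar>" using y by simp
      also have "\<dots> \<le> \<bar>x - f k\<bar>" by (rule abs_triangle_ineq2)
      finally have "pprt (y n - \<bar>f k\<bar>) \<le> \<bar>x - f k\<bar>" by (simp add: pprt_def)
      then have "norm (pprt (y n - \<bar>f k\<bar>)) \<le> norm (x - f k)"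
        using norm_mono_nonneg[OF zero_le_pprt] by (metis norm_abs_eq)
      moreover have "pprt (y n - \<bar>f k\<bar>) = y n - inf (y n) \<bar>f k\<bar>"
        using inf_add_pprt_diff[of "y n" "\<bar>f k\<bar>"] by (simp add: algebra_simps)
      ultimately show ?thesis using k by (simp add: norm_minus_commute)
    qed
    ultimately show "\<exists>z. Cauchy z \<and> (\<forall>n. norm (y n - z n) < e)"
      by (auto simp: Cauchy_convergent_iff intro!: exI[of _ "\<lambda>n. inf (y n) \<bar>f k\<bar>"])
  qed
  then show "x \<in> oc_elements" by (simp add: oc_elements_def)
qed

lemma order_ideal_oc_elements: "order_ideal_in UNIV (oc_elements :: 'a::banach_lattice set)"
  unfolding order_ideal_in_def using subspace_oc_elements oc_elements_solid by blast

text \<open>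
  Dedekind completeness of \<open>E\<^sup>a\<close>, in the stronger form that suprema of directed sets are norm
  limits. If no element of \<open>A\<close> were within \<open>e\<close> of all larger ones, one could climb for ever in steps
  of norm at least \<open>e\<close>, against the convergence of increasing sequences.
\<close>

lemma oc_directed_sup:
  fixes A :: "'a::banach_lattice set"
  assumes u: "u \<in> oc_elements" and A: "A \<noteq> {}" "\<And>a. a \<in> A \<Longrightarrow> 0 \<le> a \<and> a \<le> u"
    and dir: "\<And>a b. a \<in> A \<Longrightarrow> b \<in> A \<Longrightarrow> \<exists>c\<in>A. a \<le> c \<and> b \<le> c"
  obtains s f where "\<And>a. a \<in> A \<Longrightarrow> a \<le> s" "0 \<le> s" "s \<le> u" "f \<longlonglongrightarrow> s" "\<And>n::nat. f n \<in> A"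
proof -
  have ex: "\<exists>a\<in>A. \<forall>b\<in>A. a \<le> b \<longrightarrow> norm (b - a) < e" if "e > 0" for e
  proof (rule ccontr)
    assume "\<not> ?thesis"
    then have *: "\<forall>a\<in>A. \<exists>b\<in>A. a \<le> b \<and> e \<le> norm (b - a)" by (auto simp: not_less)
    then obtain g where g: "\<And>a. a \<in> A \<Longrightarrow> g a \<in> A \<and> a \<le> g a \<and> e \<le> norm (g a - a)" by metis
    obtain a0 where "a0 \<in> A" using A by blast
    define y where "y n = (g ^^ n) a0" for n
    have yA: "y n \<in> A" for n by (induction n) (auto simp: y_def \<open>a0 \<in> A\<close> g)
    have Suc: "y (Suc n) = g (y n)" for n by (simp add: y_def)
    have "convergent y"
      using yA A(2) g by (intro oc_elements_convergent[OF u]) (auto simp: incseq_Suc_iff Suc)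
    then have "Cauchy y" by (rule convergent_Cauchy)
    then obtain N where "\<And>m n. m \<ge> N \<Longrightarrow> n \<ge> N \<Longrightarrow> norm (y m - y n) < e"
      using CauchyD[OF _ \<open>e > 0\<close>] by blast
    then have "norm (y (Suc N) - y N) < e" by auto
    with g[OF yA[of N]] show False by (simp add: Suc)
  qed
  have "\<forall>n. \<exists>a\<in>A. \<forall>b\<in>A. a \<le> b \<longrightarrow> norm (b - a) < inverse (real (Suc n))"
    using ex by simp
  then obtain a where a: "\<And>n. a n \<in> A" "\<And>n b. b \<in> A \<Longrightarrow> a n \<le> b \<Longrightarrow> norm (b - a n) < inverse (real (Suc n))"
    by metis
  obtain j where j: "\<And>a b. a \<in> A \<Longrightarrow> b \<in> A \<Longrightarrow> j a b \<in> A \<and> a \<le> j a b \<and> b \<le> j a b" using dir by metis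
  \<comment> \<open>An increasing sequence in \<open>A\<close> that passes the element \<open>a n\<close> at step \<open>n\<close>; from there on, moves
     upwards in \<open>A\<close> have norm below \<open>1 / (n + 1)\<close>.\<close>
  define f where "f = rec_nat (a 0) (\<lambda>n x. j x (a (Suc n)))"
  have fS: "f (Suc n) = j (f n) (a (Suc n))" and f0: "f 0 = a 0" for n by (auto simp: f_def)
  have fA: "f n \<in> A" for n by (induction n) (auto simp: f0 fS a j)
  have af: "a n \<le> f n" for n by (cases n) (auto simp: f0 fS a j fA)
  have "convergent f"
    using fA A(2) j a by (intro oc_elements_convergent[OF u]) (auto simp: incseq_Suc_iff fS)
  then obtain s where s: "f \<longlonglongrightarrow> s" by (auto simp: convergent_def)
  have "b \<le> s" if b: "b \<in> A" for b
  proof -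
    have lim: "(\<lambda>n. h n - a n) \<longlonglongrightarrow> 0" if h: "\<And>n. h n \<in> A" "\<And>n. a n \<le> h n" for h
      using a(2)[OF h] by (intro Lim_null_comparison[OF _ LIMSEQ_inverse_real_of_nat])
        (auto intro!: always_eventually less_imp_le simp del: of_nat_Suc)
    have "(\<lambda>n. j b (f n) - a n) \<longlonglongrightarrow> 0"
      by (intro lim) (use j b fA order_trans[OF af] in blast)+
    moreover have "(\<lambda>n. f n - a n) \<longlonglongrightarrow> 0"
      by (intro lim af fA)
    ultimately have "(\<lambda>n. f n + ((j b (f n) - a n) - (f n - a n))) \<longlonglongrightarrow> s + (0 - 0)"
      by (intro tendsto_intros s)
    then have "(\<lambda>n. j b (f n)) \<longlonglongrightarrow> s" by simp
    then show ?thesis by (rule LIMSEQ_le_lattice[OF tendsto_const]) (use j b fA in auto)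
  qed
  moreover have "0 \<le> s" "s \<le> u"
    using LIMSEQ_nonneg_lattice[OF s, of 0] LIMSEQ_le_lattice[OF s tendsto_const, of 0 u] fA A(2) by auto
  ultimately show thesis using that s fA by blast
qed

text \<open>
  The differences \<open>x i0 - x i\<close> of a decreasing net to its value at a fixed index \<open>i0\<close> form a
  directed set. Its supremum \<open>s\<close> is attained in norm, and \<open>x i0 - s\<close> is a lower bound of the net.
\<close>

lemma order_continuous_norm_on_if_oc:
  fixes J :: "'a::banach_lattice set"
  assumes J: "order_ideal_in UNIV J" "J \<subseteq> oc_elements"
  shows "order_continuous_norm_on J"
proof (unfold order_continuous_norm_on_def, intro allI impI)
  fix I :: "'a set" and le x and e :: real
  assume net: "net_decreasing_to_zero J I le x" and "e > 0"
  from net obtain i0 where i0: "i0 \<in> I" unfolding net_decreasing_to_zero_def by blast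
  from net have refl: "\<And>i. i \<in> I \<Longrightarrow> le i i" unfolding net_decreasing_to_zero_def reflp_on_def by blast
  from net have trans: "\<And>i j k. i \<in> I \<Longrightarrow> j \<in> I \<Longrightarrow> k \<in> I \<Longrightarrow> le i j \<Longrightarrow> le j k \<Longrightarrow> le i k"
    unfolding net_decreasing_to_zero_def transp_on_def by blast
  from net have dir: "\<And>i j. i \<in> I \<Longrightarrow> j \<in> I \<Longrightarrow> \<exists>k\<in>I. le i k \<and> le j k" and xJ: "\<And>i. i \<in> I \<Longrightarrow> x i \<in> J"
    and dec: "\<And>i j. i \<in> I \<Longrightarrow> j \<in> I \<Longrightarrow> le i j \<Longrightarrow> x j \<le> x i" and pos: "\<And>i. i \<in> I \<Longrightarrow> 0 \<le> x i"
    and inf: "\<And>z. z \<in> J \<Longrightarrow> (\<forall>i\<in>I. z \<le> x i) \<Longrightarrow> z \<le> 0"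
    unfolding net_decreasing_to_zero_def by blast+
  define A where "A = {x i0 - x i | i. i \<in> I \<and> le i0 i}"
  obtain s f where s: "\<And>a. a \<in> A \<Longrightarrow> a \<le> s" "0 \<le> s" "s \<le> x i0" "f \<longlonglongrightarrow> s" "\<And>n::nat. f n \<in> A"
  proof (rule oc_directed_sup[of "x i0" A])
    show "x i0 \<in> oc_elements" using xJ i0 J by blast
    show "A \<noteq> {}" using i0 refl by (auto simp: A_def)
    show "0 \<le> a \<and> a \<le> x i0" if "a \<in> A" for a using that dec i0 pos by (auto simp: A_def)
    show "\<exists>c\<in>A. a \<le> c \<and> b \<le> c" if ab: "a \<in> A" "b \<in> A" for a b
    proof -
      from ab obtain i j where ij: "i \<in> I" "j \<in> I" "le i0 i" "le i0 j" "a = x i0 - x i" "b = x i0 - x j"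
        by (auto simp: A_def)
      from dir[OF ij(1,2)] obtain k where k: "k \<in> I" "le i k" "le j k" by blast
      then have "x i0 - x k \<in> A" using trans[of i0 i k] ij i0 by (auto simp: A_def)
      then show ?thesis using k ij dec by (intro bexI[of _ "x i0 - x k"]) auto
    qed
  qed (blast intro: that)
  have "x i0 - s \<le> 0"
  proof (rule inf)
    have "\<bar>x i0 - s\<bar> \<le> \<bar>x i0\<bar>" using s(2,3) pos[OF i0] by simp
    then show "x i0 - s \<in> J" using J(1) xJ[OF i0] unfolding order_ideal_in_def by blast
    show "\<forall>i\<in>I. x i0 - s \<le> x i"
    proof
      fix i assume i: "i \<in> I"
      from dir[OF i i0] obtain k where k: "k \<in> I" "le i k" "le i0 k" by blast
      then have "x i0 - x k \<le> s" by (intro s(1)) (auto simp: A_def)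
      then show "x i0 - s \<le> x i" using dec[OF i k(1,2)] by (metis diff_le_eq add.commute order_trans)
    qed
  qed
  then have "s = x i0" using s(3) by (simp add: order.antisym)
  with LIMSEQ_D[OF s(4) \<open>e > 0\<close>] obtain n where "norm (f n - x i0) < e" by blast
  moreover obtain i where i: "i \<in> I" "f n = x i0 - x i" using s(5)[of n] by (auto simp: A_def)
  ultimately have "norm (x i) < e" by simp
  then have "norm (x j) < e" if "j \<in> I" "le i j" for j
    using norm_mono_nonneg[OF pos dec, of j i] that i by auto
  then show "\<exists>i\<in>I. \<forall>j\<in>I. le i j \<longrightarrow> norm (x j) < e" using i by blast
qed

text \<open>
  For an increasing order bounded sequence \<open>y\<close>, the differences \<open>d - y n\<close> with \<open>d\<close> an upper bound
  of \<open>y\<close> form a net with infimum 0, because the lattice is Archimedean. A small such difference bounds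
  all later increments of \<open>y\<close>.
\<close>

lemma oc_if_order_continuous_norm_on:
  fixes J :: "'a::banach_lattice set"
  assumes J: "order_ideal_in UNIV J" and oc: "order_continuous_norm_on J"
  shows "J \<subseteq> oc_elements"
proof
  fix x assume x: "x \<in> J"
  have sub: "subspace J" and solid: "\<And>x y. x \<in> J \<Longrightarrow> \<bar>y\<bar> \<le> \<bar>x\<bar> \<Longrightarrow> y \<in> J"
    using J unfolding order_ideal_in_def by auto
  have "Cauchy y" if y: "incseq y" "\<And>n. 0 \<le> y n" "\<And>n. y n \<le> \<bar>x\<bar>" for y
  proof (rule CauchyI)
    fix e :: real assume e: "e > 0"
    have yJ: "y n \<in> J" for n using solid[OF x] y(2,3) by simp
    define D where "D = {d\<in>J. \<forall>n. y n \<le> d}"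
    define I where "I = {d - y n | d n. d \<in> D}"
    have xD: "\<bar>x\<bar> \<in> D" using solid[OF x, of "\<bar>x\<bar>"] y by (auto simp: D_def)
    have "net_decreasing_to_zero J I (\<ge>) id"
      unfolding net_decreasing_to_zero_def
    proof (intro conjI ballI impI)
      show "I \<noteq> {}" using xD by (auto simp: I_def)
      show "reflp_on I (\<ge>)" by (auto simp: reflp_on_def)
      show "transp_on I (\<ge>)" by (auto simp: transp_on_def)
      show "id ` I \<subseteq> J" using yJ by (auto simp: I_def D_def intro: subspace_diff[OF sub])
      show "0 \<le> id i" if "i \<in> I" for i using that by (auto simp: I_def D_def)
      show "\<exists>k\<in>I. i \<ge> k \<and> j \<ge> k" if ij: "i \<in> I" "j \<in> I" for i j
      proof -
        from ij obtain d m d' n where d: "d \<in> D" "d' \<in> D" "i = d - y m" "j = d' - y n" by (auto simp: I_def)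
        have D: "0 \<le> d" if "d \<in> D" for d using that order_trans[OF y(2)[of 0], of d] by (auto simp: D_def)
        then have "inf d d' \<in> J" using d(1,2) by (rule_tac solid[of d]) (auto simp: D_def)
        then have "inf d d' \<in> D" using d by (auto simp: D_def)
        then have "inf d d' - y (max m n) \<in> I" by (auto simp: I_def)
        moreover have "inf d d' - y (max m n) \<le> d - y m" "inf d d' - y (max m n) \<le> d' - y n"
          using y(1) by (auto intro!: diff_mono simp: incseq_def)
        ultimately show ?thesis using d by blast
      qed
      fix z assume z: "z \<in> J" "\<forall>i\<in>I. z \<le> id i"
      have "\<bar>x\<bar> - of_nat k *\<^sub>R z \<in> D" for k
      proof (induction k)
        case (Suc k)
        have "y n \<le> \<bar>x\<bar> - of_nat k *\<^sub>R z - z" for n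
        proof -
          have "z \<le> \<bar>x\<bar> - of_nat k *\<^sub>R z - y n" using Suc z(2) by (fastforce simp: I_def)
          then show ?thesis by (simp add: algebra_simps)
        qed
        moreover have "\<bar>x\<bar> - of_nat k *\<^sub>R z - z \<in> J" using Suc z by (auto simp: D_def intro: subspace_diff[OF sub])
        ultimately show ?case by (simp add: D_def scaleR_left_distrib algebra_simps)
      qed (use xD in simp)
      then have "y 0 \<le> \<bar>x\<bar> - of_nat k *\<^sub>R z" for k by (auto simp: D_def)
      then have "of_nat k *\<^sub>R z \<le> \<bar>x\<bar> - y 0" for k by (simp add: algebra_simps)
      then show "z \<le> 0" by (rule archimedean_lattice)
    qed auto
    with oc e obtain i where i: "i \<in> I" "norm i < e" unfolding order_continuous_norm_on_def
      by (metis id_apply order_refl)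
    then obtain d k where d: "d \<in> D" "i = d - y k" by (auto simp: I_def)
    have *: "norm (y m - y n) < e" if "k \<le> n" "n \<le> m" for m n
    proof -
      have "0 \<le> y m - y n" "y m - y n \<le> d - y k"
        using y(1) that d by (auto simp: incseq_def D_def intro!: diff_mono)
      with norm_mono_nonneg d i show ?thesis by fastforce
    qed
    then show "\<exists>M. \<forall>m\<ge>M. \<forall>n\<ge>M. norm (y m - y n) < e"
      by (intro exI[of _ k]) (metis linorder_linear norm_minus_commute)
  qed
  then show "x \<in> oc_elements" by (simp add: oc_elements_def)
qed

lemma order_continuous_part_eq: "order_continuous_part = (oc_elements :: 'a::banach_lattice set)"
  unfolding order_continuous_part_def
  by (rule Greatest_equality)
    (auto simp: order_ideal_oc_elements closed_oc_elements order_continuous_norm_on_if_oc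
      dest: oc_if_order_continuous_norm_on)

lemma order_continuous_norm_on_UNIV_iff:
  "order_continuous_norm_on (UNIV :: 'a::banach_lattice set) \<longleftrightarrow> (oc_elements :: 'a set) = UNIV"
proof -
  have "order_ideal_in UNIV (UNIV :: 'a set)" by (simp add: order_ideal_in_def)
  then show ?thesis
    using order_continuous_norm_on_if_oc[of "UNIV :: 'a set"] oc_if_order_continuous_norm_on[of "UNIV :: 'a set"] by auto
qed

section \<open>Disjoint sequences\<close>

text \<open>
  In function spaces: a point of \<open>[0, 2kh]\<close> has distance at most \<open>h\<close> from one of the points
  \<open>0, 2h, \<dots>, 2kh\<close>. The induction adds one grid point at a time.
\<close>

lemma abs_grid:
  fixes m h z :: "'a::banach_lattice"
  assumes m: "0 \<le> m" and h: "0 \<le> h" and z: "\<And>j. j \<le> k \<Longrightarrow> z \<le> \<bar>m - (2 * real j) *\<^sub>R h\<bar>"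
  shows "z \<le> sup h (m - (2 * real k) *\<^sub>R h)"
  using z
proof (induction k)
  case 0
  from 0[of 0] m show ?case by (simp add: le_supI2)
next
  case (Suc k)
  define s where "s = m - (2 * real (Suc k)) *\<^sub>R h"
  have eq: "m - (2 * real k) *\<^sub>R h = s + 2 *\<^sub>R h" by (simp add: s_def algebra_simps)
  have "inf (s + 2 *\<^sub>R h) (- s) \<le> h"
  proof -
    have "2 *\<^sub>R inf (s + 2 *\<^sub>R h) (- s) \<le> (s + 2 *\<^sub>R h) + (- s)" by (simp only: twice_inf) simp
    then have "2 *\<^sub>R inf (s + 2 *\<^sub>R h) (- s) \<le> 2 *\<^sub>R h" by simp
    then show ?thesis by (subst (asm) scaleR_le_cancel_left_pos) auto
  qed
  then have "inf (sup h (s + 2 *\<^sub>R h)) (sup s (- s)) \<le> sup h s"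
    by (simp add: inf_sup_distrib1 inf_sup_distrib2 le_supI1 le_supI2)
  moreover have "z \<le> sup h (s + 2 *\<^sub>R h)" using Suc.IH Suc.prems unfolding eq by simp
  moreover have "z \<le> sup s (- s)" using Suc.prems[of "Suc k"] by (simp add: s_def abs_lattice)
  ultimately show ?case unfolding s_def[symmetric] by (meson inf_greatest order_trans)
qed

text \<open>
  The \<open>j\<close>-th summand is positive only where the step from \<open>a\<close> to \<open>b\<close> crosses the level \<open>(j / k) x\<close>. A step
  that exceeds \<open>x / k\<close> crosses the level next to its midpoint by a margin comparable to its
  size. This is the identity \<open>2 inf p q = p + q - \<bar>p - q\<bar>\<close> together with \<open>abs_grid\<close>.
\<close>

lemma level_crossing:
  fixes a b x :: "'a::banach_lattice"
  assumes "0 \<le> a" "a \<le> b" "b \<le> x" and k: "0 < k"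
  shows "b - a \<le> inverse (real k) *\<^sub>R x +
    2 *\<^sub>R (\<Sum>j\<le>k. inf (pprt (b - (real j / real k) *\<^sub>R x)) (pprt ((real j / real k) *\<^sub>R x - a)))"
    (is "_ \<le> ?h + 2 *\<^sub>R (\<Sum>j\<le>k. ?w j)")
proof -
  have x: "0 \<le> x" using assms by order
  have "b - a - 2 *\<^sub>R (\<Sum>j\<le>k. ?w j) \<le> sup ?h ((a + b) - (2 * real k) *\<^sub>R ?h)"
  proof (rule abs_grid)
    fix j assume j: "j \<le> k"
    let ?c = "(real j / real k) *\<^sub>R x"
    have eq: "2 *\<^sub>R inf (b - ?c) (?c - a) = (b - a) - \<bar>(a + b) - (2 * real j) *\<^sub>R ?h\<bar>"
      unfolding twice_inf by (simp add: field_simps scaleR_2[symmetric])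
    have "inf (b - ?c) (?c - a) \<le> ?w j" by (intro inf_mono) (auto simp: pprt_def)
    moreover have "?w j \<le> (\<Sum>j\<le>k. ?w j)" using j by (intro member_le_sum_lattice) auto
    ultimately have "2 *\<^sub>R inf (b - ?c) (?c - a) \<le> 2 *\<^sub>R (\<Sum>j\<le>k. ?w j)"
      by (intro scaleR_left_mono) (order | simp)+
    with eq have "(b - a) - \<bar>(a + b) - (2 * real j) *\<^sub>R ?h\<bar> \<le> 2 *\<^sub>R (\<Sum>j\<le>k. ?w j)" by simp
    then show "b - a - 2 *\<^sub>R (\<Sum>j\<le>k. ?w j) \<le> \<bar>(a + b) - (2 * real j) *\<^sub>R ?h\<bar>"
      by (simp add: algebra_simps)
  qed (use assms x in \<open>auto intro: scaleR_nonneg_nonneg\<close>)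
  also have "\<dots> = ?h"
  proof -
    have "a + b \<le> 2 *\<^sub>R x" unfolding scaleR_2 using assms by (intro add_mono) order+
    moreover have "2 * real k * inverse (real k) = 2" using k by simp
    ultimately have "(a + b) - (2 * real k) *\<^sub>R ?h \<le> 0" by (simp only: scaleR_scaleR) simp
    also have "0 \<le> ?h" using x k by (intro scaleR_nonneg_nonneg) auto
    finally show ?thesis by (rule sup_absorb1)
  qed
  finally show ?thesis by (simp add: algebra_simps)
qed

text \<open>
  For an increasing sequence, the parts of different steps that cross the same level are disjoint.
  So these parts tend to 0 for each of the finitely many levels, and \<open>level_crossing\<close> bounds
  the steps themselves. Applied to subsequences, this gives the Cauchy property.
\<close>

theorem oc_elements_if_disjoint_null:
  fixes x :: "'a::banach_lattice"
  assumes null: "\<And>w :: nat \<Rightarrow> 'a. (\<And>n. 0 \<le> w n \<and> w n \<le> \<bar>x\<bar>) \<Longrightarrow>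
    (\<And>m n. m \<noteq> n \<Longrightarrow> inf (w m) (w n) = 0) \<Longrightarrow> w \<longlonglongrightarrow> 0"
  shows "x \<in> oc_elements"
proof -
  have step: "(\<lambda>n. z (Suc n) - z n) \<longlonglongrightarrow> 0" if z: "incseq z" "\<And>n. 0 \<le> z n" "\<And>n. z n \<le> \<bar>x\<bar>" for z
  proof (rule LIMSEQ_I)
    fix e :: real assume e: "e > 0"
    obtain k :: nat where k: "norm x / (e / 2) < real k" "0 < k"
      using reals_Archimedean2[of "max (norm x / (e / 2)) 0"] by auto
    define w where "w j n = inf (pprt (z (Suc n) - (real j / real k) *\<^sub>R \<bar>x\<bar>)) (pprt ((real j / real k) *\<^sub>R \<bar>x\<bar> - z n))" for j n
    have disj: "inf (w j m) (w j n) = 0" if "m < n" for j m n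
    proof -
      let ?c = "(real j / real k) *\<^sub>R \<bar>x\<bar>"
      have "z (Suc m) \<le> z n" using that z(1) by (auto simp: incseq_def)
      then have "pprt (?c - z n) \<le> pprt (?c - z (Suc m))" by (intro pprt_mono) simp
      moreover have "inf (pprt (z (Suc m) - ?c)) (pprt (?c - z (Suc m))) = 0"
        using inf_pprt_pprt_minus[of "z (Suc m) - ?c"] by simp
      ultimately show ?thesis
        by (rule_tac inf_eq_0_mono[of _ "pprt (z (Suc m) - ?c)" _ "pprt (?c - z (Suc m))"]) (auto simp: w_def intro: le_infI2)
    qed
    have "w j \<longlonglongrightarrow> 0" for j
    proof (rule null)
      show "0 \<le> w j n \<and> w j n \<le> \<bar>x\<bar>" for n
      proof -
        have "0 \<le> (real j / real k) *\<^sub>R \<bar>x\<bar>" by (intro scaleR_nonneg_nonneg) auto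
        then have "z (Suc n) - (real j / real k) *\<^sub>R \<bar>x\<bar> \<le> z (Suc n)" by simp
        also have "\<dots> \<le> \<bar>x\<bar>" by (rule z)
        finally have "pprt (z (Suc n) - (real j / real k) *\<^sub>R \<bar>x\<bar>) \<le> \<bar>x\<bar>" by (simp add: pprt_def)
        then show ?thesis by (auto simp: w_def intro: le_infI1)
      qed
      show "inf (w j m) (w j n) = 0" if "m \<noteq> n" for m n
        using that disj[of m n] disj[of n m] by (auto simp: neq_iff inf_commute)
    qed
    then have "(\<lambda>n. 2 *\<^sub>R (\<Sum>j\<le>k. w j n)) \<longlonglongrightarrow> 2 *\<^sub>R (\<Sum>j\<le>k. 0)"
      by (intro tendsto_intros)
    then have "(\<lambda>n. 2 *\<^sub>R (\<Sum>j\<le>k. w j n)) \<longlonglongrightarrow> 0" by simp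
    from LIMSEQ_D[OF this, of "e / 2"] e obtain N where N: "\<And>n. n \<ge> N \<Longrightarrow> norm (2 *\<^sub>R (\<Sum>j\<le>k. w j n)) < e / 2"
      by auto
    have "norm (z (Suc n) - z n - 0) < e" if "n \<ge> N" for n
    proof -
      have "z n \<le> z (Suc n)" using z(1) by (simp add: incseq_Suc_iff)
      then have "norm (z (Suc n) - z n) \<le> norm (inverse (real k) *\<^sub>R \<bar>x\<bar> + 2 *\<^sub>R (\<Sum>j\<le>k. w j n))"
        unfolding w_def using z k(2) by (intro norm_mono_nonneg level_crossing) auto
      also have "\<dots> \<le> norm (inverse (real k) *\<^sub>R \<bar>x\<bar>) + norm (2 *\<^sub>R (\<Sum>j\<le>k. w j n))" by (rule norm_triangle_ineq)
      also have "norm (inverse (real k) *\<^sub>R \<bar>x\<bar>) < e / 2" using k e by (simp add: norm_abs_eq field_simps)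
      finally show ?thesis using N[OF that] by simp
    qed
    then show "\<exists>N. \<forall>n\<ge>N. norm (z (Suc n) - z n - 0) < e" by blast
  qed
  have "Cauchy y" if y: "incseq y" "\<And>n. 0 \<le> y n" "\<And>n. y n \<le> \<bar>x\<bar>" for y
  proof (rule ccontr)
    assume "\<not> Cauchy y"
    then obtain e where e: "e > 0" "\<And>N. \<exists>m\<ge>N. \<exists>n\<ge>N. e \<le> norm (y m - y n)"
      unfolding Cauchy_iff by (auto simp: not_less)
    have "\<exists>m\<ge>N. e / 2 \<le> norm (y m - y N)" for N
    proof -
      from e(2)[of N] obtain m n where mn: "m \<ge> N" "n \<ge> N" "e \<le> norm (y m - y n)" by blast
      have "norm (y m - y n) \<le> norm (y m - y N) + norm (y n - y N)"
        using norm_triangle_ineq4[of "y m - y N" "y n - y N"] by simp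
      then have "e / 2 \<le> norm (y m - y N) \<or> e / 2 \<le> norm (y n - y N)" using mn by linarith
      then show ?thesis using mn by blast
    qed
    then obtain g where g: "\<And>N. N \<le> g N" "\<And>N. e / 2 \<le> norm (y (g N) - y N)" by metis
    \<comment> \<open>A subsequence all of whose steps have norm at least \<open>e / 2\<close>.\<close>
    define r where "r n = (g ^^ n) 0" for n
    have "(\<lambda>n. y (r (Suc n)) - y (r n)) \<longlonglongrightarrow> 0"
      using y g(1) by (intro step) (auto simp: incseq_Suc_iff r_def intro: incseqD)
    from LIMSEQ_D[OF this, of "e / 2"] e(1) obtain N where "norm (y (r (Suc N)) - y (r N) - 0) < e / 2" by auto
    with g(2)[of "r N"] show False by (simp add: r_def)
  qed
  then show ?thesis by (simp add: oc_elements_def)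
qed

text \<open>
  The partial sums increase and stay below \<open>u\<close>, so the series converges.
\<close>

lemma oc_elements_disjoint_null:
  fixes w :: "nat \<Rightarrow> 'a::banach_lattice"
  assumes "u \<in> oc_elements" "\<And>n. 0 \<le> w n \<and> w n \<le> u" "\<And>m n. m \<noteq> n \<Longrightarrow> inf (w m) (w n) = 0"
  shows "w \<longlonglongrightarrow> 0"
proof -
  have u: "0 \<le> u" using assms(2)[of 0] order_trans by blast
  have "convergent (\<lambda>n. sum w {..<n})"
    using assms u by (intro oc_elements_convergent[of u]) (auto simp: incseq_Suc_iff intro!: sum_nonneg sum_disjoint_le)
  then have "summable w" by (simp add: summable_iff_convergent)
  then show ?thesis by (rule summable_LIMSEQ_zero)
qed


section \<open>L-weakly compact sets\<close>

lemma L_weakly_compact_subset_interval: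
  fixes A :: "'a::banach_lattice set"
  assumes "u \<in> oc_elements" "A \<noteq> {}" "\<And>x. x \<in> A \<Longrightarrow> \<bar>x\<bar> \<le> u"
  shows "L_weakly_compact A"
  unfolding L_weakly_compact_def
proof (intro conjI allI impI)
  show "bounded A" using assms(3) norm_le_abs unfolding bounded_iff by blast
  fix x :: "nat \<Rightarrow> 'a"
  assume x: "(\<forall>n. x n \<in> solid_hull A) \<and> (\<forall>m n. m \<noteq> n \<longrightarrow> lattice_disjoint (x m) (x n))"
  have "(\<lambda>n. \<bar>x n\<bar>) \<longlonglongrightarrow> 0"
    using x assms by (intro oc_elements_disjoint_null[of u])
      (auto simp: solid_hull_def lattice_disjoint_def, meson order_trans)
  then show "(\<lambda>n. norm (x n)) \<longlonglongrightarrow> 0" using tendsto_norm_zero by (fastforce simp: norm_abs_eq)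
qed fact

lemma L_weakly_compact_imp_oc:
  assumes "L_weakly_compact A" "x \<in> A" shows "x \<in> oc_elements"
proof (rule oc_elements_if_disjoint_null)
  fix w :: "nat \<Rightarrow> 'a"
  assume w: "\<And>n. 0 \<le> w n \<and> w n \<le> \<bar>x\<bar>" "\<And>m n. m \<noteq> n \<Longrightarrow> inf (w m) (w n) = 0"
  have "(\<forall>n. w n \<in> solid_hull A) \<and> (\<forall>m n. m \<noteq> n \<longrightarrow> lattice_disjoint (w m) (w n))"
    using w assms(2) by (auto simp: solid_hull_def lattice_disjoint_def)
  then show "w \<longlonglongrightarrow> 0" using assms(1) unfolding L_weakly_compact_def
    by (auto intro: tendsto_norm_zero_cancel)
qed

text \<open>
  Otherwise, choose \<open>a n\<close> in \<open>A\<close> that exceeds the multiple \<open>4 ^ n\<close> of the sum \<open>s n\<close> of all earlier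
  moduli by more than \<open>e\<close>. Since \<open>X\<close> is above every \<open>2\<^sup>-\<^sup>n \<bar>a n\<bar>\<close>, the parts
  \<open>v n = (\<bar>a n\<bar> - 4\<^sup>n s n - 2\<^sup>-\<^sup>n X)\<^sup>+\<close> are disjoint, while their norms do not tend to 0.
\<close>

lemma L_weakly_compact_almost_order_bounded:
  fixes A :: "'a::banach_lattice set"
  assumes A: "L_weakly_compact A" and e: "e > 0"
  shows "\<exists>u\<in>oc_elements. 0 \<le> u \<and> (\<forall>x\<in>A. norm (pprt (\<bar>x\<bar> - u)) \<le> e)"
proof (rule ccontr)
  assume not: "\<not> ?thesis"
  then have "\<exists>x\<in>A. e < norm (pprt (\<bar>x\<bar> - u))" if "u \<in> oc_elements" "0 \<le> u" for u
    using that by (auto simp: not_le)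
  then obtain g where g: "\<And>u. u \<in> oc_elements \<Longrightarrow> 0 \<le> u \<Longrightarrow> g u \<in> A \<and> e < norm (pprt (\<bar>g u\<bar> - u))" by metis
  define s where "s = rec_nat 0 (\<lambda>n s. s + \<bar>g ((4 ^ n) *\<^sub>R s)\<bar>)"
  define a where "a n = g ((4 ^ n) *\<^sub>R s n)" for n
  have s0: "s 0 = 0" and sS: "s (Suc n) = s n + \<bar>a n\<bar>" for n by (auto simp: s_def a_def)
  have s: "s n \<in> oc_elements \<and> 0 \<le> s n \<and> a n \<in> A" for n
  proof (induction n)
    case 0 then show ?case using g[of 0] by (simp add: s0 oc_elements_0 a_def)
  next
    case (Suc n)
    then have "s (Suc n) \<in> oc_elements \<and> 0 \<le> s (Suc n)"
      using L_weakly_compact_imp_oc[OF A, of "a n"] by (auto simp: sS oc_elements_abs_iff intro: oc_elements_add)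
    then show ?case using g[of "(4 ^ Suc n) *\<^sub>R s (Suc n)"] by (auto simp: a_def oc_elements_scale scaleR_nonneg_nonneg)
  qed
  have big: "e < norm (pprt (\<bar>a n\<bar> - (4 ^ n) *\<^sub>R s n))" for n
    using g[of "(4 ^ n) *\<^sub>R s n"] s[of n] by (auto simp: a_def oc_elements_scale scaleR_nonneg_nonneg)
  have as: "\<bar>a m\<bar> \<le> s n" if "m < n" for m n
    using that
  proof (induction n)
    case (Suc n) then show ?case using s[of n] by (cases "m = n") (auto simp: sS intro: add_increasing add_increasing2)
  qed simp
  obtain C where C: "\<And>x. x \<in> A \<Longrightarrow> norm x \<le> C" using A unfolding L_weakly_compact_def bounded_iff by blast
  have summ: "summable (\<lambda>n. (1/2) ^ n *\<^sub>R \<bar>a n\<bar>)"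
  proof (rule summable_comparison_test')
    show "summable (\<lambda>n. (1/2) ^ n * C)" by (intro summable_mult2 summable_geometric) auto
    show "norm ((1/2) ^ n *\<^sub>R \<bar>a n\<bar>) \<le> (1/2) ^ n * C" if "0 \<le> n" for n
      using C s[of n] by (simp add: norm_abs_eq divide_simps)
  qed
  define X where "X = (\<Sum>n. (1/2) ^ n *\<^sub>R \<bar>a n\<bar>)"
  have aX: "(1/2) ^ n *\<^sub>R \<bar>a n\<bar> \<le> X" for n
  proof (rule LIMSEQ_le_lattice[OF tendsto_const summable_LIMSEQ[OF summ, folded X_def], of "Suc n"])
    fix N assume "Suc n \<le> N"
    then show "(1/2) ^ n *\<^sub>R \<bar>a n\<bar> \<le> (\<Sum>n<N. (1/2) ^ n *\<^sub>R \<bar>a n\<bar>)"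
      by (intro member_le_sum_lattice) (auto intro: scaleR_nonneg_nonneg)
  qed
  have X0: "0 \<le> X" using order_trans[OF abs_ge_zero, of "a 0" X] aX[of 0] by simp
  define v where "v n = pprt (\<bar>a n\<bar> - (4 ^ n) *\<^sub>R s n - (1/2) ^ n *\<^sub>R X)" for n
  have v0: "0 \<le> v n" for n by (simp add: v_def)
  \<comment> \<open>Both are dominated by the positive and the negative part of one element: \<open>v n\<close> lives where
     \<open>\<bar>a n\<bar>\<close> is large compared with \<open>\<bar>a m\<bar>\<close>, and \<open>v m\<close> where it is not.\<close>
  have disj: "inf (v m) (v n) = 0" if mn: "m < n" for m n
  proof (rule inf_eq_0_mono)
    let ?p = "4 ^ n *\<^sub>R \<bar>a m\<bar> - \<bar>a n\<bar>"
    show "inf (pprt ?p) (pprt (- ?p)) = 0" by (rule inf_pprt_pprt_minus)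
    have "v n \<le> pprt (\<bar>a n\<bar> - 4 ^ n *\<^sub>R \<bar>a m\<bar>)"
    proof -
      have "4 ^ n *\<^sub>R \<bar>a m\<bar> \<le> 4 ^ n *\<^sub>R s n" by (intro scaleR_left_mono as mn) auto
      moreover have "0 \<le> (1/2) ^ n *\<^sub>R X" by (intro scaleR_nonneg_nonneg X0) auto
      ultimately have "4 ^ n *\<^sub>R \<bar>a m\<bar> + 0 \<le> 4 ^ n *\<^sub>R s n + (1/2) ^ n *\<^sub>R X" by (rule add_mono)
      then show ?thesis unfolding v_def diff_diff_eq by (intro pprt_mono diff_left_mono) simp
    qed
    then show "v n \<le> pprt (- ?p)" by simp
    have "v m \<le> pprt (\<bar>a m\<bar> - (1/2) ^ m *\<^sub>R ((1/2) ^ n *\<^sub>R \<bar>a n\<bar>))"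
    proof -
      have "(1/2) ^ m *\<^sub>R ((1/2) ^ n *\<^sub>R \<bar>a n\<bar>) \<le> (1/2) ^ m *\<^sub>R X" by (intro scaleR_left_mono aX) auto
      moreover have "0 \<le> 4 ^ m *\<^sub>R s m" using s[of m] by (intro scaleR_nonneg_nonneg) auto
      ultimately have "0 + (1/2) ^ m *\<^sub>R ((1/2) ^ n *\<^sub>R \<bar>a n\<bar>) \<le> 4 ^ m *\<^sub>R s m + (1/2) ^ m *\<^sub>R X" by (intro add_mono)
      then show ?thesis unfolding v_def diff_diff_eq by (intro pprt_mono diff_left_mono) simp
    qed
    also have "\<dots> \<le> pprt ?p"
    proof -
      have "pprt (\<bar>a m\<bar> - (1/2) ^ m *\<^sub>R ((1/2) ^ n *\<^sub>R \<bar>a n\<bar>)) \<le> 4 ^ n *\<^sub>R pprt (\<bar>a m\<bar> - (1/2) ^ m *\<^sub>R ((1/2) ^ n *\<^sub>R \<bar>a n\<bar>))"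
        (is "?q \<le> _") using scaleR_right_mono[of 1 "4 ^ n" ?q] by simp
      also have "\<dots> = pprt (4 ^ n *\<^sub>R \<bar>a m\<bar> - (4 ^ n * (1/2) ^ m * (1/2) ^ n) *\<^sub>R \<bar>a n\<bar>)"
        by (simp add: pprt_scaleR[symmetric] scaleR_diff_right mult.assoc)
      also have "\<dots> \<le> pprt ?p"
      proof -
        have "(2::real) ^ m * 2 ^ n \<le> 2 ^ n * 2 ^ n" using mn by (intro mult_right_mono power_increasing) auto
        also have "\<dots> = 4 ^ n" by (simp add: power_mult_distrib[symmetric])
        finally have "1 \<le> (4 ^ n * (1/2) ^ m * (1/2) ^ n :: real)" by (simp add: field_simps power_divide)
        then have "1 *\<^sub>R \<bar>a n\<bar> \<le> (4 ^ n * (1/2) ^ m * (1/2) ^ n) *\<^sub>R \<bar>a n\<bar>" by (intro scaleR_right_mono) auto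
        then show ?thesis by (intro pprt_mono diff_left_mono) simp
      qed
      finally show ?thesis .
    qed
    finally show "v m \<le> pprt ?p" .
  qed (rule v0)+
  have "v n \<in> solid_hull A" for n
  proof -
    have "0 \<le> 4 ^ n *\<^sub>R s n + (1/2) ^ n *\<^sub>R X" using s[of n] X0
      by (intro add_nonneg_nonneg scaleR_nonneg_nonneg) auto
    then have "v n \<le> pprt \<bar>a n\<bar>" unfolding v_def diff_diff_eq
      by (intro pprt_mono) (simp only: diff_le_eq le_add_same_cancel1)
    then show ?thesis using s[of n] v0 unfolding solid_hull_def by (intro CollectI bexI[of _ "a n"]) auto
  qed
  moreover have "lattice_disjoint (v m) (v n)" if "m \<noteq> n" for m n
    using that disj[of m n] disj[of n m] v0 by (auto simp: lattice_disjoint_def neq_iff inf_commute)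
  ultimately have "(\<lambda>n. norm (v n)) \<longlonglongrightarrow> 0" using A unfolding L_weakly_compact_def by blast
  moreover have "(\<lambda>n. (1/2) ^ n * norm X) \<longlonglongrightarrow> 0 * norm X"
    by (intro tendsto_intros LIMSEQ_realpow_zero) auto
  ultimately have "(\<lambda>n. norm (v n) + (1/2) ^ n * norm X) \<longlonglongrightarrow> 0 + 0 * norm X" by (rule tendsto_add)
  moreover have "e \<le> norm (v n) + (1/2) ^ n * norm X" for n
  proof -
    let ?b = "\<bar>a n\<bar> - 4 ^ n *\<^sub>R s n" and ?x = "(1/2) ^ n *\<^sub>R X"
    have "0 \<le> ?x" by (intro scaleR_nonneg_nonneg X0) auto
    then have "pprt ?b \<le> v n + ?x" using pprt_add_le[of "?b - ?x" ?x] by (simp add: v_def)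
    then have "norm (pprt ?b) \<le> norm (v n + ?x)" by (intro norm_mono_nonneg) auto
    also have "\<dots> \<le> norm (v n) + norm ?x" by (rule norm_triangle_ineq)
    finally show ?thesis using big[of n] by simp
  qed
  ultimately have "e \<le> 0 + 0 * norm X" by (intro LIMSEQ_le_const) auto
  with e show False by simp
qed

section \<open>The Hahn--Banach theorem\<close>

definition sublinear :: "('a::real_vector \<Rightarrow> real) \<Rightarrow> bool" where
  "sublinear p \<longleftrightarrow> (\<forall>x y. p (x + y) \<le> p x + p y) \<and> (\<forall>t\<ge>0. \<forall>x. p (t *\<^sub>R x) = t * p x)"

lemma sublinearI:
  assumes "\<And>x y. p (x + y) \<le> p x + p y" "p 0 = 0" "\<And>t x. t > 0 \<Longrightarrow> p (t *\<^sub>R x) \<le> t * p x"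
  shows "sublinear p"
proof -
  have "p (t *\<^sub>R x) = t * p x" if "0 \<le> t" for t x
  proof (cases "t = 0")
    case False
    with that have t: "0 < t" by simp
    have "p (inverse t *\<^sub>R (t *\<^sub>R x)) \<le> inverse t * p (t *\<^sub>R x)" using t by (intro assms(3)) simp
    with t have "t * p x \<le> p (t *\<^sub>R x)" by (simp add: field_simps)
    with assms(3)[OF t] show ?thesis by (intro order.antisym)
  qed (simp add: assms(2))
  then show ?thesis using assms(1) by (simp add: sublinear_def)
qed

lemma sublinearD:
  assumes "sublinear p"
  shows "p (x + y) \<le> p x + p y" "0 \<le> t \<Longrightarrow> p (t *\<^sub>R x) = t * p x" "p 0 = 0" "- p (- x) \<le> p x"
proof -
  show 1: "p (x + y) \<le> p x + p y" "0 \<le> t \<Longrightarrow> p (t *\<^sub>R x) = t * p x" for x y t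
    using assms by (auto simp: sublinear_def)
  show 0: "p 0 = 0" using 1(2)[of 0 0] by simp
  show "- p (- x) \<le> p x" using 1(1)[of x "- x"] 0 by simp
qed

text \<open>
  A minimal sublinear functional equals its own shift \<open>r\<close> in every direction \<open>y\<close>. By the last
  inequality it is then superadditive, hence additive.
\<close>

lemma sublinear_shift:
  fixes p :: "'a::real_vector \<Rightarrow> real" and y :: 'a
  assumes p: "sublinear p"
  defines "r \<equiv> \<lambda>x. INF t\<in>{0..}. p (x + t *\<^sub>R y) - t * p y"
  shows "sublinear r" "r x \<le> p x" "r x \<le> p (x + y) - p y"
proof -
  have lower: "- p (- x) \<le> p (x + t *\<^sub>R y) - t * p y" if "t \<ge> 0" for x t
    using sublinearD(1)[OF p, of "x + t *\<^sub>R y" "- x"] sublinearD(2)[OF p that, of y] by simp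
  have bdd: "bdd_below ((\<lambda>t. p (x + t *\<^sub>R y) - t * p y) ` {0..})" for x
    using lower by (intro bdd_belowI2) auto
  have r: "r x \<le> p (x + t *\<^sub>R y) - t * p y" if "t \<ge> 0" for x t
    unfolding r_def using that by (intro cINF_lower[OF bdd]) auto
  have rI: "c \<le> r x" if "\<And>t. t \<ge> 0 \<Longrightarrow> c \<le> p (x + t *\<^sub>R y) - t * p y" for c x
    unfolding r_def using that by (intro cINF_greatest) auto
  show "r x \<le> p x" "r x \<le> p (x + y) - p y" using r[of 0 x] r[of 1 x] by auto
  show "sublinear r"
  proof (rule sublinearI)
    fix x x'
    have *: "r (x + x') \<le> (p (x + t *\<^sub>R y) - t * p y) + (p (x' + t' *\<^sub>R y) - t' * p y)" if "t \<ge> 0" "t' \<ge> 0" for t t'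
    proof -
      have "r (x + x') \<le> p ((x + x') + (t + t') *\<^sub>R y) - (t + t') * p y" using that by (intro r) auto
      also have "(x + x') + (t + t') *\<^sub>R y = (x + t *\<^sub>R y) + (x' + t' *\<^sub>R y)" by (simp add: algebra_simps)
      finally show ?thesis using sublinearD(1)[OF p, of "x + t *\<^sub>R y" "x' + t' *\<^sub>R y"] by (simp add: algebra_simps)
    qed
    have "r (x + x') - (p (x + t *\<^sub>R y) - t * p y) \<le> r x'" if "t \<ge> 0" for t
      using *[OF that] by (intro rI) (simp add: algebra_simps)
    then have "r (x + x') - r x' \<le> r x" by (intro rI) (simp add: algebra_simps)
    then show "r (x + x') \<le> r x + r x'" by simp
  next
    show "r 0 = 0" using r[of 0 0] rI[of 0 0] lower[of _ 0] sublinearD(3)[OF p] by (intro order.antisym) auto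
  next
    fix s :: real and x assume s: "s > 0"
    have "inverse s * r (s *\<^sub>R x) \<le> r x"
    proof (rule rI)
      fix t :: real assume t: "t \<ge> 0"
      have "r (s *\<^sub>R x) \<le> p (s *\<^sub>R x + (s * t) *\<^sub>R y) - (s * t) * p y" using s t by (intro r) auto
      also have "s *\<^sub>R x + (s * t) *\<^sub>R y = s *\<^sub>R (x + t *\<^sub>R y)" by (simp add: algebra_simps)
      also have "p \<dots> = s * p (x + t *\<^sub>R y)" using s by (intro sublinearD(2)[OF p]) auto
      finally show "inverse s * r (s *\<^sub>R x) \<le> p (x + t *\<^sub>R y) - t * p y" using s by (simp add: field_simps)
    qed
    then show "r (s *\<^sub>R x) \<le> s * r x" using s by (simp add: field_simps)
  qed
qed

text \<open>
  For two members of a chain, one is below the other, and its subadditivity bounds the infimum.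
\<close>

lemma sublinear_chain_Inf:
  fixes p :: "'a::real_vector \<Rightarrow> real" and C :: "('a \<Rightarrow> real) set"
  assumes C: "C \<noteq> {}" "\<And>q. q \<in> C \<Longrightarrow> sublinear q \<and> (\<forall>x. q x \<le> p x)"
    and chain: "\<And>q q'. q \<in> C \<Longrightarrow> q' \<in> C \<Longrightarrow> (\<forall>x. q x \<le> q' x) \<or> (\<forall>x. q' x \<le> q x)"
  defines "u \<equiv> \<lambda>x. INF q\<in>C. q x"
  shows "sublinear u" "q \<in> C \<Longrightarrow> u x \<le> q x"
proof -
  have bdd: "bdd_below ((\<lambda>q. q x) ` C)" for x
  proof (rule bdd_belowI2)
    fix q assume "q \<in> C"
    then show "- p (- x) \<le> q x" using C(2)[of q] sublinearD(4)[of q x] by (meson neg_le_iff_le order_trans)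
  qed
  show u: "u x \<le> q x" if "q \<in> C" for q x unfolding u_def using that by (intro cINF_lower[OF bdd])
  have uI: "c \<le> u x" if "\<And>q. q \<in> C \<Longrightarrow> c \<le> q x" for c x unfolding u_def using that C(1) by (intro cINF_greatest)
  show "sublinear u"
  proof (rule sublinearI)
    fix x y
    have *: "u (x + y) \<le> q x + q' y" if q: "q \<in> C" "q' \<in> C" for q q'
    proof -
      obtain m where m: "m \<in> C" "m x \<le> q x" "m y \<le> q' y" using chain[OF q] q by blast
      then show ?thesis using u[OF m(1), of "x + y"] C(2)[OF m(1)] sublinearD(1)[of m x y] by linarith
    qed
    have "u (x + y) - q x \<le> u y" if "q \<in> C" for q using *[OF that] by (intro uI) (simp add: algebra_simps)
    then have "u (x + y) - u y \<le> u x" by (intro uI) (simp add: algebra_simps)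
    then show "u (x + y) \<le> u x + u y" by simp
  next
    have "q 0 = 0" if "q \<in> C" for q using C(2)[OF that] sublinearD(3) by blast
    then show "u 0 = 0" using C(1) uI[of 0 0] u[of _ 0] by (metis all_not_in_conv order.antisym order_refl)
  next
    fix t :: real and x assume t: "t > 0"
    have "inverse t * u (t *\<^sub>R x) \<le> u x"
    proof (rule uI)
      fix q assume q: "q \<in> C"
      then have "u (t *\<^sub>R x) \<le> t * q x" using u[OF q, of "t *\<^sub>R x"] C(2)[OF q] sublinearD(2)[of q t x] t by auto
      then show "inverse t * u (t *\<^sub>R x) \<le> q x" using t by (simp add: field_simps)
    qed
    then show "u (t *\<^sub>R x) \<le> t * u x" using t by (simp add: field_simps)
  qed
qed

text \<open>
  Zorn's lemma gives a minimal sublinear functional below \<open>p\<close>. Starting from the shift of \<open>p\<close> in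
  direction \<open>x0\<close> forces the value \<open>p x0\<close> at \<open>x0\<close>.
\<close>

theorem hahn_banach:
  fixes p :: "'a::real_vector \<Rightarrow> real"
  assumes p: "sublinear p"
  obtains f where "linear f" "\<And>x. f x \<le> p x" "f x0 = p x0"
proof -
  define r where "r = (\<lambda>x. INF t\<in>{0..}. p (x + t *\<^sub>R x0) - t * p x0)"
  have r: "sublinear r" "\<And>x. r x \<le> p x" "\<And>x. r x \<le> p (x + x0) - p x0"
    unfolding r_def by (rule sublinear_shift[OF p])+
  define A where "A = {q. sublinear q \<and> (\<forall>x. q x \<le> r x)}"
  define P where "P = (\<lambda>q q' :: 'a \<Rightarrow> real. \<forall>x. q' x \<le> q x)"
  have "\<exists>q\<in>A. \<forall>q'\<in>A. P q q' \<longrightarrow> q' = q"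
  proof (rule predicate_Zorn)
    show "partial_order_on A (relation_of P A)"
      by (rule partial_order_on_relation_ofI) (auto simp: P_def fun_eq_iff intro: order_trans order.antisym)
    fix C assume "C \<in> Chains (relation_of P A)"
    then have CA: "C \<subseteq> A" and chain: "\<And>q q'. q \<in> C \<Longrightarrow> q' \<in> C \<Longrightarrow> P q q' \<or> P q' q"
      unfolding Chains_def relation_of_def by blast+
    show "\<exists>u\<in>A. \<forall>q\<in>C. P q u"
    proof (cases "C = {}")
      case True
      then show ?thesis using r(1) by (auto simp: A_def)
    next
      case False
      have C: "\<And>q. q \<in> C \<Longrightarrow> sublinear q \<and> (\<forall>x. q x \<le> r x)" using CA by (auto simp: A_def)
      have ch: "\<And>q q'. q \<in> C \<Longrightarrow> q' \<in> C \<Longrightarrow> (\<forall>x. q x \<le> q' x) \<or> (\<forall>x. q' x \<le> q x)"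
        using chain unfolding P_def by blast
      have u1: "sublinear (\<lambda>x. INF q\<in>C. q x)"
        by (rule sublinear_chain_Inf(1)[OF False, of r]) (fact C, fact ch)
      have u2: "(INF q\<in>C. q x) \<le> q' x" if "q' \<in> C" for q' x
        by (rule sublinear_chain_Inf(2)[OF False, of r]) (fact C, fact ch, fact that)
      obtain q0 where q0: "q0 \<in> C" using False by blast
      have "(INF q\<in>C. q x) \<le> r x" for x using order_trans[OF u2[OF q0]] C[OF q0] by blast
      then have "(\<lambda>x. INF q\<in>C. q x) \<in> A" using u1 by (simp add: A_def)
      then show ?thesis
        by (rule_tac x = "\<lambda>x. INF q\<in>C. q x" in bexI) (simp_all add: P_def u2)
    qed
  qed
  then obtain q where q: "q \<in> A" and min: "\<And>q'. q' \<in> A \<Longrightarrow> P q q' \<Longrightarrow> q' = q" by blast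
  have sq: "sublinear q" and qr: "\<And>x. q x \<le> r x" using q by (auto simp: A_def)
  have add: "q (x + y) = q x + q y" for x y
  proof (rule order.antisym)
    define s where "s = (\<lambda>x. INF t\<in>{0..}. q (x + t *\<^sub>R y) - t * q y)"
    have s: "sublinear s" "\<And>x. s x \<le> q x" "\<And>x. s x \<le> q (x + y) - q y"
      unfolding s_def by (rule sublinear_shift[OF sq])+
    have "s = q" using s(1,2) qr by (intro min) (auto simp: A_def P_def intro: order_trans)
    then show "q x + q y \<le> q (x + y)" using s(3)[of x] by simp
  qed (rule sublinearD(1)[OF sq])
  have minus: "q (- x) = - q x" for x using add[of x "- x"] sublinearD(3)[OF sq] by simp
  have "linear q"
  proof (rule linearI[OF add])
    fix t :: real and x
    show "q (t *\<^sub>R x) = t *\<^sub>R q x"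
      using sublinearD(2)[OF sq, of t x] sublinearD(2)[OF sq, of "- t" x] minus[of "t *\<^sub>R x"]
      by (cases "0 \<le> t") auto
  qed
  moreover have qp: "q x \<le> p x" for x using qr r(2) order_trans by blast
  moreover have "q x0 = p x0"
  proof (rule order.antisym)
    show "p x0 \<le> q x0" using qr[of "- x0"] r(3)[of "- x0"] minus[of x0] sublinearD(3)[OF p] by simp
  qed (rule qp)
  ultimately show thesis using that by blast
qed

definition positive_functional :: "('a::banach_lattice \<Rightarrow> real) \<Rightarrow> bool" where
  "positive_functional f \<longleftrightarrow> bounded_linear f \<and> (\<forall>x\<ge>0. 0 \<le> f x)"

text \<open>
  The sublinear functional \<open>\<parallel>x\<^sup>+\<parallel>\<close> vanishes on negative elements, so every linear functional below
  it is positive.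
\<close>

lemma positive_functional_norming:
  fixes x0 :: "'a::banach_lattice"
  assumes "0 \<le> x0"
  obtains f where "positive_functional f" "\<And>x. \<bar>f x\<bar> \<le> norm x" "f x0 = norm x0"
proof -
  have "sublinear (\<lambda>x::'a. norm (pprt x))"
  proof (rule sublinearI)
    fix x y :: 'a
    have "norm (pprt (x + y)) \<le> norm (pprt x + pprt y)" by (intro norm_mono_nonneg pprt_add_le) auto
    also have "\<dots> \<le> norm (pprt x) + norm (pprt y)" by (rule norm_triangle_ineq)
    finally show "norm (pprt (x + y)) \<le> norm (pprt x) + norm (pprt y)" .
  qed (auto simp: pprt_scaleR)
  then obtain f where f: "linear f" "\<And>x. f x \<le> norm (pprt x)" "f x0 = norm (pprt x0)"
    using hahn_banach[of "\<lambda>x::'a. norm (pprt x)" x0] by blast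
  have le: "\<bar>f x\<bar> \<le> norm x" for x
    using f(2)[of x] f(2)[of "- x"] norm_pprt_le[of x] norm_pprt_le[of "- x"] linear_neg[OF f(1), of x]
    by (auto simp: abs_le_iff)
  then have "bounded_linear f" using f(1)
    by (auto simp: bounded_linear_def bounded_linear_axioms_def intro!: exI[of _ 1])
  moreover have "0 \<le> f x" if "0 \<le> x" for x
    using f(2)[of "- x"] linear_neg[OF f(1), of x] that by simp
  ultimately show thesis using that[of f] le f(3) assms by (simp add: positive_functional_def)
qed

definition linear_map_on :: "'a::real_vector set \<Rightarrow> ('a \<Rightarrow> 'b::real_vector) \<Rightarrow> bool" where
  "linear_map_on J f \<longleftrightarrow> (\<forall>x\<in>J. \<forall>y\<in>J. f (x + y) = f x + f y) \<and> (\<forall>t. \<forall>x\<in>J. f (t *\<^sub>R x) = t *\<^sub>R f x)"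

text \<open>
  The functional \<open>p\<close> is the largest sublinear one that is below \<open>g\<close> on \<open>J\<close> and below \<open>C\<close> times the
  norm. A linear functional below \<open>p\<close> agrees with \<open>g\<close> on \<open>J\<close>, as \<open>J\<close> is a subspace.
\<close>

lemma linear_map_on_extend:
  fixes g :: "'a::real_normed_vector \<Rightarrow> real"
  assumes J: "subspace J" and g: "linear_map_on J g" and C: "0 \<le> C" "\<And>x. x \<in> J \<Longrightarrow> \<bar>g x\<bar> \<le> C * norm x"
  obtains f where "bounded_linear f" "\<And>x. x \<in> J \<Longrightarrow> f x = g x"
proof -
  have gadd: "\<And>x y. x \<in> J \<Longrightarrow> y \<in> J \<Longrightarrow> g (x + y) = g x + g y" and gsc: "\<And>t x. x \<in> J \<Longrightarrow> g (t *\<^sub>R x) = t * g x"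
    using g by (auto simp: linear_map_on_def)
  have J0: "0 \<in> J" using subspace_0[OF J] .
  have g0: "g 0 = 0" using gsc[OF J0, of 0] by simp
  define p where "p x = (INF y\<in>J. g y + C * norm (x - y))" for x
  have lower: "- C * norm x \<le> g y + C * norm (x - y)" if "y \<in> J" for x y
  proof -
    have "norm y \<le> norm x + norm (x - y)" using norm_triangle_ineq4[of x "x - y"] by simp
    then have "C * norm y \<le> C * norm x + C * norm (x - y)" using C(1) by (metis distrib_left mult_left_mono)
    then show ?thesis using C(2)[OF that] by linarith
  qed
  have bdd: "bdd_below ((\<lambda>y. g y + C * norm (x - y)) ` J)" for x
    using lower by (intro bdd_belowI2)
  have pl: "p x \<le> g y + C * norm (x - y)" if "y \<in> J" for x y
    unfolding p_def using that by (intro cINF_lower[OF bdd])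
  have pI: "c \<le> p x" if "\<And>y. y \<in> J \<Longrightarrow> c \<le> g y + C * norm (x - y)" for c x
    unfolding p_def using that J0 by (intro cINF_greatest) auto
  have "sublinear p"
  proof (rule sublinearI)
    fix x x'
    have *: "p (x + x') \<le> (g y + C * norm (x - y)) + (g y' + C * norm (x' - y'))" if y: "y \<in> J" "y' \<in> J" for y y'
    proof -
      have "p (x + x') \<le> g (y + y') + C * norm ((x + x') - (y + y'))" using y J by (intro pl) (auto intro: subspace_add)
      moreover have "norm ((x + x') - (y + y')) \<le> norm (x - y) + norm (x' - y')" by (rule norm_diff_triangle_ineq)
      then have "C * norm ((x + x') - (y + y')) \<le> C * norm (x - y) + C * norm (x' - y')"
        using C(1) by (metis distrib_left mult_left_mono)
      ultimately show ?thesis using gadd[OF y] by linarith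
    qed
    have "p (x + x') - (g y + C * norm (x - y)) \<le> p x'" if "y \<in> J" for y
      using *[OF that] by (intro pI) (simp add: algebra_simps)
    then have "p (x + x') - p x' \<le> p x" by (intro pI) (simp add: algebra_simps)
    then show "p (x + x') \<le> p x + p x'" by simp
  next
    show "p 0 = 0" using pl[OF J0, of 0] g0 pI[of 0 0] lower[of _ 0] by (intro order.antisym) auto
  next
    fix s :: real and x assume s: "s > 0"
    have "inverse s * p (s *\<^sub>R x) \<le> p x"
    proof (rule pI)
      fix y assume y: "y \<in> J"
      have "p (s *\<^sub>R x) \<le> g (s *\<^sub>R y) + C * norm (s *\<^sub>R x - s *\<^sub>R y)" using y J by (intro pl) (auto intro: subspace_scale)
      also have "\<dots> = s * (g y + C * norm (x - y))"
        using s by (simp only: gsc[OF y] scaleR_diff_right[symmetric] norm_scaleR) (simp add: distrib_left)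
      finally show "inverse s * p (s *\<^sub>R x) \<le> g y + C * norm (x - y)" using s by (simp add: field_simps)
    qed
    then show "p (s *\<^sub>R x) \<le> s * p x" using s by (simp add: field_simps)
  qed
  then obtain f where f: "linear f" "\<And>x. f x \<le> p x" using hahn_banach[of p 0] by blast
  have pC: "p x \<le> C * norm x" for x using pl[OF J0, of x] g0 by simp
  have "norm (f x) \<le> norm x * C" for x
    using f(2)[of x] f(2)[of "- x"] pC[of x] pC[of "- x"] linear_neg[OF f(1), of x]
    by (simp add: abs_le_iff mult.commute)
  then have "bounded_linear f"
    by (intro bounded_linear_intro[of f C]) (auto simp: linear_add[OF f(1)] linear_scale[OF f(1)])
  moreover have "f x = g x" if x: "x \<in> J" for x
  proof (rule order.antisym)
    have le: "f x \<le> g x" if "x \<in> J" for x using f(2)[of x] pl[OF that, of x] by simp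
    show "f x \<le> g x" by (rule le[OF x])
    show "g x \<le> f x"
      using le[OF subspace_neg[OF J x]] gsc[OF x, of "-1"] linear_neg[OF f(1), of x] by simp
  qed
  ultimately show thesis by (rule that)
qed

section \<open>Truncation limits and band projections\<close>

lemma linear_map_onD:
  assumes J: "subspace J" and f: "linear_map_on J f"
  shows "x \<in> J \<Longrightarrow> y \<in> J \<Longrightarrow> f (x + y) = f x + f y"
    and "x \<in> J \<Longrightarrow> f (t *\<^sub>R x) = t *\<^sub>R f x"
    and "f 0 = 0"
    and "x \<in> J \<Longrightarrow> f (- x) = - f x"
    and "x \<in> J \<Longrightarrow> y \<in> J \<Longrightarrow> f (x - y) = f x - f y"
    and "(\<And>i. i \<in> I \<Longrightarrow> h i \<in> J) \<Longrightarrow> f (sum h I) = (\<Sum>i\<in>I. f (h i))"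
proof -
  show add: "x \<in> J \<Longrightarrow> y \<in> J \<Longrightarrow> f (x + y) = f x + f y" for x y
    using f by (auto simp: linear_map_on_def)
  show sc: "x \<in> J \<Longrightarrow> f (t *\<^sub>R x) = t *\<^sub>R f x" for x t
    using f by (auto simp: linear_map_on_def)
  show 0: "f 0 = 0" using sc[of 0 0] subspace_0[OF J] by simp
  show neg: "x \<in> J \<Longrightarrow> f (- x) = - f x" for x using sc[of x "-1"] by simp
  show "x \<in> J \<Longrightarrow> y \<in> J \<Longrightarrow> f (x - y) = f x - f y"
    using add[of x "- y"] neg[of y] subspace_neg[OF J, of y] by simp
  show "(\<And>i. i \<in> I \<Longrightarrow> h i \<in> J) \<Longrightarrow> f (sum h I) = (\<Sum>i\<in>I. f (h i))"
    by (induction I rule: infinite_finite_induct) (auto simp: 0 add subspace_sum[OF J])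
qed

text \<open>
  Applying \<open>g\<close> to \<open>(x + y)\<^sup>+ + x\<^sup>- + y\<^sup>- = (x + y)\<^sup>- + x\<^sup>+ + y\<^sup>+\<close> carries additivity over from
  the positive cone.
\<close>

lemma linear_map_on_from_cone:
  fixes g :: "'a::banach_lattice \<Rightarrow> 'b::real_vector"
  assumes J: "subspace J" "\<And>x. x \<in> J \<Longrightarrow> pprt x \<in> J"
    and split: "\<And>x. x \<in> J \<Longrightarrow> g x = g (pprt x) - g (pprt (- x))"
    and add: "\<And>x y. x \<in> J \<Longrightarrow> y \<in> J \<Longrightarrow> 0 \<le> x \<Longrightarrow> 0 \<le> y \<Longrightarrow> g (x + y) = g x + g y"
    and scale: "\<And>t x. x \<in> J \<Longrightarrow> 0 \<le> x \<Longrightarrow> 0 \<le> t \<Longrightarrow> g (t *\<^sub>R x) = t *\<^sub>R g x"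
  shows "linear_map_on J g"
proof -
  have neg: "- x \<in> J" if "x \<in> J" for x using subspace_neg[OF J(1) that] .
  have "g (x + y) = g x + g y" if xy: "x \<in> J" "y \<in> J" for x y
  proof -
    let ?a = "pprt (x + y)" and ?b = "pprt (- (x + y))"
    have mem: "?a \<in> J" "?b \<in> J" "pprt x \<in> J" "pprt (- x) \<in> J" "pprt y \<in> J" "pprt (- y) \<in> J"
      "pprt (- x) + pprt (- y) \<in> J" "pprt x + pprt y \<in> J"
      using xy J neg by (auto intro!: subspace_add[OF J(1)] J(2) neg simp del: minus_add_distrib)
    have "?a + (pprt (- x) + pprt (- y)) = ?b + (pprt x + pprt y)"
      using pprt_diff[of "x + y"] pprt_diff[of x] pprt_diff[of y] by (simp add: algebra_simps)
    then have "g (?a + (pprt (- x) + pprt (- y))) = g (?b + (pprt x + pprt y))" by simp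
    then have "g ?a + (g (pprt (- x)) + g (pprt (- y))) = g ?b + (g (pprt x) + g (pprt y))"
      using mem by (simp add: add del: minus_add_distrib)
    then have "g ?a = g ?b + (g (pprt x) + g (pprt y)) - (g (pprt (- x)) + g (pprt (- y)))"
      by (simp only: eq_diff_eq)
    moreover have "g (x + y) = g ?a - g ?b" using xy J(1) by (intro split subspace_add)
    ultimately have "g (x + y) = g ?b + (g (pprt x) + g (pprt y)) - (g (pprt (- x)) + g (pprt (- y))) - g ?b"
      by (simp only:)
    also have "\<dots> = (g (pprt x) - g (pprt (- x))) + (g (pprt y) - g (pprt (- y)))" by (simp add: algebra_simps)
    finally show ?thesis by (simp only: split[OF xy(1)] split[OF xy(2)])
  qed
  moreover have "g (t *\<^sub>R x) = t *\<^sub>R g x" if x: "x \<in> J" for t x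
  proof -
    have *: "g (t *\<^sub>R x) = t *\<^sub>R g x" if x: "x \<in> J" and t: "t \<ge> 0" for t x
    proof -
      have "g (t *\<^sub>R x) = g (pprt (t *\<^sub>R x)) - g (pprt (- (t *\<^sub>R x)))" using x J(1) by (intro split subspace_scale)
      also have "\<dots> = g (t *\<^sub>R pprt x) - g (t *\<^sub>R pprt (- x))"
        using pprt_scaleR[OF t, of x] pprt_scaleR[OF t, of "- x"] by simp
      also have "\<dots> = t *\<^sub>R (g (pprt x) - g (pprt (- x)))" using x t J neg by (simp add: scale scaleR_diff_right)
      finally show ?thesis using split[OF x] by simp
    qed
    have "g (- x) = - g x" using split[OF x] split[OF neg[OF x]] by simp
    then show ?thesis using *[OF x, of t] *[OF neg[OF x], of "- t"] by (cases "t \<ge> 0") auto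
  qed
  ultimately show ?thesis by (simp add: linear_map_on_def)
qed

text \<open>
  With this instance, truncation limits cover operators and functionals at once.
\<close>

instance real :: banach_lattice
  by standard (auto simp: sup_real_def abs_real_def)

text \<open>
  For positive \<open>x\<close> this is the limit of \<open>\<Phi> (inf x (n b))\<close>, that is, \<open>\<Phi>\<close> applied to the part of
  \<open>x\<close> in the band generated by \<open>b\<close>. If \<open>\<Phi>\<close> is a functional, this makes sense even if that band
  is not a projection band.
\<close>

definition trunc_lim :: "('a::banach_lattice \<Rightarrow> 'b::banach_lattice) \<Rightarrow> 'a \<Rightarrow> 'a \<Rightarrow> 'b" where
  "trunc_lim \<Phi> b x = lim (\<lambda>n. \<Phi> (inf (pprt x) (real n *\<^sub>R b))) - lim (\<lambda>n. \<Phi> (inf (pprt (- x)) (real n *\<^sub>R b)))"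

lemma inf_scaleR_mono_nat: "0 \<le> b \<Longrightarrow> m \<le> n \<Longrightarrow> inf x (real m *\<^sub>R b) \<le> inf x (real n *\<^sub>R (b::'a::banach_lattice))"
  by (intro inf_mono scaleR_right_mono) auto

text \<open>
  Two cases are used: the identity on \<open>E\<^sup>a\<close>, and positive functionals on the whole lattice.
\<close>

locale truncation =
  fixes J :: "'a::banach_lattice set" and b :: 'a and \<Phi> :: "'a \<Rightarrow> 'b::banach_lattice"
  assumes J: "order_ideal_in UNIV J" and b: "0 \<le> b"
    and \<Phi>: "bounded_linear \<Phi>" "\<And>x. 0 \<le> x \<Longrightarrow> 0 \<le> \<Phi> x"
    and conv: "\<And>x. x \<in> J \<Longrightarrow> 0 \<le> x \<Longrightarrow> convergent (\<lambda>n. \<Phi> (inf x (real n *\<^sub>R b)))"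
begin

lemma J_subspace: "subspace J" and J_solid: "x \<in> J \<Longrightarrow> \<bar>y\<bar> \<le> \<bar>x\<bar> \<Longrightarrow> y \<in> J"
  using J by (auto simp: order_ideal_in_def)

lemma J_pprt: "x \<in> J \<Longrightarrow> pprt x \<in> J"
  by (rule J_solid[of x]) (auto simp: pprt_le_abs)

lemma \<Phi>_mono: "x \<le> y \<Longrightarrow> \<Phi> x \<le> \<Phi> y"
  using \<Phi>(2)[of "y - x"] by (simp add: bounded_linear.linear[OF \<Phi>(1)] linear_diff)

lemma \<Phi>_0: "\<Phi> 0 = 0"
  using \<Phi>(1) by (simp add: bounded_linear.linear linear_0)

lemma nb: "0 \<le> real n *\<^sub>R b"
  using b by (simp add: scaleR_nonneg_nonneg)

lemma trunc_lim_LIMSEQ: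
  assumes "x \<in> J" "0 \<le> x" shows "(\<lambda>n. \<Phi> (inf x (real n *\<^sub>R b))) \<longlonglongrightarrow> trunc_lim \<Phi> b x"
proof -
  have "trunc_lim \<Phi> b x = lim (\<lambda>n. \<Phi> (inf x (real n *\<^sub>R b)))"
    using assms(2) nb by (simp add: trunc_lim_def inf_absorb1 \<Phi>_0 lim_const)
  then show ?thesis using conv[OF assms] by (simp add: convergent_LIMSEQ_iff)
qed

lemma trunc_lim_upper:
  assumes "x \<in> J" "0 \<le> x" shows "\<Phi> (inf x (real n *\<^sub>R b)) \<le> trunc_lim \<Phi> b x"
  by (rule LIMSEQ_le_lattice[OF tendsto_const trunc_lim_LIMSEQ[OF assms], of n])
    (intro \<Phi>_mono inf_scaleR_mono_nat b)

lemma trunc_lim_bounds: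
  assumes "x \<in> J" "0 \<le> x" shows "0 \<le> trunc_lim \<Phi> b x" "trunc_lim \<Phi> b x \<le> \<Phi> x"
proof -
  have "0 \<le> \<Phi> (inf x (real n *\<^sub>R b))" "\<Phi> (inf x (real n *\<^sub>R b)) \<le> \<Phi> x" for n
    using assms nb by (simp_all add: \<Phi>(2) \<Phi>_mono)
  note bounds = this
  show "0 \<le> trunc_lim \<Phi> b x"
    by (rule LIMSEQ_nonneg_lattice[OF trunc_lim_LIMSEQ[OF assms]]) (rule bounds)
  show "trunc_lim \<Phi> b x \<le> \<Phi> x"
    by (rule LIMSEQ_le_lattice[OF trunc_lim_LIMSEQ[OF assms] tendsto_const]) (rule bounds)
qed

lemma trunc_lim_self:
  assumes "b \<in> J" shows "trunc_lim \<Phi> b b = \<Phi> b"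
proof -
  have "\<Phi> (inf b (real 1 *\<^sub>R b)) \<le> trunc_lim \<Phi> b b" by (rule trunc_lim_upper[OF assms b])
  then show ?thesis using trunc_lim_bounds(2)[OF assms b] by simp
qed

lemma trunc_lim_disjoint:
  assumes "w \<in> J" "0 \<le> w" "inf w b = 0" shows "trunc_lim \<Phi> b w = 0"
  using trunc_lim_LIMSEQ[OF assms(1,2)] inf_disjoint_multiple[OF assms(2) b assms(3)]
  by (simp add: \<Phi>_0 LIMSEQ_const_iff)

text \<open>
  Truncation is subadditive, and conversely \<open>inf x (n b) + inf y (n b) \<le> inf (x + y) (2 n b)\<close>; in the
  limit the factor 2 is harmless.
\<close>

lemma trunc_lim_add:
  assumes x: "x \<in> J" "0 \<le> x" and y: "y \<in> J" "0 \<le> y"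
  shows "trunc_lim \<Phi> b (x + y) = trunc_lim \<Phi> b x + trunc_lim \<Phi> b y"
proof (rule order.antisym)
  have xy: "x + y \<in> J" "0 \<le> x + y" using x y J_subspace by (auto intro: subspace_add)
  have \<Phi>_add: "\<Phi> (v + w) = \<Phi> v + \<Phi> w" for v w using \<Phi>(1) by (simp add: bounded_linear.linear linear_add)
  note lim = trunc_lim_LIMSEQ[OF x] trunc_lim_LIMSEQ[OF y]
  have le: "\<Phi> (inf (x + y) (real n *\<^sub>R b)) \<le> \<Phi> (inf x (real n *\<^sub>R b)) + \<Phi> (inf y (real n *\<^sub>R b))" for n
    unfolding \<Phi>_add[symmetric] using x y nb by (intro \<Phi>_mono inf_add_le)
  show "trunc_lim \<Phi> b (x + y) \<le> trunc_lim \<Phi> b x + trunc_lim \<Phi> b y"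
    using LIMSEQ_le_lattice[OF trunc_lim_LIMSEQ[OF xy] tendsto_add[OF lim], of 0] le by simp
  have "\<Phi> (inf x (real n *\<^sub>R b)) + \<Phi> (inf y (real n *\<^sub>R b)) \<le> trunc_lim \<Phi> b (x + y)" for n
  proof -
    have "inf x (real n *\<^sub>R b) + inf y (real n *\<^sub>R b) \<le> inf (x + y) (real (n + n) *\<^sub>R b)"
      unfolding of_nat_add scaleR_left_distrib by (intro le_infI add_mono inf_le1 inf_le2)
    from order_trans[OF \<Phi>_mono[OF this] trunc_lim_upper[OF xy]] show ?thesis by (simp add: \<Phi>_add)
  qed
  then show "trunc_lim \<Phi> b x + trunc_lim \<Phi> b y \<le> trunc_lim \<Phi> b (x + y)"
    using LIMSEQ_le_lattice[OF tendsto_add[OF lim] tendsto_const, of 0] by blast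
qed

lemma trunc_lim_scale:
  assumes x: "x \<in> J" "0 \<le> x" and t: "0 \<le> t"
  shows "trunc_lim \<Phi> b (t *\<^sub>R x) = t *\<^sub>R trunc_lim \<Phi> b x"
proof -
  have \<Phi>_scale: "\<Phi> (t *\<^sub>R v) = t *\<^sub>R \<Phi> v" for t v using \<Phi>(1) by (simp add: bounded_linear.linear linear_scale)
  have le: "trunc_lim \<Phi> b (t *\<^sub>R x) \<le> t *\<^sub>R trunc_lim \<Phi> b x" if x: "x \<in> J" "0 \<le> x" and t: "0 < t" for t x
  proof (rule LIMSEQ_le_lattice[OF trunc_lim_LIMSEQ tendsto_const])
    show "t *\<^sub>R x \<in> J" "0 \<le> t *\<^sub>R x" using x t J_subspace by (auto intro: subspace_scale scaleR_nonneg_nonneg)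
    fix n :: nat
    obtain N :: nat where N: "real n / t \<le> real N" using real_arch_simple by blast
    have "real n *\<^sub>R b \<le> (t * real N) *\<^sub>R b" using N t by (intro scaleR_right_mono b) (simp add: field_simps)
    then have "inf (t *\<^sub>R x) (real n *\<^sub>R b) \<le> t *\<^sub>R inf x (real N *\<^sub>R b)"
      using t by (simp add: scaleR_inf le_infI2)
    from \<Phi>_mono[OF this] have "\<Phi> (inf (t *\<^sub>R x) (real n *\<^sub>R b)) \<le> t *\<^sub>R \<Phi> (inf x (real N *\<^sub>R b))"
      by (simp add: \<Phi>_scale)
    also have "\<dots> \<le> t *\<^sub>R trunc_lim \<Phi> b x" using t by (intro scaleR_left_mono trunc_lim_upper x) auto
    finally show "\<Phi> (inf (t *\<^sub>R x) (real n *\<^sub>R b)) \<le> t *\<^sub>R trunc_lim \<Phi> b x" .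
  qed
  show ?thesis
  proof (cases "t = 0")
    case True
    have "trunc_lim \<Phi> b 0 = 0"
      using trunc_lim_bounds[of 0] subspace_0[OF J_subspace] by (intro order.antisym) (auto simp: \<Phi>_0)
    then show ?thesis using True by simp
  next
    case False
    with t have t: "0 < t" by simp
    have tx: "t *\<^sub>R x \<in> J" "0 \<le> t *\<^sub>R x" using x t J_subspace by (auto intro: subspace_scale scaleR_nonneg_nonneg)
    have "trunc_lim \<Phi> b x \<le> inverse t *\<^sub>R trunc_lim \<Phi> b (t *\<^sub>R x)" using le[OF tx, of "inverse t"] t by simp
    then have "t *\<^sub>R trunc_lim \<Phi> b x \<le> t *\<^sub>R (inverse t *\<^sub>R trunc_lim \<Phi> b (t *\<^sub>R x))"
      using t by (intro scaleR_left_mono) auto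
    then show ?thesis using le[OF x t] t by (intro order.antisym) auto
  qed
qed

lemma linear_map_on_trunc_lim: "linear_map_on J (trunc_lim \<Phi> b)"
proof (rule linear_map_on_from_cone[OF J_subspace J_pprt])
  show "trunc_lim \<Phi> b x = trunc_lim \<Phi> b (pprt x) - trunc_lim \<Phi> b (pprt (- x))" if "x \<in> J" for x
    using nb by (simp add: trunc_lim_def inf_absorb1 \<Phi>_0)
qed (auto intro: trunc_lim_add trunc_lim_scale)

end


subsection \<open>Order projections\<close>

text \<open>
  Band projections of \<open>E\<^sup>a\<close>. The carrier is \<open>E\<^sup>a\<close> rather than the whole lattice, since elsewhere
  the truncations \<open>inf x (n b)\<close> may fail to converge.
\<close>

definition order_projection :: "('a::banach_lattice \<Rightarrow> 'a) \<Rightarrow> bool" where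
  "order_projection P \<longleftrightarrow> linear_map_on oc_elements P \<and>
     (\<forall>x\<in>oc_elements. 0 \<le> x \<longrightarrow> 0 \<le> P x \<and> P x \<le> x) \<and> (\<forall>x\<in>oc_elements. P (P x) = P x)"

abbreviation band_proj :: "'a::banach_lattice \<Rightarrow> 'a \<Rightarrow> 'a" where
  "band_proj \<equiv> trunc_lim (\<lambda>x. x)"

lemma truncation_oc: "0 \<le> b \<Longrightarrow> truncation oc_elements b (\<lambda>x::'a::banach_lattice. x)"
proof (rule truncation.intro)
  fix x :: 'a assume "0 \<le> b" "x \<in> oc_elements" "0 \<le> x"
  then show "convergent (\<lambda>n. inf x (real n *\<^sub>R b))"
    by (intro oc_elements_convergent[of x] monoI inf_scaleR_mono_nat inf_greatest inf_le1 scaleR_nonneg_nonneg) auto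
qed (auto simp: order_ideal_oc_elements bounded_linear_ident)

lemma order_projection_linear:
  assumes "order_projection P"
  shows "linear_map_on oc_elements P"
    and "x \<in> oc_elements \<Longrightarrow> y \<in> oc_elements \<Longrightarrow> P (x + y) = P x + P y"
    and "x \<in> oc_elements \<Longrightarrow> y \<in> oc_elements \<Longrightarrow> P (x - y) = P x - P y"
    and "x \<in> oc_elements \<Longrightarrow> P (- x) = - P x"
    and "x \<in> oc_elements \<Longrightarrow> P (t *\<^sub>R x) = t *\<^sub>R P x"
    and "P 0 = 0"
    and "(\<And>i. i \<in> I \<Longrightarrow> h i \<in> oc_elements) \<Longrightarrow> P (sum h I) = (\<Sum>i\<in>I. P (h i))"
  using assms linear_map_onD[OF subspace_oc_elements, of P] unfolding order_projection_def by blast+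

lemma order_projection_pos:
  assumes "order_projection P" "x \<in> oc_elements" "0 \<le> x" shows "0 \<le> P x" "P x \<le> x"
  using assms unfolding order_projection_def by blast+

lemma order_projection_abs:
  assumes P: "order_projection P" and x: "x \<in> oc_elements"
  shows "\<bar>P x\<bar> \<le> \<bar>x\<bar>" "P x \<in> oc_elements" "norm (P x) \<le> norm x"
proof -
  have p: "pprt x \<in> oc_elements" "pprt (- x) \<in> oc_elements"
    using x oc_elements_pprt subspace_neg[OF subspace_oc_elements] by blast+
  have "P x = P (pprt x) - P (pprt (- x))" using order_projection_linear(3)[OF P p] pprt_diff[of x] by simp
  also have "\<bar>\<dots>\<bar> \<le> \<bar>P (pprt x)\<bar> + \<bar>P (pprt (- x))\<bar>" by (rule abs_triangle_ineq4)
  also have "\<dots> \<le> pprt x + pprt (- x)" using order_projection_pos[OF P p(1)] order_projection_pos[OF P p(2)] by (intro add_mono) auto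
  finally show le: "\<bar>P x\<bar> \<le> \<bar>x\<bar>" by (simp add: abs_eq_pprt_add)
  then show "P x \<in> oc_elements" by (rule oc_elements_solid[OF x])
  show "norm (P x) \<le> norm x" using le by (rule norm_mono_abs)
qed

lemma order_projection_idem: "order_projection P \<Longrightarrow> x \<in> oc_elements \<Longrightarrow> P (P x) = P x"
  by (simp add: order_projection_def)

text \<open>
  As \<open>0 \<le> Q P x \<le> P x\<close>, the complement of \<open>P\<close> annihilates \<open>Q P x\<close>; in the same way, \<open>P Q\<close>
  annihilates the range of the complement of \<open>P\<close>.
\<close>

lemma order_projection_commute:
  assumes P: "order_projection P" and Q: "order_projection Q" and x: "x \<in> oc_elements"
  shows "P (Q x) = Q (P x)"
proof -
  have *: "P (Q (P x)) = Q (P x) \<and> P (Q x) = P (Q (P x))" if P: "order_projection P" and Q: "order_projection Q" and x: "x \<in> oc_elements" "0 \<le> x" for P Q x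
  proof
    note mem = order_projection_abs(2)[OF P] order_projection_abs(2)[OF Q]
    note Pp = order_projection_pos[OF P] and Qp = order_projection_pos[OF Q]
    note lin = order_projection_linear(3)[OF P] order_projection_linear(3)[OF Q]
    have "Q (P x) - P (Q (P x)) \<le> P x - P (P x)"
    proof -
      have "0 \<le> (P x - Q (P x)) - P (P x - Q (P x))"
        using Pp(2)[of "P x - Q (P x)"] Qp(2)[of "P x"] mem x Pp(1) by (simp add: oc_elements_diff)
      then show ?thesis using lin(1)[of "P x" "Q (P x)"] mem x by (simp add: algebra_simps)
    qed
    moreover have "P (Q (P x)) \<le> Q (P x)" using Pp x mem Qp(1) by blast
    ultimately show "P (Q (P x)) = Q (P x)"
      using order_projection_idem[OF P x(1)] by (intro order.antisym) auto
    let ?y = "x - P x"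
    have y: "?y \<in> oc_elements" "0 \<le> ?y" using x mem Pp(2) by (auto intro: oc_elements_diff)
    have "P (Q ?y) \<le> P ?y"
      using Pp(1)[of "?y - Q ?y"] lin(1)[of ?y "Q ?y"] Qp(2)[OF y] mem y by (simp add: oc_elements_diff)
    also have "P ?y = 0" using lin(1)[of x "P x"] mem x order_projection_idem[OF P x(1)] by simp
    finally have "P (Q ?y) = 0" using Pp(1)[of "Q ?y"] Qp(1)[OF y] mem y by (intro order.antisym) auto
    then show "P (Q x) = P (Q (P x))" using lin mem x by simp
  qed
  have pos: "P (Q x) = Q (P x)" if "x \<in> oc_elements" "0 \<le> x" for x
    using *[OF P Q that] by simp
  have p: "pprt x \<in> oc_elements" "pprt (- x) \<in> oc_elements"
    using x oc_elements_pprt subspace_neg[OF subspace_oc_elements] by blast+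
  have "P (Q (pprt x - pprt (- x))) = Q (P (pprt x - pprt (- x)))"
    using p by (simp add: order_projection_linear(3)[OF P] order_projection_linear(3)[OF Q] pos
        order_projection_abs(2)[OF P] order_projection_abs(2)[OF Q])
  then show ?thesis by (simp only: pprt_diff)
qed

lemma order_projection_band_proj:
  fixes b :: "'a::banach_lattice"
  assumes "0 \<le> b" shows "order_projection (band_proj b)"
proof -
  interpret truncation oc_elements b "\<lambda>x::'a. x" using assms by (rule truncation_oc)
  have pos_idem: "band_proj b (band_proj b x) = band_proj b x" if x: "x \<in> oc_elements" "0 \<le> x" for x
  proof -
    let ?p = "band_proj b x"
    have p: "0 \<le> ?p" "?p \<le> x" using trunc_lim_bounds[OF x] by auto
    then have "?p \<in> oc_elements" using oc_elements_below[OF x(1)] by blast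
    then have "(\<lambda>n. inf ?p (real n *\<^sub>R b)) \<longlonglongrightarrow> band_proj b ?p" using trunc_lim_LIMSEQ p by blast
    moreover have "inf ?p (real n *\<^sub>R b) = inf x (real n *\<^sub>R b)" for n
      using trunc_lim_upper[OF x, of n] p by (intro order.antisym) (auto intro: le_infI1)
    ultimately show ?thesis using trunc_lim_LIMSEQ[OF x] LIMSEQ_unique by fastforce
  qed
  note lin = linear_map_onD(5)[OF subspace_oc_elements linear_map_on_trunc_lim]
  have "band_proj b (band_proj b x) = band_proj b x" if x: "x \<in> oc_elements" for x
  proof -
    have p: "pprt x \<in> oc_elements" "pprt (- x) \<in> oc_elements"
      using x oc_elements_pprt subspace_neg[OF subspace_oc_elements] by blast+
    have m: "band_proj b (pprt x) \<in> oc_elements" "band_proj b (pprt (- x)) \<in> oc_elements"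
      using p trunc_lim_bounds oc_elements_below by (metis zero_le_pprt)+
    have "band_proj b x = band_proj b (pprt x) - band_proj b (pprt (- x))"
      using lin[OF p] pprt_diff[of x] by simp
    then show ?thesis using lin[OF m] p by (simp add: pos_idem)
  qed
  then show ?thesis
    using linear_map_on_trunc_lim trunc_lim_bounds by (simp add: order_projection_def)
qed

lemma band_proj_self: "0 \<le> b \<Longrightarrow> b \<in> oc_elements \<Longrightarrow> band_proj b b = b"
  by (rule truncation.trunc_lim_self[OF truncation_oc])

lemma band_proj_disjoint: "0 \<le> b \<Longrightarrow> w \<in> oc_elements \<Longrightarrow> 0 \<le> w \<Longrightarrow> inf w b = 0 \<Longrightarrow> band_proj b w = 0"
  by (rule truncation.trunc_lim_disjoint[OF truncation_oc])

lemma band_proj_pprt: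
  assumes "w \<in> oc_elements" shows "band_proj (pprt w) w = pprt w"
proof -
  have p: "pprt w \<in> oc_elements" "pprt (- w) \<in> oc_elements"
    using assms oc_elements_pprt subspace_neg[OF subspace_oc_elements] by blast+
  have "band_proj (pprt w) w = band_proj (pprt w) (pprt w) - band_proj (pprt w) (pprt (- w))"
    using order_projection_linear(3)[OF order_projection_band_proj p] pprt_diff[of w] by simp
  then show ?thesis using p inf_pprt_pprt_minus[of w] by (simp add: band_proj_self band_proj_disjoint inf_commute)
qed


subsection \<open>Parts of a positive functional\<close>

abbreviation band_part :: "('a::banach_lattice \<Rightarrow> real) \<Rightarrow> 'a \<Rightarrow> 'a \<Rightarrow> real" where
  "band_part \<equiv> trunc_lim"

lemma positive_functional_abs_le:
  assumes "positive_functional f" shows "\<bar>f x\<bar> \<le> f \<bar>x\<bar>"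
proof -
  have l: "linear f" and pos: "\<And>x. 0 \<le> x \<Longrightarrow> 0 \<le> f x"
    using assms by (auto simp: positive_functional_def bounded_linear.linear)
  show ?thesis
    using pos[of "\<bar>x\<bar> - x"] pos[of "\<bar>x\<bar> + x"] abs_ge_self[of x] abs_add_self_nonneg[of x]
    by (simp add: linear_diff[OF l] linear_add[OF l] abs_le_iff minus_le_iff)
qed

lemma positive_functional_mono:
  assumes "positive_functional f" "x \<le> y" shows "f x \<le> f y"
proof -
  have "0 \<le> f (y - x)" using assms by (simp add: positive_functional_def)
  then show ?thesis using assms by (simp add: positive_functional_def bounded_linear.linear linear_diff)
qed

lemma truncation_functional:
  assumes g: "positive_functional g" and b: "0 \<le> b" shows "truncation UNIV b g"
proof (rule truncation.intro)
  show "convergent (\<lambda>n. g (inf x (real n *\<^sub>R b)))" if "0 \<le> x" for x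
  proof (rule Bseq_mono_convergent)
    show mono: "\<forall>m n. m \<le> n \<longrightarrow> g (inf x (real m *\<^sub>R b)) \<le> g (inf x (real n *\<^sub>R b))"
      using g b by (auto intro: positive_functional_mono inf_scaleR_mono_nat)
    have "0 \<le> g (inf x (real n *\<^sub>R b))" "g (inf x (real n *\<^sub>R b)) \<le> g x" for n
      using g that b by (auto simp: positive_functional_def scaleR_nonneg_nonneg intro: positive_functional_mono)
    then show "Bseq (\<lambda>n. g (inf x (real n *\<^sub>R b)))" by (intro BseqI'[of _ "g x"]) simp
  qed
qed (use assms in \<open>auto simp: order_ideal_in_def positive_functional_def\<close>)

lemma band_part_le:
  assumes "positive_functional g" "0 \<le> b" "0 \<le> x"
  shows "0 \<le> band_part g b x" "band_part g b x \<le> g x"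
  using truncation.trunc_lim_bounds[OF truncation_functional[OF assms(1,2)]] assms by auto

lemma positive_functional_band_part:
  assumes g: "positive_functional g" and b: "0 \<le> b" shows "positive_functional (band_part g b)"
proof -
  interpret truncation UNIV b g using assms by (rule truncation_functional)
  have l: "linear (band_part g b)"
    using linear_map_on_trunc_lim by (intro linearI) (auto simp: linear_map_on_def)
  obtain K where K: "\<And>x. norm (g x) \<le> norm x * K" using g bounded_linear.bounded[of g] unfolding positive_functional_def by blast
  have "norm (band_part g b x) \<le> norm x * K" for x
  proof -
    have "\<bar>band_part g b x\<bar> \<le> band_part g b \<bar>x\<bar>"
      using band_part_le(1)[OF g b, of "\<bar>x\<bar> - x"] band_part_le(1)[OF g b, of "\<bar>x\<bar> + x"] abs_ge_self[of x] abs_add_self_nonneg[of x]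
      by (simp add: linear_diff[OF l] linear_add[OF l] abs_le_iff minus_le_iff)
    also have "\<dots> \<le> g \<bar>x\<bar>" by (rule band_part_le[OF g b]) simp
    also have "\<dots> \<le> norm x * K" using K[of "\<bar>x\<bar>"] by (simp add: norm_abs_eq)
    finally show ?thesis by simp
  qed
  then have "bounded_linear (band_part g b)"
    by (intro bounded_linear_intro[of _ K]) (auto simp: linear_add[OF l] linear_scale[OF l])
  then show ?thesis using band_part_le(1)[OF g b] by (simp add: positive_functional_def)
qed

lemma band_part_self: "positive_functional g \<Longrightarrow> 0 \<le> b \<Longrightarrow> band_part g b b = g b"
  using truncation.trunc_lim_self[OF truncation_functional] by auto

lemma band_part_disjoint: "positive_functional g \<Longrightarrow> 0 \<le> b \<Longrightarrow> 0 \<le> w \<Longrightarrow> inf w b = 0 \<Longrightarrow> band_part g b w = 0"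
  using truncation.trunc_lim_disjoint[OF truncation_functional] by auto

text \<open>
  For disjoint \<open>a\<close> and \<open>c\<close>, the sum \<open>n (a + c)\<close> is the supremum of \<open>n a\<close> and \<open>n c\<close>, and \<open>inf x\<close>
  distributes over it.
\<close>

lemma band_part_add:
  assumes g: "positive_functional g" and ac: "0 \<le> a" "0 \<le> c" "inf a c = 0"
  shows "band_part g (a + c) x = band_part g a x + band_part g c x"
proof -
  have pos: "band_part g (a + c) x = band_part g a x + band_part g c x" if x: "0 \<le> x" for x
  proof -
    have eq: "inf x (real n *\<^sub>R (a + c)) = inf x (real n *\<^sub>R a) + inf x (real n *\<^sub>R c)" for n
    proof -
      let ?a = "real n *\<^sub>R a" and ?c = "real n *\<^sub>R c"
      have nn: "0 \<le> ?a" "0 \<le> ?c" using ac by (auto intro: scaleR_nonneg_nonneg)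
      have "inf ?c a = 0" using inf_disjoint_multiple[of a c n] ac by (simp add: inf_commute)
      then have 0: "inf ?a ?c = 0" using inf_disjoint_multiple[of ?c a n] ac nn by (simp add: inf_commute)
      then have "?a + ?c = sup ?a ?c" using add_eq_inf_sup[of ?a ?c] by simp
      then have "inf x (real n *\<^sub>R (a + c)) = sup (inf x ?a) (inf x ?c)" by (simp add: scaleR_right_distrib inf_sup_distrib1)
      moreover have "inf (inf x ?a) (inf x ?c) = 0"
        by (rule inf_eq_0_mono[OF _ _ _ _ 0]) (use x nn in auto)
      ultimately show ?thesis using add_eq_inf_sup[of "inf x ?a" "inf x ?c"] by simp
    qed
    have ga: "g (v + w) = g v + g w" for v w using g by (simp add: positive_functional_def bounded_linear.linear linear_add)
    have "(\<lambda>n. g (inf x (real n *\<^sub>R a)) + g (inf x (real n *\<^sub>R c))) \<longlonglongrightarrow> band_part g a x + band_part g c x"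
      using x ac g by (intro tendsto_add truncation.trunc_lim_LIMSEQ[OF truncation_functional]) auto
    moreover have "(\<lambda>n. g (inf x (real n *\<^sub>R (a + c)))) \<longlonglongrightarrow> band_part g (a + c) x"
      using x ac g by (intro truncation.trunc_lim_LIMSEQ[OF truncation_functional]) auto
    ultimately show ?thesis unfolding eq ga using LIMSEQ_unique by blast
  qed
  have split: "f x = f (pprt x) - f (pprt (- x))" if "positive_functional f" for f :: "'a \<Rightarrow> real"
    using that linear_diff[of f "pprt x" "pprt (- x)"] pprt_diff[of x]
    by (simp add: positive_functional_def bounded_linear.linear)
  show ?thesis
    using split[OF positive_functional_band_part[OF g, of "a + c"]] split[OF positive_functional_band_part[OF g, of a]]
      split[OF positive_functional_band_part[OF g, of c]] pos[of "pprt x"] pos[of "pprt (- x)"] ac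
    by simp
qed

section \<open>Order intervals and positive functionals\<close>

lemma not_tendsto_zero_subseq:
  fixes x :: "nat \<Rightarrow> 'a::real_normed_vector"
  assumes "\<not> x \<longlonglongrightarrow> 0"
  obtains e and r :: "nat \<Rightarrow> nat" where "e > 0" "strict_mono r" "\<And>n. e \<le> norm (x (r n))"
proof -
  from assms obtain e where e: "e > 0" "\<And>N. \<exists>n\<ge>N. e \<le> norm (x n)"
    unfolding LIMSEQ_iff by (auto simp: not_less)
  have "\<exists>r. \<forall>n. e \<le> norm (x (r n)) \<and> r n < r (Suc n)"
  proof (rule dependent_nat_choice)
    show "\<exists>n. e \<le> norm (x n)" using e(2)[of 0] by blast
    show "\<exists>m. e \<le> norm (x m) \<and> n < m" for n using e(2)[of "Suc n"] by (auto simp: Suc_le_eq)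
  qed
  then obtain r where "\<forall>n. e \<le> norm (x (r n)) \<and> r n < r (Suc n)" ..
  then show thesis using that[of e r] e(1) by (simp add: strict_mono_Suc_iff)
qed

text \<open>
  Pass to a subsequence with \<open>\<phi> (t (r n)) \<le> 2\<^sup>-\<^sup>n\<close> and let \<open>w n\<close> be the supremum of its tail
  from \<open>n\<close> on. The tails decrease to an element \<open>v\<close> on which \<open>\<phi>\<close> vanishes.
\<close>

lemma small_functional_dominated:
  fixes t :: "nat \<Rightarrow> 'a::banach_lattice"
  assumes u: "u \<in> oc_elements" and t: "\<And>n. 0 \<le> t n" "\<And>n. t n \<le> u"
    and \<phi>: "positive_functional \<phi>" and lim: "(\<lambda>n. \<phi> (t n)) \<longlonglongrightarrow> 0"
  obtains r :: "nat \<Rightarrow> nat" and w v where "strict_mono r" "\<And>n. t (r n) \<le> w n" "w \<longlonglongrightarrow> v" "0 \<le> v" "v \<le> u" "\<phi> v = 0"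
proof -
  have l: "linear \<phi>" and bl: "bounded_linear \<phi>" and pos: "\<And>x. 0 \<le> x \<Longrightarrow> 0 \<le> \<phi> x"
    using \<phi> by (auto simp: positive_functional_def bounded_linear.linear)
  have "\<exists>k>m. \<phi> (t k) \<le> (1/2) ^ n" for m n
  proof -
    from LIMSEQ_D[OF lim, of "(1/2) ^ n"] obtain N where "\<And>k. k \<ge> N \<Longrightarrow> \<bar>\<phi> (t k)\<bar> < (1/2) ^ n" by auto
    from this[of "max N (Suc m)"] show ?thesis by (intro exI[of _ "max N (Suc m)"]) auto
  qed
  note ex = this
  have "\<exists>r. \<forall>n. \<phi> (t (r n)) \<le> (1/2) ^ n \<and> r n < r (Suc n)"
  proof (rule dependent_nat_choice)
    show "\<exists>k. \<phi> (t k) \<le> (1/2) ^ 0" using ex by blast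
    show "\<exists>k. \<phi> (t k) \<le> (1/2) ^ Suc n \<and> m < k" for m n using ex by blast
  qed
  then obtain r where r: "\<And>n. \<phi> (t (r n)) \<le> (1/2) ^ n" "strict_mono r" by (auto simp: strict_mono_Suc_iff)
  \<comment> \<open>\<open>W m k\<close> is the supremum of \<open>t (r m), \<dots>, t (r (m + k))\<close>.\<close>
  define W where "W m = rec_nat (t (r m)) (\<lambda>k s. sup s (t (r (m + Suc k))))" for m
  have W0: "W m 0 = t (r m)" and WS: "W m (Suc k) = sup (W m k) (t (r (m + Suc k)))" for m k
    by (auto simp: W_def)
  have Wb: "0 \<le> W m k \<and> W m k \<le> u" for m k by (induction k) (auto simp: W0 WS t intro: le_supI1)
  have \<phi>W: "\<phi> (W m k) \<le> (\<Sum>i\<le>k. (1/2) ^ (m + i))" for m k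
  proof (induction k)
    case (Suc k)
    have "W m (Suc k) \<le> W m k + t (r (m + Suc k))"
      unfolding WS using Wb t by (intro sup_least) (auto intro: add_increasing add_increasing2)
    then have "\<phi> (W m (Suc k)) \<le> \<phi> (W m k) + \<phi> (t (r (m + Suc k)))"
      using positive_functional_mono[OF \<phi>] by (metis linear_add[OF l])
    then show ?case using Suc r(1)[of "m + Suc k"] by simp
  qed (use r in \<open>simp add: W0\<close>)
  have geo: "(\<Sum>i\<le>k. (1/2::real) ^ (m + i)) \<le> 2 * (1/2) ^ m" for m k
  proof -
    have "(\<Sum>i\<le>k. (1/2::real) ^ (m + i)) = (1/2) ^ m * (2 - (1/2) ^ k)"
      by (induction k) (auto simp: power_add field_simps)
    also have "\<dots> \<le> (1/2) ^ m * 2" by (intro mult_left_mono) auto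
    finally show ?thesis by simp
  qed
  have "convergent (W m)" for m
    using Wb by (intro oc_elements_convergent[OF u]) (auto simp: incseq_Suc_iff WS)
  then obtain w where w: "\<And>m. W m \<longlonglongrightarrow> w m" unfolding convergent_def by metis
  have w_ge: "W m k \<le> w m" for m k
  proof (rule LIMSEQ_le_lattice[OF tendsto_const w])
    have "incseq (W m)" by (auto simp: incseq_Suc_iff WS)
    then show "W m k \<le> W m n" if "k \<le> n" for n using that by (rule incseqD)
  qed
  have w_le: "w m \<le> u" for m by (rule LIMSEQ_le_lattice[OF w tendsto_const]) (use Wb in auto)
  have w_0: "0 \<le> w m" for m using order_trans[OF _ w_ge[of m 0]] Wb[of m 0] by blast
  have WW: "W (Suc m) k \<le> W m (Suc k)" for m k
  proof (induction k)
    case (Suc k) then show ?case unfolding WS[of m "Suc k"] WS[of "Suc m" k] by (intro sup_mono) auto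
  qed (simp add: W0 WS)
  have w_dec: "w (Suc m) \<le> w m" for m
    by (rule LIMSEQ_le_lattice[OF w tendsto_const]) (use WW w_ge in \<open>meson order_trans\<close>)
  then have "convergent w"
    using w_le w_0 by (intro oc_elements_convergent_decreasing[OF u]) (auto simp: decseq_Suc_iff)
  then obtain v where v: "w \<longlonglongrightarrow> v" by (auto simp: convergent_def)
  have v0: "0 \<le> v" and vu: "v \<le> u"
    using LIMSEQ_nonneg_lattice[OF v, of 0] LIMSEQ_le_lattice[OF v tendsto_const, of 0 u] w_0 w_le by auto
  have \<phi>w: "\<phi> (w m) \<le> 2 * (1/2) ^ m" for m
    using bounded_linear.tendsto[OF bl w[of m]]
    by (rule LIMSEQ_le_const2) (use order_trans[OF \<phi>W geo] in blast)
  have lim0: "(\<lambda>m. 2 * (1/2::real) ^ m) \<longlonglongrightarrow> 0"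
    by (intro tendsto_mult_right_zero LIMSEQ_realpow_zero) auto
  have "\<phi> v \<le> 0"
    by (rule LIMSEQ_le[OF bounded_linear.tendsto[OF bl v] lim0]) (use \<phi>w in blast)
  then have "\<phi> v = 0" using pos[OF v0] by simp
  moreover have "t (r n) \<le> w n" for n using w_ge[of n 0] by (simp add: W0)
  ultimately show thesis using that r(2) v v0 vu by blast
qed

lemma strictly_positive_norm_control:
  fixes t :: "nat \<Rightarrow> 'a::banach_lattice"
  assumes u: "u \<in> oc_elements" and \<phi>: "positive_functional \<phi>"
    and strict: "\<And>v. 0 \<le> v \<Longrightarrow> v \<le> u \<Longrightarrow> \<phi> v = 0 \<Longrightarrow> v = 0"
    and t: "\<And>n. \<bar>t n\<bar> \<le> u" and lim: "(\<lambda>n. \<phi> \<bar>t n\<bar>) \<longlonglongrightarrow> 0"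
  shows "t \<longlonglongrightarrow> 0"
proof (rule ccontr)
  assume "\<not> ?thesis"
  then obtain e and q :: "nat \<Rightarrow> nat" where e: "e > 0" and q: "strict_mono q" "\<And>n. e \<le> norm (t (q n))"
    using not_tendsto_zero_subseq[of t] by blast
  have "(\<lambda>n. \<phi> \<bar>t (q n)\<bar>) \<longlonglongrightarrow> 0" using LIMSEQ_subseq_LIMSEQ[OF lim q(1)] by (simp add: o_def)
  then obtain r w v where *: "\<And>n. \<bar>t (q (r n))\<bar> \<le> w n" "w \<longlonglongrightarrow> v" "0 \<le> v" "v \<le> u" "\<phi> v = 0"
    using small_functional_dominated[OF u, of "\<lambda>n. \<bar>t (q n)\<bar>" \<phi>] t \<phi> by (metis abs_ge_zero)
  have "v = 0" using strict * by blast
  then have "(\<lambda>n. norm (w n)) \<longlonglongrightarrow> 0" using *(2) tendsto_norm_zero by blast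
  moreover have "e \<le> norm (w n)" for n using norm_le_abs[OF *(1)] q(2) order_trans by blast
  ultimately have "e \<le> 0" by (intro LIMSEQ_le_const) auto
  with e show False by simp
qed

text \<open>
  A functional composed with \<open>P\<close> is bounded on \<open>E\<^sup>a\<close> only; its Hahn--Banach extension tests the
  sequence in the whole space.
\<close>

lemma weakly_null_order_projection:
  fixes x :: "nat \<Rightarrow> 'a::banach_lattice"
  assumes x: "weakly_null x" "\<And>n. x n \<in> oc_elements" and P: "order_projection P"
  shows "weakly_null (\<lambda>n. P (x n))"
  unfolding weakly_null_def
proof (intro allI impI)
  fix f :: "'a \<Rightarrow> real" assume f: "bounded_linear f"
  obtain K where K: "K > 0" "\<And>x. norm (f x) \<le> norm x * K" using bounded_linear.pos_bounded[OF f] by blast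
  have "linear_map_on oc_elements (\<lambda>x. f (P x))"
    using order_projection_linear[OF P] linear_add[OF bounded_linear.linear[OF f]] linear_scale[OF bounded_linear.linear[OF f]]
    by (simp add: linear_map_on_def)
  moreover have "\<bar>f (P x)\<bar> \<le> K * norm x" if "x \<in> oc_elements" for x
  proof -
    have "\<bar>f (P x)\<bar> \<le> K * norm (P x)" using K(2)[of "P x"] by (simp add: mult.commute)
    also have "\<dots> \<le> K * norm x" using K(1) order_projection_abs(3)[OF P that] by (intro mult_left_mono) auto
    finally show ?thesis .
  qed
  ultimately obtain f' where "bounded_linear f'" "\<And>x. x \<in> oc_elements \<Longrightarrow> f' x = f (P x)"
    using linear_map_on_extend[OF subspace_oc_elements _ less_imp_le[OF K(1)], of "\<lambda>x. f (P x)"] by blast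
  then show "(\<lambda>n. f (P (x n))) \<longlonglongrightarrow> 0" using x by (auto simp: weakly_null_def)
qed


section \<open>Discrete order continuous part\<close>

text \<open>
  The truncations of \<open>x\<close> at multiples of an atom lie in the ideal generated by it, that is, in its span.
\<close>

lemma band_proj_discrete_element:
  assumes d: "discrete_element oc_elements d" and x: "x \<in> oc_elements"
  shows "\<exists>c. band_proj d x = c *\<^sub>R (d :: 'a::banach_lattice)"
proof -
  have dM: "d \<in> oc_elements" and d0: "0 \<le> d" "d \<noteq> 0" and hull: "order_ideal_in oc_elements hull {d} = span {d}"
    using d by (auto simp: discrete_element_def)
  interpret truncation oc_elements d "\<lambda>x::'a. x" using d0(1) by (rule truncation_oc)
  obtain f where f: "positive_functional f" "f d = norm d" using positive_functional_norming[OF d0(1)] by blast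
  have pos: "\<exists>c. band_proj d x = c *\<^sub>R d" if x: "x \<in> oc_elements" "0 \<le> x" for x
  proof -
    have "\<exists>c. inf x (real n *\<^sub>R d) = c *\<^sub>R d" for n
    proof -
      have m: "inf x (real n *\<^sub>R d) \<in> oc_elements" "0 \<le> inf x (real n *\<^sub>R d)"
        using x nb oc_elements_below[OF x(1), of "inf x (real n *\<^sub>R d)"] by auto
      have "inf x (real n *\<^sub>R d) \<in> I" if I: "order_ideal_in oc_elements I" "{d} \<subseteq> I" for I
      proof -
        have "real n *\<^sub>R d \<in> I" using I by (auto simp: order_ideal_in_def subspace_scale)
        moreover have "\<bar>inf x (real n *\<^sub>R d)\<bar> \<le> \<bar>real n *\<^sub>R d\<bar>" using m nb by simp
        ultimately show ?thesis using I m unfolding order_ideal_in_def by blast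
      qed
      then have "inf x (real n *\<^sub>R d) \<in> order_ideal_in oc_elements hull {d}" by (simp add: hull_def)
      then show ?thesis by (auto simp: hull span_singleton)
    qed
    then obtain c where c: "\<And>n. inf x (real n *\<^sub>R d) = c n *\<^sub>R d" by metis
    have lim: "(\<lambda>n. c n *\<^sub>R d) \<longlonglongrightarrow> band_proj d x" using trunc_lim_LIMSEQ[OF x] by (simp add: c)
    then have "(\<lambda>n. f (c n *\<^sub>R d)) \<longlonglongrightarrow> f (band_proj d x)"
      using f(1) by (intro bounded_linear.tendsto[of f]) (auto simp: positive_functional_def)
    then have "(\<lambda>n. c n * norm d) \<longlonglongrightarrow> f (band_proj d x)"
      using f by (simp add: positive_functional_def bounded_linear.linear linear_scale)
    then have "(\<lambda>n. c n * norm d / norm d) \<longlonglongrightarrow> f (band_proj d x) / norm d"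
      using d0 by (intro tendsto_divide) auto
    then have "c \<longlonglongrightarrow> f (band_proj d x) / norm d" using d0 by simp
    then have "(\<lambda>n. c n *\<^sub>R d) \<longlonglongrightarrow> (f (band_proj d x) / norm d) *\<^sub>R d" by (intro tendsto_intros)
    with lim show ?thesis using LIMSEQ_unique by blast
  qed
  have p: "pprt x \<in> oc_elements" "pprt (- x) \<in> oc_elements"
    using x oc_elements_pprt subspace_neg[OF subspace_oc_elements] by blast+
  from pos[OF p(1)] pos[OF p(2)] obtain c c' where "band_proj d (pprt x) = c *\<^sub>R d" "band_proj d (pprt (- x)) = c' *\<^sub>R d" by auto
  then have "band_proj d x = (c - c') *\<^sub>R d"
    using order_projection_linear(3)[OF order_projection_band_proj[OF d0(1)] p] pprt_diff[of x] by (simp add: scaleR_diff_left)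
  then show ?thesis by blast
qed

text \<open>
  Let \<open>P A\<close> be the projection onto the span of a finite set \<open>A\<close> of atoms. The elements \<open>P A u\<close> increase to
  \<open>u\<close> in norm, since what their supremum leaves of \<open>u\<close> is disjoint from all atoms. So \<open>P A\<close> is close to the
  identity uniformly on \<open>[-u, u]\<close>, and the rest of an L-weakly compact set is small in norm.
\<close>

lemma discrete_weakly_null_tendsto:
  fixes x :: "nat \<Rightarrow> 'a::banach_lattice"
  assumes disc: "discrete_vector_lattice (oc_elements :: 'a set)"
    and x: "weakly_null x" "L_weakly_compact (range x)"
  shows "x \<longlonglongrightarrow> 0"
proof -
  obtain D :: "'a set" where DD: "(\<forall>d\<in>D. discrete_element oc_elements d) \<and> pairwise lattice_disjoint D \<and>
      (\<forall>y\<in>oc_elements. (\<forall>d\<in>D. lattice_disjoint y d) \<longrightarrow> y = 0)"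
    using disc unfolding discrete_vector_lattice_def by (rule exE)
  then have D: "\<And>d. d \<in> D \<Longrightarrow> discrete_element oc_elements d" "pairwise lattice_disjoint D"
    and max: "\<And>y. y \<in> oc_elements \<Longrightarrow> (\<And>d. d \<in> D \<Longrightarrow> lattice_disjoint y d) \<Longrightarrow> y = 0"
    by blast+
  have xM: "x n \<in> oc_elements" for n using L_weakly_compact_imp_oc[OF x(2)] by blast
  have d0: "0 \<le> d" "d \<noteq> 0" "d \<in> oc_elements" if "d \<in> D" for d using D(1)[OF that] by (auto simp: discrete_element_def)
  have proj: "order_projection (band_proj d)" if "d \<in> D" for d using d0[OF that] by (intro order_projection_band_proj)
  note lin = order_projection_linear[OF proj]
  define P where "P A y = (\<Sum>d\<in>A. band_proj d y)" for A and y :: 'a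
  have Plin: "P A (y - z) = P A y - P A z" if "A \<subseteq> D" "y \<in> oc_elements" "z \<in> oc_elements" for A y z
    using that lin(3) by (auto simp: P_def sum_subtractf[symmetric] intro!: sum.cong)
  have Ppos: "0 \<le> P A y" "P A y \<le> y" if A: "A \<subseteq> D" "finite A" and y: "y \<in> oc_elements" "0 \<le> y" for A y
  proof -
    have b: "0 \<le> band_proj d y \<and> band_proj d y \<le> y" if "d \<in> A" for d
      using order_projection_pos[OF proj y] that A by blast
    then show "0 \<le> P A y" unfolding P_def by (intro sum_nonneg) auto
    show "P A y \<le> y"
      unfolding P_def
    proof (rule sum_disjoint_le[OF A(2) y(2) b])
      fix d d' assume d: "d \<in> A" "d' \<in> A" "d \<noteq> d'"
      obtain c c' where c: "band_proj d y = c *\<^sub>R d" "band_proj d' y = c' *\<^sub>R d'"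
        using band_proj_discrete_element[OF D(1) y(1)] d A by (meson subsetD)
      have dis: "inf d d' = 0" using D(2) d A d0 unfolding pairwise_def lattice_disjoint_def by (metis abs_of_nonneg subsetD)
      have nonneg: "0 \<le> e" if "0 \<le> e *\<^sub>R v" "0 \<le> v" "v \<noteq> 0" for e and v :: 'a
      proof (rule ccontr)
        assume "\<not> 0 \<le> e"
        then have "e *\<^sub>R v \<le> 0" using that(2) by (intro scaleR_nonpos_nonneg) auto
        then have "e *\<^sub>R v = 0" using that(1) by (rule order.antisym)
        then show False using \<open>\<not> 0 \<le> e\<close> that(3) by simp
      qed
      have "0 \<le> c" "0 \<le> c'" using nonneg[of c d] nonneg[of c' d'] b[OF d(1)] b[OF d(2)] c d A d0 by auto
      then show "inf (band_proj d y) (band_proj d' y) = 0"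
        unfolding c using d A d0 by (intro inf_scaleR_disjoint dis) auto
    qed auto
  qed
  have dense: "\<exists>A. A \<subseteq> D \<and> finite A \<and> norm (u - P A u) < e" if u: "u \<in> oc_elements" "0 \<le> u" and e: "e > 0" for u e
  proof -
    obtain s f where s: "\<And>a. a \<in> {P A u |A. A \<subseteq> D \<and> finite A} \<Longrightarrow> a \<le> s" "0 \<le> s" "s \<le> u" "f \<longlonglongrightarrow> s"
      "\<And>n::nat. f n \<in> {P A u |A. A \<subseteq> D \<and> finite A}"
    proof (rule oc_directed_sup[OF u(1), of "{P A u |A. A \<subseteq> D \<and> finite A}"])
      show "{P A u |A. A \<subseteq> D \<and> finite A} \<noteq> {}" by blast
      show "0 \<le> a \<and> a \<le> u" if "a \<in> {P A u |A. A \<subseteq> D \<and> finite A}" for a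
      proof -
        from that obtain A where "A \<subseteq> D" "finite A" "a = P A u" by blast
        then show ?thesis using Ppos[of A u] u by simp
      qed
      show "\<exists>c\<in>{P A u |A. A \<subseteq> D \<and> finite A}. a \<le> c \<and> b \<le> c"
        if ab: "a \<in> {P A u |A. A \<subseteq> D \<and> finite A}" "b \<in> {P A u |A. A \<subseteq> D \<and> finite A}" for a b
      proof -
        from ab obtain A B where AB: "A \<subseteq> D" "finite A" "B \<subseteq> D" "finite B" "a = P A u" "b = P B u" by blast
        have "P A u \<le> P (A \<union> B) u" "P B u \<le> P (A \<union> B) u"
          unfolding P_def using AB order_projection_pos(1)[OF proj u] by (auto intro!: sum_mono2)
        then show ?thesis using AB by (intro bexI[of _ "P (A \<union> B) u"]) auto
      qed
    qed (blast intro: that)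
    have "u - s = 0"
    proof (rule max)
      show us: "u - s \<in> oc_elements" using s u oc_elements_below[OF u(1), of "u - s"] by simp
      fix d assume d: "d \<in> D"
      define z where "z = inf (u - s) d"
      have z: "0 \<le> z" "z \<le> d" "z \<le> u - s" using s d0[OF d] by (auto simp: z_def)
      have zM: "z \<in> oc_elements" using oc_elements_below[OF us] z by blast
      have "band_proj d u \<le> s" using d by (intro s(1) CollectI exI[of _ "{d}"]) (auto simp: P_def)
      then have zu: "z \<le> u - band_proj d u" using z(3) by (meson diff_left_mono order_trans)
      note M = order_projection_abs(2)[OF proj[OF d] u(1)]
      have "0 \<le> band_proj d ((u - band_proj d u) - z)"
        using zu zM u M by (intro order_projection_pos(1)[OF proj[OF d]] oc_elements_diff) auto
      also have "\<dots> = (band_proj d u - band_proj d (band_proj d u)) - band_proj d z"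
        using u M zM by (simp add: lin(3)[OF d] oc_elements_diff)
      also have "\<dots> = - band_proj d z" using order_projection_idem[OF proj[OF d] u(1)] by simp
      finally have "band_proj d z \<le> 0" by simp
      moreover have "inf z (real 1 *\<^sub>R d) \<le> band_proj d z"
        by (rule truncation.trunc_lim_upper[OF truncation_oc]) (use d0[OF d] zM z in auto)
      ultimately have "z \<le> 0" using z(2) by (simp add: inf_absorb1)
      then show "lattice_disjoint (u - s) d"
        using z s(3) d0[OF d] unfolding lattice_disjoint_def z_def by (simp add: order.antisym)
    qed
    then have "f \<longlonglongrightarrow> u" using s(4) by simp
    from LIMSEQ_D[OF this e] obtain n where "norm (f n - u) < e" by blast
    then show ?thesis using s(5)[of n] by (auto simp: norm_minus_commute)
  qed
  have Pnull: "(\<lambda>n. P A (x n)) \<longlonglongrightarrow> 0" if A: "A \<subseteq> D" for A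
  proof -
    have "(\<lambda>n. band_proj d (x n)) \<longlonglongrightarrow> 0" if d: "d \<in> D" for d
    proof -
      obtain f where f: "positive_functional f" "f d = norm d" using positive_functional_norming[OF d0(1)[OF d]] by blast
      have "\<exists>c. \<forall>n. band_proj d (x n) = c n *\<^sub>R d" using band_proj_discrete_element[OF D(1)[OF d] xM] by metis
      then obtain c where c: "\<And>n. band_proj d (x n) = c n *\<^sub>R d" by blast
      have "(\<lambda>n. f (band_proj d (x n))) \<longlonglongrightarrow> 0"
        using weakly_null_order_projection[OF x(1) xM proj[OF d]] f(1) by (auto simp: weakly_null_def positive_functional_def)
      then have "(\<lambda>n. c n * norm d) \<longlonglongrightarrow> 0"
        using f by (simp add: c positive_functional_def bounded_linear.linear linear_scale)
      then have "(\<lambda>n. norm (c n *\<^sub>R d)) \<longlonglongrightarrow> 0" using tendsto_rabs_zero_iff[of "\<lambda>n. c n * norm d" sequentially] by (simp add: abs_mult)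
      then show ?thesis unfolding c by (rule tendsto_norm_zero_cancel)
    qed
    then have "(\<lambda>n. \<Sum>d\<in>A. band_proj d (x n)) \<longlonglongrightarrow> (\<Sum>d\<in>A. 0)" using A by (intro tendsto_sum) auto
    then show ?thesis by (simp add: P_def)
  qed
  show ?thesis
  proof (rule LIMSEQ_I)
    fix e :: real assume e: "e > 0"
    obtain u where u: "u \<in> oc_elements" "0 \<le> u" "\<And>n. norm (pprt (\<bar>x n\<bar> - u)) \<le> e / 3"
      using L_weakly_compact_almost_order_bounded[OF x(2), of "e / 3"] e by auto
    obtain A where A: "A \<subseteq> D" "finite A" "norm (u - P A u) < e / 3" using dense[OF u(1,2), of "e / 3"] e by auto
    from LIMSEQ_D[OF Pnull[OF A(1)], of "e / 3"] e obtain N where N: "\<And>n. n \<ge> N \<Longrightarrow> norm (P A (x n)) < e / 3" by auto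
    have "norm (x n - 0) < e" if n: "n \<ge> N" for n
    proof -
      let ?v = "pprt (\<bar>x n\<bar> - u)"
      have ab: "\<bar>x n\<bar> \<in> oc_elements" using xM by (simp add: oc_elements_abs_iff)
      have vM: "?v \<in> oc_elements" using ab u by (intro oc_elements_pprt oc_elements_diff)
      have mono: "y - P A y \<le> z - P A z" if "y \<in> oc_elements" "z \<in> oc_elements" "y \<le> z" for y z
        using Ppos(2)[OF A(1,2), of "z - y"] Plin[OF A(1) that(2,1)] that by (simp add: oc_elements_diff algebra_simps)
      have neg: "P A (- y) = - P A y" if "y \<in> oc_elements" for y
        using Plin[OF A(1) oc_elements_0 that] Plin[OF A(1) oc_elements_0 oc_elements_0] by simp
      have "\<bar>x n - P A (x n)\<bar> \<le> \<bar>x n\<bar> - P A \<bar>x n\<bar>"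
        using mono[OF xM ab abs_ge_self] neg[OF xM]
          mono[OF subspace_neg[OF subspace_oc_elements xM] ab abs_ge_minus_self]
        by (intro abs_leI) (auto simp: algebra_simps)
      also have "\<dots> \<le> (u + ?v) - P A (u + ?v)"
      proof (rule mono[OF ab])
        show "u + ?v \<in> oc_elements" using u vM by (intro oc_elements_add)
        show "\<bar>x n\<bar> \<le> u + ?v" using inf_add_pprt_diff[of "\<bar>x n\<bar>" u] by (metis add_right_mono inf_le2)
      qed
      also have "\<dots> = (u - P A u) + (?v - P A ?v)"
        using Plin[OF A(1), of u "- ?v"] neg[OF vM] u vM subspace_neg[OF subspace_oc_elements vM] by (simp add: algebra_simps)
      also have "\<dots> \<le> (u - P A u) + ?v" using Ppos(1)[OF A(1,2) vM] by simp
      finally have "norm (x n - P A (x n)) \<le> norm ((u - P A u) + ?v)" by (rule norm_le_abs)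
      also have "\<dots> \<le> norm (u - P A u) + norm ?v" by (rule norm_triangle_ineq)
      finally have "norm (x n - P A (x n)) < 2 * e / 3" using A(3) u(3)[of n] by simp
      moreover have "norm (x n) \<le> norm (x n - P A (x n)) + norm (P A (x n))" using norm_triangle_ineq[of "x n - P A (x n)" "P A (x n)"] by simp
      ultimately show ?thesis using N[OF n] by simp
    qed
    then show "\<exists>N. \<forall>n\<ge>N. norm (x n - 0) < e" by blast
  qed
qed

section \<open>Finite partitions into order projections\<close>

lemma sum_lessThan_double: "(\<Sum>k<2 * (m::nat). f k) = (\<Sum>i<m. f (2 * i) + f (2 * i + 1) :: 'b::comm_monoid_add)"
  by (induction m) (auto simp: add.assoc)

text \<open>
  The index set \<open>{..<m}\<close> instead of a set of projections allows vanishing and repeated members.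
\<close>

definition order_partition :: "nat \<Rightarrow> (nat \<Rightarrow> 'a::banach_lattice \<Rightarrow> 'a) \<Rightarrow> bool" where
  "order_partition m P \<longleftrightarrow> (\<forall>i<m. order_projection (P i)) \<and> (\<forall>x\<in>oc_elements. (\<Sum>i<m. P i x) = x) \<and>
     (\<forall>i<m. \<forall>j<m. i \<noteq> j \<longrightarrow> (\<forall>x\<in>oc_elements. P i (P j x) = 0))"

text \<open>
  Every cell \<open>P k\<close> is cut into its parts in the range of \<open>Q\<close> (index \<open>2 k\<close>) and of the complement
  of \<open>Q\<close> (index \<open>2 k + 1\<close>).
\<close>

definition refine :: "('a::banach_lattice \<Rightarrow> 'a) \<Rightarrow> (nat \<Rightarrow> 'a \<Rightarrow> 'a) \<Rightarrow> nat \<Rightarrow> 'a \<Rightarrow> 'a" where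
  "refine Q P k x = (if even k then Q (P (k div 2) x) else P (k div 2) x - Q (P (k div 2) x))"

lemma order_projection_compl:
  fixes Q :: "'a::banach_lattice \<Rightarrow> 'a"
  assumes Q: "order_projection Q" shows "order_projection (\<lambda>x. x - Q x)"
  unfolding order_projection_def linear_map_on_def
proof (intro conjI ballI allI impI)
  note lin = order_projection_linear[OF Q] and mem = order_projection_abs(2)[OF Q]
  fix x :: 'a assume x: "x \<in> oc_elements"
  show "x + y - Q (x + y) = x - Q x + (y - Q y)" if "y \<in> oc_elements" for y using lin(2)[OF x that] by simp
  show "t *\<^sub>R x - Q (t *\<^sub>R x) = t *\<^sub>R (x - Q x)" for t using lin(5)[OF x] by (simp add: scaleR_diff_right)
  show "0 \<le> x - Q x" "x - Q x \<le> x" if "0 \<le> x" using order_projection_pos[OF Q x that] by auto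
  show "x - Q x - Q (x - Q x) = x - Q x" using lin(3)[OF x mem[OF x]] order_projection_idem[OF Q x] by simp
qed

lemma order_projection_compose:
  assumes P: "order_projection P" and Q: "order_projection Q" shows "order_projection (\<lambda>x. Q (P x))"
proof -
  have "Q (P (Q (P x))) = Q (P x)" if x: "x \<in> oc_elements" for x
  proof -
    note Px = order_projection_abs(2)[OF P x]
    have "P (Q (P x)) = Q (P (P x))" by (rule order_projection_commute[OF P Q Px])
    then show ?thesis using order_projection_idem[OF P x] order_projection_idem[OF Q Px] by simp
  qed
  moreover have "Q (P x) \<le> x \<and> 0 \<le> Q (P x)" if "x \<in> oc_elements" "0 \<le> x" for x
    using order_projection_pos[OF P that] order_projection_pos[OF Q, of "P x"] order_projection_abs(2)[OF P that(1)]
    by (auto intro: order_trans)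
  ultimately show ?thesis
    unfolding order_projection_def linear_map_on_def
    using order_projection_linear[OF P] order_projection_linear[OF Q] order_projection_abs(2)[OF P] by simp
qed

lemma order_partitionD:
  assumes "order_partition m P"
  shows "i < m \<Longrightarrow> order_projection (P i)"
    and "x \<in> oc_elements \<Longrightarrow> (\<Sum>i<m. P i x) = x"
    and "i < m \<Longrightarrow> j < m \<Longrightarrow> i \<noteq> j \<Longrightarrow> x \<in> oc_elements \<Longrightarrow> P i (P j x) = 0"
  using assms unfolding order_partition_def by blast+

lemma order_partition_trivial: "order_partition 1 (\<lambda>_ x. x)"
  by (auto simp: order_partition_def order_projection_def linear_map_on_def)

lemma refine_simps:
  "refine Q P (2 * i) x = Q (P i x)" "refine Q P (Suc (2 * i)) x = P i x - Q (P i x)"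
  by (auto simp: refine_def)

lemma order_partition_refine:
  assumes P: "order_partition m P" and Q: "order_projection Q"
  shows "order_partition (2 * m) (refine Q P)"
proof -
  define R where "R k = (if even k then Q else (\<lambda>x. x - Q x))" for k :: nat
  have R: "order_projection (R k)" for k using Q order_projection_compl[OF Q] by (simp add: R_def)
  have ref: "refine Q P k = (\<lambda>x. R k (P (k div 2) x))" for k by (auto simp: refine_def R_def)
  note proj = order_partitionD(1)[OF P]
  have "order_projection (refine Q P k)" if "k < 2 * m" for k
    unfolding ref by (rule order_projection_compose[OF proj R]) (use that in auto)
  moreover have "(\<Sum>k<2 * m. refine Q P k x) = x" if "x \<in> oc_elements" for x
    using order_partitionD(2)[OF P that] by (simp add: sum_lessThan_double refine_simps)
  moreover have "refine Q P k (refine Q P l x) = 0" if kl: "k < 2 * m" "l < 2 * m" "k \<noteq> l" and x: "x \<in> oc_elements" for k l x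
  proof -
    have kd: "k div 2 < m" "l div 2 < m" using kl by auto
    have lx: "P (l div 2) x \<in> oc_elements" using order_projection_abs(2)[OF proj[OF kd(2)] x] .
    have "refine Q P k (refine Q P l x) = R k (R l (P (k div 2) (P (l div 2) x)))"
      unfolding ref using order_projection_commute[OF proj[OF kd(1)] R lx] by simp
    also have "\<dots> = 0"
    proof (cases "k div 2 = l div 2")
      case True
      then have "even k \<noteq> even l" using kl(3) by presburger
      then have "R k (R l y) = 0" if "y \<in> oc_elements" for y
        using that order_projection_linear(3)[OF Q] order_projection_idem[OF Q] order_projection_abs(2)[OF Q]
        by (auto simp: R_def)
      then show ?thesis using order_projection_abs(2)[OF proj[OF kd(1)] lx] by blast
    next
      case False
      then show ?thesis using order_partitionD(3)[OF P kd False x] order_projection_linear(6)[OF R] by simp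
    qed
    finally show ?thesis .
  qed
  ultimately show ?thesis by (simp add: order_partition_def)
qed

lemma partition_refine:
  assumes P: "order_partition m P" and Q: "order_projection Q" and x: "x \<in> oc_elements"
    and k: "k < 2 * m" and j: "j < m"
  shows "P j (refine Q P k x) = (if j = k div 2 then refine Q P k x else 0)"
    and "refine Q P k (P j x) = (if j = k div 2 then refine Q P k x else 0)"
proof -
  have kd: "k div 2 < m" using k by auto
  note proj = order_partitionD(1)[OF P]
  let ?y = "P (k div 2) x"
  have y: "?y \<in> oc_elements" using order_projection_abs(2)[OF proj[OF kd] x] .
  have "P j ?y = (if j = k div 2 then ?y else 0)"
    using order_partitionD(3)[OF P j kd _ x] order_projection_idem[OF proj[OF kd] x] by auto
  moreover have "P (k div 2) (P j x) = (if j = k div 2 then ?y else 0)"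
    using order_partitionD(3)[OF P kd j _ x] order_projection_idem[OF proj[OF kd] x] by auto
  moreover have "P j (Q ?y) = Q (P j ?y)" by (rule order_projection_commute[OF proj[OF j] Q y])
  moreover have "P j (?y - Q ?y) = P j ?y - P j (Q ?y)"
    by (rule order_projection_linear(3)[OF proj[OF j] y order_projection_abs(2)[OF Q y]])
  ultimately show "P j (refine Q P k x) = (if j = k div 2 then refine Q P k x else 0)"
    "refine Q P k (P j x) = (if j = k div 2 then refine Q P k x else 0)"
    using order_projection_linear(6)[OF Q] by (auto simp: refine_def)
qed


section \<open>Approximation of dominated operators\<close>

text \<open>
  For \<open>t > 0\<close> the bracket is \<open>(s - c t)\<^sup>2 / t\<close>, and \<open>d \<le> \<eta> + d\<^sup>2 / \<eta>\<close> for \<open>d = \<bar>s - c t\<bar> / t\<close>. The bracket is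
  linear in \<open>s\<close> and \<open>t\<close> apart from its first term, so it can be summed over the parts of a cell.
\<close>

lemma abs_diff_le_energy:
  fixes s t c \<eta> :: real
  assumes "0 \<le> s" "s \<le> t" "0 < \<eta>"
  shows "\<bar>s - c * t\<bar> \<le> \<eta> * t + (s\<^sup>2 / t - 2 * c * s + c\<^sup>2 * t) / \<eta>"
proof (cases "t = 0")
  case False
  with assms have t: "0 < t" by simp
  define d where "d = \<bar>s - c * t\<bar> / t"
  have d: "\<bar>s - c * t\<bar> = d * t" using t by (simp add: d_def)
  have "s\<^sup>2 / t - 2 * c * s + c\<^sup>2 * t = (s - c * t)\<^sup>2 / t" using t by (simp add: field_simps power2_eq_square)
  also have "\<dots> = d\<^sup>2 * t" using t by (simp add: d_def power_divide power2_eq_square)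
  finally have eq: "s\<^sup>2 / t - 2 * c * s + c\<^sup>2 * t = d\<^sup>2 * t" .
  have "d * \<eta> \<le> \<eta>\<^sup>2 + d\<^sup>2" using sum_squares_bound[of d \<eta>] sum_power2_ge_zero[of d \<eta>] by linarith
  then have "d \<le> \<eta> + d\<^sup>2 / \<eta>" using assms(3) by (simp add: field_simps power2_eq_square)
  then have "d * t \<le> (\<eta> + d\<^sup>2 / \<eta>) * t" using t by (intro mult_right_mono) auto
  then show ?thesis unfolding eq d by (simp add: algebra_simps)
qed (use assms in auto)

locale dominated_operator =
  fixes S T :: "'e::banach_lattice \<Rightarrow> 'f::banach_lattice" and \<phi> :: "'f \<Rightarrow> real" and u :: 'e
  assumes S: "bounded_linear S" and T: "bounded_linear T"
    and S_pos: "\<And>x. 0 \<le> x \<Longrightarrow> 0 \<le> S x" and S_le_T: "\<And>x. 0 \<le> x \<Longrightarrow> S x \<le> T x"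
    and \<phi>: "positive_functional \<phi>" and F: "(oc_elements :: 'f set) = UNIV"
    and u: "u \<in> oc_elements" "0 \<le> u"
begin

lemma S_linear: "linear S" and T_linear: "linear T" and \<phi>_linear: "linear \<phi>"
  using S T \<phi> by (auto simp: bounded_linear.linear positive_functional_def)

lemma T_pos: "0 \<le> x \<Longrightarrow> 0 \<le> T x"
  using S_pos S_le_T order_trans by blast

definition \<sigma> where "\<sigma> p q = \<phi> (q (S (p u)))"
definition \<tau> where "\<tau> p q = \<phi> (q (T (p u)))"

lemma \<sigma>_\<tau>:
  assumes "order_projection p" "order_projection q" shows "0 \<le> \<sigma> p q" "\<sigma> p q \<le> \<tau> p q"
proof -
  have p: "0 \<le> p u" using order_projection_pos[OF assms(1) u] by simp
  have q: "0 \<le> q y" if "0 \<le> y" for y using order_projection_pos[OF assms(2), of y] that F by simp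
  have "0 \<le> q (S (p u))" by (intro q S_pos p)
  moreover have "0 \<le> q (T (p u) - S (p u))" using S_le_T[OF p] by (intro q) simp
  then have "q (S (p u)) \<le> q (T (p u))" using order_projection_linear(3)[OF assms(2)] F by simp
  ultimately show "0 \<le> \<sigma> p q" "\<sigma> p q \<le> \<tau> p q"
    using positive_functional_mono[OF \<phi>] linear_0[OF \<phi>_linear] unfolding \<sigma>_def \<tau>_def by metis+
qed

text \<open>
  The integral of the squared density of \<open>\<sigma>\<close> with respect to \<open>\<tau>\<close>, for densities that are constant on
  the cells. Cells with \<open>\<tau> = 0\<close> contribute 0, by the convention for division by 0.
\<close>

definition energy where
  "energy m P n B = (\<Sum>i<m. \<Sum>j<n. (\<sigma> (P i) (B j))\<^sup>2 / \<tau> (P i) (B j))"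

lemma sum_\<tau>:
  assumes P: "order_partition m P" and B: "order_partition n B"
  shows "(\<Sum>i<m. \<Sum>j<n. \<tau> (P i) (B j)) = \<phi> (T u)"
proof -
  have "(\<Sum>j<n. \<tau> (P i) (B j)) = \<phi> (T (P i u))" for i
    unfolding \<tau>_def using order_partitionD(2)[OF B, of "T (P i u)"] F by (simp add: linear_sum[OF \<phi>_linear, symmetric])
  then show ?thesis
    using order_partitionD(2)[OF P u(1)] by (simp add: linear_sum[OF \<phi>_linear, symmetric] linear_sum[OF T_linear, symmetric])
qed

lemma energy_le:
  assumes P: "order_partition m P" and B: "order_partition n B"
  shows "energy m P n B \<le> \<phi> (T u)"
proof -
  have "(\<sigma> (P i) (B j))\<^sup>2 / \<tau> (P i) (B j) \<le> \<tau> (P i) (B j)" if "i < m" "j < n" for i j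
  proof -
    note st = \<sigma>_\<tau>[OF order_partitionD(1)[OF P that(1)] order_partitionD(1)[OF B that(2)]]
    have "(\<sigma> (P i) (B j))\<^sup>2 \<le> \<tau> (P i) (B j) * \<tau> (P i) (B j)" unfolding power2_eq_square using st by (intro mult_mono) auto
    then show ?thesis using st by (cases "\<tau> (P i) (B j) = 0") (auto simp: divide_le_eq)
  qed
  then have "energy m P n B \<le> (\<Sum>i<m. \<Sum>j<n. \<tau> (P i) (B j))" unfolding energy_def by (intro sum_mono) auto
  then show ?thesis by (simp add: sum_\<tau>[OF P B])
qed

lemma near_maximal_energy:
  assumes \<eta>: "\<eta> > 0"
  obtains m P n B where "order_partition m P" "order_partition n B"
    "\<And>m' P' n' B'. order_partition m' P' \<Longrightarrow> order_partition n' B' \<Longrightarrow> energy m' P' n' B' \<le> energy m P n B + \<eta>"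
proof -
  define X where "X = {energy m P n B | m P n B. order_partition m P \<and> order_partition n B}"
  have bdd: "bdd_above X" using energy_le by (intro bdd_aboveI[of _ "\<phi> (T u)"]) (auto simp: X_def)
  obtain m0 and P0 :: "nat \<Rightarrow> 'e \<Rightarrow> 'e" where "order_partition m0 P0" using order_partition_trivial by metis
  moreover obtain n0 and B0 :: "nat \<Rightarrow> 'f \<Rightarrow> 'f" where "order_partition n0 B0" using order_partition_trivial by metis
  ultimately have ne: "X \<noteq> {}" unfolding X_def by blast
  have "Sup X - \<eta> < Sup X" using \<eta> by simp
  then obtain y where "y \<in> X" "Sup X - \<eta> < y" using less_cSup_iff[OF ne bdd] by blast
  then obtain m P n B where g: "order_partition m P" "order_partition n B" "Sup X - \<eta> < energy m P n B"
    unfolding X_def by blast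
  have "energy m' P' n' B' \<le> energy m P n B + \<eta>" if "order_partition m' P'" "order_partition n' B'" for m' P' n' B'
  proof -
    have "energy m' P' n' B' \<in> X" using that unfolding X_def by blast
    then have "energy m' P' n' B' \<le> Sup X" by (rule cSup_upper[OF _ bdd])
    with g(3) show ?thesis by simp
  qed
  with g show thesis using that by blast
qed

text \<open>
  The operator whose density with respect to \<open>T\<close> is constant on the cells, with the average
  density \<open>\<sigma> / \<tau>\<close> as value.
\<close>

definition step where
  "step m P n B x = (\<Sum>i<m. \<Sum>j<n. (\<sigma> (P i) (B j) / \<tau> (P i) (B j)) *\<^sub>R B j (T (P i x)))"

lemma step_linear:
  assumes P: "order_partition m P" and B: "order_partition n B"
  shows "linear_map_on oc_elements (step m P n B)"
proof -
  let ?c = "\<lambda>i j. \<sigma> (P i) (B j) / \<tau> (P i) (B j)"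
  have BF: "B j (v + w) = B j v + B j w" "B j (t *\<^sub>R v) = t *\<^sub>R B j v" if "j < n" for j v w t
    using order_projection_linear(2,5)[OF order_partitionD(1)[OF B that]] F by simp_all
  have "step m P n B (x + y) = step m P n B x + step m P n B y" if xy: "x \<in> oc_elements" "y \<in> oc_elements" for x y
    unfolding step_def sum.distrib[symmetric]
  proof (intro sum.cong refl)
    fix i j assume ij: "i \<in> {..<m}" "j \<in> {..<n}"
    then have "P i (x + y) = P i x + P i y" using order_projection_linear(2)[OF order_partitionD(1)[OF P] xy] by simp
    then show "?c i j *\<^sub>R B j (T (P i (x + y))) = ?c i j *\<^sub>R B j (T (P i x)) + ?c i j *\<^sub>R B j (T (P i y))"
      using ij by (simp add: linear_add[OF T_linear] BF scaleR_right_distrib)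
  qed
  moreover have "step m P n B (t *\<^sub>R x) = t *\<^sub>R step m P n B x" if x: "x \<in> oc_elements" for t x
    unfolding step_def scaleR_sum_right
  proof (intro sum.cong refl)
    fix i j assume ij: "i \<in> {..<m}" "j \<in> {..<n}"
    then have "P i (t *\<^sub>R x) = t *\<^sub>R P i x" using order_projection_linear(5)[OF order_partitionD(1)[OF P] x] by simp
    then show "?c i j *\<^sub>R B j (T (P i (t *\<^sub>R x))) = t *\<^sub>R ?c i j *\<^sub>R B j (T (P i x))"
      using ij by (simp add: linear_scale[OF T_linear] BF mult.commute)
  qed
  ultimately show ?thesis by (simp add: linear_map_on_def)
qed

lemma coefficient_bounds:
  assumes P: "order_partition m P" and B: "order_partition n B" and ij: "i < m" "j < n"
  shows "0 \<le> \<sigma> (P i) (B j) / \<tau> (P i) (B j)" "\<sigma> (P i) (B j) / \<tau> (P i) (B j) \<le> 1"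
proof -
  note st = \<sigma>_\<tau>[OF order_partitionD(1)[OF P ij(1)] order_partitionD(1)[OF B ij(2)]]
  show "0 \<le> \<sigma> (P i) (B j) / \<tau> (P i) (B j)" "\<sigma> (P i) (B j) / \<tau> (P i) (B j) \<le> 1"
    using st by (auto simp: divide_le_eq_1)
qed

lemma step_bounds:
  assumes P: "order_partition m P" and B: "order_partition n B" and x: "x \<in> oc_elements" "0 \<le> x"
  shows "0 \<le> step m P n B x" "step m P n B x \<le> T x"
proof -
  have b: "0 \<le> B j (T (P i x))" if "i < m" "j < n" for i j
    using order_projection_pos(1)[OF order_partitionD(1)[OF P that(1)] x] F
      order_projection_pos(1)[OF order_partitionD(1)[OF B that(2)]] T_pos by simp
  show "0 \<le> step m P n B x"
    unfolding step_def using b coefficient_bounds[OF P B] by (intro sum_nonneg scaleR_nonneg_nonneg) auto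
  have "step m P n B x \<le> (\<Sum>i<m. \<Sum>j<n. 1 *\<^sub>R B j (T (P i x)))"
    unfolding step_def using b coefficient_bounds[OF P B] by (intro sum_mono scaleR_right_mono) auto
  also have "\<dots> = T x"
    using order_partitionD(2)[OF B] order_partitionD(2)[OF P x(1)] F by (simp add: linear_sum[OF T_linear, symmetric])
  finally show "step m P n B x \<le> T x" .
qed

text \<open>
  A refined cell lies in one coarse cell, so only one term of \<open>step\<close> survives.
\<close>

lemma step_cell:
  assumes P: "order_partition m P" and B: "order_partition n B" and Q: "order_projection Q" and C: "order_projection C"
    and k: "k < 2 * m" and l: "l < 2 * n"
  shows "\<phi> (refine C B l (step m P n B (refine Q P k u))) =
    \<sigma> (P (k div 2)) (B (l div 2)) / \<tau> (P (k div 2)) (B (l div 2)) * \<tau> (refine Q P k) (refine C B l)"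
proof -
  define c where "c i j = \<sigma> (P i) (B j) / \<tau> (P i) (B j)" for i j
  have kd: "k div 2 < m" and ld: "l div 2 < n" using k l by auto
  let ?x = "refine Q P k u"
  note L = order_projection_linear[OF order_partitionD(1)[OF order_partition_refine[OF B C] l]]
  have T0: "T 0 = 0" by (rule linear_0[OF T_linear])
  have B0: "B j 0 = 0" if "j < n" for j using order_projection_linear(6)[OF order_partitionD(1)[OF B that]] .
  have "step m P n B ?x = (\<Sum>i<m. if i = k div 2 then (\<Sum>j<n. c i j *\<^sub>R B j (T ?x)) else 0)"
    unfolding step_def c_def[symmetric] using partition_refine(1)[OF P Q u(1) k] T0 B0
    by (intro sum.cong refl) auto
  also have "\<dots> = (\<Sum>j<n. c (k div 2) j *\<^sub>R B j (T ?x))" using kd by (simp add: sum.delta)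
  finally have "refine C B l (step m P n B ?x) = (\<Sum>j<n. c (k div 2) j *\<^sub>R refine C B l (B j (T ?x)))"
    using F by (simp add: L(5,7))
  also have "\<dots> = (\<Sum>j<n. if j = l div 2 then c (k div 2) j *\<^sub>R refine C B l (T ?x) else 0)"
    using partition_refine(2)[OF B C _ l] F by (intro sum.cong refl) auto
  also have "\<dots> = c (k div 2) (l div 2) *\<^sub>R refine C B l (T ?x)" using ld by (simp add: sum.delta)
  finally show ?thesis by (simp add: linear_scale[OF \<phi>_linear] c_def \<tau>_def)
qed

text \<open>
  The sum over the cells of a refinement of the squared deviations, divided by \<open>\<tau>\<close>, is the gain of
  energy. The coefficient \<open>\<sigma> / \<tau>\<close> of the coarse cell is what makes the cross terms add up
  to minus the energy of the coarse grid.
\<close>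

lemma refinement_deviation:
  assumes P: "order_partition m P" and B: "order_partition n B" and Q: "order_projection Q" and C: "order_projection C"
    and \<eta>: "\<eta> > 0" and max: "energy (2 * m) (refine Q P) (2 * n) (refine C B) \<le> energy m P n B + \<eta>\<^sup>2"
  shows "(\<Sum>k<2*m. \<Sum>l<2*n. \<bar>\<phi> (refine C B l (S (refine Q P k u) - step m P n B (refine Q P k u)))\<bar>)
    \<le> \<eta> * (\<phi> (T u) + 1)"
proof -
  define c where "c i j = \<sigma> (P i) (B j) / \<tau> (P i) (B j)" for i j
  define s where "s k l = \<sigma> (refine Q P k) (refine C B l)" for k l
  define t where "t k l = \<tau> (refine Q P k) (refine C B l)" for k l
  note P' = order_partition_refine[OF P Q] and B' = order_partition_refine[OF B C]
  have st: "0 \<le> s k l" "s k l \<le> t k l" if "k < 2 * m" "l < 2 * n" for k l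
    unfolding s_def t_def using \<sigma>_\<tau> order_partitionD(1)[OF P' that(1)] order_partitionD(1)[OF B' that(2)] by auto
  have \<sigma>_sum: "s (2*i) (2*j) + s (2*i) (2*j+1) + (s (2*i+1) (2*j) + s (2*i+1) (2*j+1)) = \<sigma> (P i) (B j)"
    and \<tau>_sum: "t (2*i) (2*j) + t (2*i) (2*j+1) + (t (2*i+1) (2*j) + t (2*i+1) (2*j+1)) = \<tau> (P i) (B j)"
    if ij: "i < m" "j < n" for i j
  proof -
    have lin: "linear \<phi>" by (rule \<phi>_linear)
    have Bd: "B j (v - w) = B j v - B j w" for v w using ij F order_projection_linear(3)[OF order_partitionD(1)[OF B]] by simp
    show "s (2*i) (2*j) + s (2*i) (2*j+1) + (s (2*i+1) (2*j) + s (2*i+1) (2*j+1)) = \<sigma> (P i) (B j)"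
      by (simp add: s_def \<sigma>_def refine_simps linear_diff[OF lin] linear_diff[OF S_linear] Bd)
    show "t (2*i) (2*j) + t (2*i) (2*j+1) + (t (2*i+1) (2*j) + t (2*i+1) (2*j+1)) = \<tau> (P i) (B j)"
      by (simp add: t_def \<tau>_def refine_simps linear_diff[OF lin] linear_diff[OF T_linear] Bd)
  qed
  have dev: "\<phi> (refine C B l (S (refine Q P k u) - step m P n B (refine Q P k u))) = s k l - c (k div 2) (l div 2) * t k l"
    if kl: "k < 2 * m" "l < 2 * n" for k l
  proof -
    have "refine C B l (v - w) = refine C B l v - refine C B l w" for v w
      using F order_projection_linear(3)[OF order_partitionD(1)[OF B' kl(2)]] by simp
    then show ?thesis
      using step_cell[OF P B Q C kl] by (simp add: linear_diff[OF \<phi>_linear] s_def t_def c_def \<sigma>_def)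
  qed
  have quad: "(\<Sum>k<2*m. \<Sum>l<2*n. - 2 * c (k div 2) (l div 2) * s k l + (c (k div 2) (l div 2))\<^sup>2 * t k l) = - energy m P n B"
  proof -
    have cell: "- 2 * c i j * \<sigma> (P i) (B j) + (c i j)\<^sup>2 * \<tau> (P i) (B j) = - ((\<sigma> (P i) (B j))\<^sup>2 / \<tau> (P i) (B j))" for i j
      by (cases "\<tau> (P i) (B j) = 0") (auto simp: c_def power2_eq_square field_simps)
    have "(\<Sum>k<2*m. \<Sum>l<2*n. - 2 * c (k div 2) (l div 2) * s k l + (c (k div 2) (l div 2))\<^sup>2 * t k l) =
      (\<Sum>i<m. \<Sum>j<n. - 2 * c i j * (s (2*i) (2*j) + s (2*i) (2*j+1) + (s (2*i+1) (2*j) + s (2*i+1) (2*j+1)))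
        + (c i j)\<^sup>2 * (t (2*i) (2*j) + t (2*i) (2*j+1) + (t (2*i+1) (2*j) + t (2*i+1) (2*j+1))))"
      unfolding sum_lessThan_double sum.distrib[symmetric] by (intro sum.cong refl) (simp add: algebra_simps)
    also have "\<dots> = (\<Sum>i<m. \<Sum>j<n. - ((\<sigma> (P i) (B j))\<^sup>2 / \<tau> (P i) (B j)))"
      by (intro sum.cong refl) (simp only: \<sigma>_sum \<tau>_sum lessThan_iff cell)
    also have "\<dots> = - energy m P n B" by (simp add: energy_def sum_negf)
    finally show ?thesis .
  qed
  have "(\<Sum>k<2*m. \<Sum>l<2*n. \<bar>\<phi> (refine C B l (S (refine Q P k u) - step m P n B (refine Q P k u)))\<bar>)
    = (\<Sum>k<2*m. \<Sum>l<2*n. \<bar>s k l - c (k div 2) (l div 2) * t k l\<bar>)"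
    by (intro sum.cong refl) (simp only: dev lessThan_iff)
  also have "\<dots> \<le> (\<Sum>k<2*m. \<Sum>l<2*n. \<eta> * t k l + ((s k l)\<^sup>2 / t k l - 2 * c (k div 2) (l div 2) * s k l + (c (k div 2) (l div 2))\<^sup>2 * t k l) / \<eta>)"
    using st \<eta> by (intro sum_mono abs_diff_le_energy) auto
  also have "\<dots> = \<eta> * (\<Sum>k<2*m. \<Sum>l<2*n. t k l) + ((\<Sum>k<2*m. \<Sum>l<2*n. (s k l)\<^sup>2 / t k l) +
    (\<Sum>k<2*m. \<Sum>l<2*n. - 2 * c (k div 2) (l div 2) * s k l + (c (k div 2) (l div 2))\<^sup>2 * t k l)) / \<eta>"
    unfolding sum_distrib_left sum.distrib[symmetric] sum_divide_distrib by (intro sum.cong refl) (simp add: algebra_simps)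
  also have "\<dots> = \<eta> * \<phi> (T u) + (energy (2*m) (refine Q P) (2*n) (refine C B) - energy m P n B) / \<eta>"
    unfolding quad using sum_\<tau>[OF P' B'] by (simp add: energy_def s_def t_def)
  also have "\<dots> \<le> \<eta> * \<phi> (T u) + \<eta>\<^sup>2 / \<eta>" using max \<eta> by (intro add_left_mono divide_right_mono) auto
  also have "\<dots> = \<eta> * (\<phi> (T u) + 1)" using \<eta> by (simp add: power2_eq_square algebra_simps)
  finally show ?thesis .
qed

text \<open>
  The modulus of \<open>z\<close> is detected by the projection \<open>C\<close> onto the band of its positive part. So refining by
  \<open>Q\<close> on the one side and by \<open>C\<close> on the other turns \<open>\<phi> \<bar>z\<bar>\<close> into a sum over cells.
\<close>

lemma deviation_on_components:
  assumes P: "order_partition m P" and B: "order_partition n B" and \<eta>: "\<eta> > 0"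
    and max: "\<And>Q C. order_projection Q \<Longrightarrow> order_projection C \<Longrightarrow>
      energy (2 * m) (refine Q P) (2 * n) (refine C B) \<le> energy m P n B + \<eta>\<^sup>2"
    and Q: "order_projection Q"
  shows "\<phi> \<bar>S (Q u) - step m P n B (Q u)\<bar> \<le> \<eta> * (\<phi> (T u) + 1)"
proof -
  define D where "D x = S x - step m P n B x" for x
  have D_linear: "linear_map_on oc_elements D"
    using step_linear[OF P B] by (simp add: linear_map_on_def D_def linear_add[OF S_linear] linear_scale[OF S_linear] scaleR_diff_right)
  define z where "z = D (Q u)"
  define C where "C = band_proj (pprt z)"
  have C: "order_projection C" unfolding C_def by (intro order_projection_band_proj) simp
  have Cz: "C z = pprt z" unfolding C_def by (intro band_proj_pprt) (simp add: F)
  define d where "d k l = \<phi> (refine C B l (D (refine Q P k u)))" for k l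
  note C_linear = order_projection_linear[OF C, unfolded F, simplified]
  have ref: "refine C B (2*j) w = C (B j w)" "refine C B (2*j+1) w = B j w - C (B j w)" for j w
    by (auto simp: refine_def)
  have even: "(\<Sum>j<n. refine C B (2*j) w) = C w" and odd: "(\<Sum>j<n. refine C B (2*j+1) w) = w - C w" for w
  proof -
    have w: "(\<Sum>j<n. B j w) = w" using order_partitionD(2)[OF B, of w] F by simp
    show "(\<Sum>j<n. refine C B (2*j) w) = C w" unfolding ref using C_linear(7)[of "\<lambda>j. B j w" "{..<n}"] w by simp
    then show "(\<Sum>j<n. refine C B (2*j+1) w) = w - C w" unfolding ref by (simp add: sum_subtractf w)
  qed
  have PM: "P i u \<in> oc_elements" if "i < m" for i using order_projection_abs(2)[OF order_partitionD(1)[OF P that] u(1)] .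
  have QM: "refine Q P (2*i) u \<in> oc_elements" if "i < m" for i
    using order_projection_abs(2)[OF Q PM[OF that]] by (simp add: refine_def)
  have "Q u = (\<Sum>i<m. refine Q P (2*i) u)"
    using order_projection_linear(7)[OF Q, of "{..<m}" "\<lambda>i. P i u"] PM order_partitionD(2)[OF P u(1)] by (simp add: refine_def)
  then have z: "z = (\<Sum>i<m. D (refine Q P (2*i) u))"
    unfolding z_def using linear_map_onD(6)[OF subspace_oc_elements D_linear, of "{..<m}" "\<lambda>i. refine Q P (2*i) u"] QM by simp
  have Cz_eq: "C z = (\<Sum>i<m. \<Sum>j<n. refine C B (2*j) (D (refine Q P (2*i) u)))"
    unfolding even by (subst z) (simp add: C_linear(7))
  have zCz_eq: "z - C z = (\<Sum>i<m. \<Sum>j<n. refine C B (2*j+1) (D (refine Q P (2*i) u)))"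
    unfolding odd sum_subtractf C_linear(7)[symmetric] z[symmetric] ..
  have "\<bar>z\<bar> = C z - (z - C z)" using Cz pprt_diff[of z] by (simp add: abs_eq_pprt_add algebra_simps)
  then have "\<phi> \<bar>z\<bar> = \<phi> (C z) - \<phi> (z - C z)" by (simp only: linear_diff[OF \<phi>_linear])
  also have "\<dots>= (\<Sum>i<m. \<Sum>j<n. d (2*i) (2*j) - d (2*i) (2*j+1))"
    unfolding zCz_eq unfolding Cz_eq by (simp only: linear_sum[OF \<phi>_linear] d_def sum_subtractf)
  also have "\<dots> \<le> (\<Sum>i<m. \<Sum>j<n. \<bar>d (2*i) (2*j)\<bar> + \<bar>d (2*i) (2*j+1)\<bar> + (\<bar>d (2*i+1) (2*j)\<bar> + \<bar>d (2*i+1) (2*j+1)\<bar>))"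
    by (intro sum_mono) linarith
  also have "\<dots> = (\<Sum>k<2*m. \<Sum>l<2*n. \<bar>d k l\<bar>)"
    unfolding sum_lessThan_double sum.distrib[symmetric] ..
  also have "\<dots> \<le> \<eta> * (\<phi> (T u) + 1)"
    using refinement_deviation[OF P B Q C \<eta> max[OF Q C]] by (simp add: d_def D_def)
  finally show ?thesis by (simp add: z_def D_def)
qed

text \<open>
  Components \<open>Q u\<close> suffice: if \<open>Q\<close> projects onto the band where \<open>2 y\<close> exceeds \<open>u\<close>, then
  \<open>y' = 2 y - Q u\<close> is again in \<open>[0, u]\<close>, and \<open>y = (Q u + y') / 2\<close>. Repeating this is a binary
  expansion of \<open>y\<close>.
\<close>

lemma approximation:
  assumes \<epsilon>: "\<epsilon> > 0"
  obtains m P n B where "order_partition m P" "order_partition n B"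
    "\<And>y. 0 \<le> y \<Longrightarrow> y \<le> u \<Longrightarrow> \<phi> \<bar>S y - step m P n B y\<bar> \<le> \<epsilon>"
proof -
  have Tu: "0 \<le> \<phi> (T u)" using \<phi> T_pos[OF u(2)] by (simp add: positive_functional_def)
  define \<eta> where "\<eta> = \<epsilon> / (\<phi> (T u) + 1)"
  have \<eta>: "\<eta> > 0" "\<eta> * (\<phi> (T u) + 1) = \<epsilon>" using \<epsilon> Tu by (auto simp: \<eta>_def)
  obtain m P n B where P: "order_partition m P" and B: "order_partition n B" and
    max: "\<And>m' P' n' B'. order_partition m' P' \<Longrightarrow> order_partition n' B' \<Longrightarrow> energy m' P' n' B' \<le> energy m P n B + \<eta>\<^sup>2"
    by (rule near_maximal_energy[of "\<eta>\<^sup>2"]) (use \<eta> in auto)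
  define D where "D x = S x - step m P n B x" for x
  have D_linear: "linear_map_on oc_elements D"
    using step_linear[OF P B] by (simp add: linear_map_on_def D_def linear_add[OF S_linear] linear_scale[OF S_linear] scaleR_diff_right)
  have comp: "\<phi> \<bar>D (Q u)\<bar> \<le> \<epsilon>" if Q: "order_projection Q" for Q
  proof -
    have "\<phi> \<bar>D (Q u)\<bar> \<le> \<eta> * (\<phi> (T u) + 1)"
      unfolding D_def
      by (rule deviation_on_components[OF P B \<eta>(1) max Q]) (auto intro: order_partition_refine P B)
    then show ?thesis by (simp only: \<eta>(2))
  qed
  have bound: "\<phi> \<bar>D y\<bar> \<le> \<epsilon> + 2 * \<phi> (T u) * (1/2) ^ N" if "0 \<le> y" "y \<le> u" for y N
    using that
  proof (induction N arbitrary: y)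
    case 0
    have y: "y \<in> oc_elements" using oc_elements_below[OF u(1)] 0 by blast
    have "T y \<le> T u" using T_pos[of "u - y"] 0 by (simp add: linear_diff[OF T_linear])
    have "\<bar>D y\<bar> \<le> \<bar>S y\<bar> + \<bar>step m P n B y\<bar>" unfolding D_def by (rule abs_triangle_ineq4)
    also have "\<dots> \<le> T u + T u"
      using S_pos[OF 0(1)] S_le_T[OF 0(1)] step_bounds[OF P B y 0(1)] \<open>T y \<le> T u\<close> by (intro add_mono) auto
    finally have "\<phi> \<bar>D y\<bar> \<le> \<phi> (T u + T u)" by (rule positive_functional_mono[OF \<phi>])
    then show ?case using \<epsilon> by (simp add: linear_add[OF \<phi>_linear])
  next
    case (Suc N)
    have y: "y \<in> oc_elements" using oc_elements_below[OF u(1)] Suc.prems by blast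
    define w where "w = 2 *\<^sub>R y - u"
    have w: "w \<in> oc_elements" unfolding w_def using y u by (intro oc_elements_diff oc_elements_scale)
    define Q where "Q = band_proj (pprt w)"
    have Q: "order_projection Q" unfolding Q_def by (intro order_projection_band_proj) simp
    have Qw: "Q w = pprt w" unfolding Q_def using w by (rule band_proj_pprt)
    have Qw': "Q w = 2 *\<^sub>R Q y - Q u"
      unfolding w_def using y u by (simp add: order_projection_linear(3,5)[OF Q] oc_elements_scale)
    define y' where "y' = 2 *\<^sub>R y - Q u"
    have y'0: "0 \<le> y'"
    proof -
      have "y' = 2 *\<^sub>R (y - Q y) + pprt w" unfolding y'_def Qw[symmetric] Qw' by (simp add: algebra_simps)
      also have "0 \<le> \<dots>" using order_projection_pos[OF Q y] Suc.prems by (intro add_nonneg_nonneg scaleR_nonneg_nonneg) auto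
      finally show ?thesis .
    qed
    have y'u: "y' \<le> u"
    proof -
      have "0 \<le> Q (u - y)" using Suc.prems u y by (intro order_projection_pos[OF Q] oc_elements_diff) auto
      then have "0 \<le> pprt (- w) + 2 *\<^sub>R (Q u - Q y)"
        using u y by (intro add_nonneg_nonneg scaleR_nonneg_nonneg) (auto simp: order_projection_linear(3)[OF Q])
      also have "pprt (- w) = Q w - w" using pprt_diff[of w] Qw by (simp add: algebra_simps)
      also have "Q w - w + 2 *\<^sub>R (Q u - Q y) = u - y'" unfolding Qw' unfolding y'_def w_def by (simp add: scaleR_2 algebra_simps)
      finally show ?thesis by simp
    qed
    have y': "y' \<in> oc_elements" using oc_elements_below[OF u(1) y'0 y'u] .
    have Qu: "Q u \<in> oc_elements" using order_projection_abs(2)[OF Q u(1)] .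
    have "y = (1/2) *\<^sub>R (Q u + y')" by (simp add: y'_def)
    then have "D y = (1/2) *\<^sub>R (D (Q u) + D y')"
      using linear_map_onD(1,2)[OF subspace_oc_elements D_linear] Qu y' by (simp add: oc_elements_add)
    then have "\<bar>D y\<bar> \<le> (1/2) *\<^sub>R (\<bar>D (Q u)\<bar> + \<bar>D y'\<bar>)"
      unfolding abs_scaleR by (simp add: abs_scaleR scaleR_left_mono abs_triangle_ineq)
    then have "\<phi> \<bar>D y\<bar> \<le> (1/2) * (\<phi> \<bar>D (Q u)\<bar> + \<phi> \<bar>D y'\<bar>)"
      using positive_functional_mono[OF \<phi>] by (metis linear_add[OF \<phi>_linear] linear_scale[OF \<phi>_linear] real_scaleR_def)
    with comp[OF Q] Suc.IH[OF y'0 y'u] show ?case by simp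
  qed
  have "\<phi> \<bar>D y\<bar> \<le> \<epsilon>" if y: "0 \<le> y" "y \<le> u" for y
  proof (rule LIMSEQ_le_const)
    have "(\<lambda>N. \<epsilon> + 2 * \<phi> (T u) * (1/2) ^ N) \<longlonglongrightarrow> \<epsilon> + 2 * \<phi> (T u) * 0"
      by (intro tendsto_intros LIMSEQ_realpow_zero) auto
    then show "(\<lambda>N. \<epsilon> + 2 * \<phi> (T u) * (1/2) ^ N) \<longlonglongrightarrow> \<epsilon>" by simp
    show "\<exists>N. \<forall>n\<ge>N. \<phi> \<bar>D y\<bar> \<le> \<epsilon> + 2 * \<phi> (T u) * (1/2) ^ n" using bound[OF y] by blast
  qed
  with P B show thesis using that by (simp add: D_def)
qed

end

section \<open>Order continuous range\<close>

lemma weakly_null_subseq: "weakly_null x \<Longrightarrow> strict_mono r \<Longrightarrow> weakly_null (\<lambda>n. x (r n))"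
  unfolding weakly_null_def using LIMSEQ_subseq_LIMSEQ by (fastforce simp: o_def)

lemma L_weakly_compact_mono_solid:
  assumes "L_weakly_compact A" "B \<noteq> {}" "\<And>y. y \<in> B \<Longrightarrow> \<exists>x\<in>A. \<bar>y\<bar> \<le> \<bar>x\<bar>"
  shows "L_weakly_compact B"
proof -
  have "solid_hull B \<subseteq> solid_hull A"
    using assms(3) unfolding solid_hull_def by (blast intro: order_trans)
  moreover obtain C where C: "\<And>x. x \<in> A \<Longrightarrow> norm x \<le> C" using assms(1) unfolding L_weakly_compact_def bounded_iff by blast
  have "norm y \<le> C" if "y \<in> B" for y
  proof -
    from assms(3)[OF that] obtain x where "x \<in> A" "\<bar>y\<bar> \<le> \<bar>x\<bar>" by blast
    then show ?thesis using norm_mono_abs C order_trans by blast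
  qed
  then have "bounded B" unfolding bounded_iff by blast
  ultimately show ?thesis using assms(1,2) unfolding L_weakly_compact_def by (meson subsetD)
qed

text \<open>
  The sum of the functionals \<open>2\<^sup>-\<^sup>n \<psi>\<^sub>n\<close>.
\<close>

lemma positive_functional_series:
  fixes \<psi> :: "nat \<Rightarrow> 'a::banach_lattice \<Rightarrow> real"
  assumes \<psi>: "\<And>n. positive_functional (\<psi> n)" "\<And>n x. \<bar>\<psi> n x\<bar> \<le> norm x"
  obtains \<phi> where "positive_functional \<phi>" "\<And>v n. 0 \<le> v \<Longrightarrow> \<phi> v = 0 \<Longrightarrow> \<psi> n v = 0"
proof -
  have sg: "summable (\<lambda>n. (1/2::real) ^ n * c)" for c by (intro summable_mult2 summable_geometric) auto
  have summ: "summable (\<lambda>n. (1/2) ^ n * \<psi> n x)" for x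
  proof (rule summable_comparison_test'[OF sg[of "norm x"]])
    show "norm ((1/2) ^ n * \<psi> n x) \<le> (1/2) ^ n * norm x" for n using \<psi>(2)[of n x] by (simp add: abs_mult divide_right_mono)
  qed
  define \<phi> where "\<phi> x = (\<Sum>n. (1/2) ^ n * \<psi> n x)" for x
  have lin: "linear (\<psi> n)" for n using \<psi>(1) by (simp add: positive_functional_def bounded_linear.linear)
  have pos: "0 \<le> (1/2) ^ n * \<psi> n x" if "0 \<le> x" for n x using \<psi>(1)[of n] that by (simp add: positive_functional_def)
  have "bounded_linear \<phi>"
  proof (rule bounded_linear_intro)
    show "\<phi> (x + y) = \<phi> x + \<phi> y" for x y
      unfolding \<phi>_def by (subst suminf_add[OF summ summ]) (simp add: linear_add[OF lin] distrib_left)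
    show "\<phi> (t *\<^sub>R x) = t *\<^sub>R \<phi> x" for t x
      unfolding \<phi>_def real_scaleR_def suminf_mult[OF summ, symmetric] by (simp add: linear_scale[OF lin] mult.left_commute)
    fix x
    have "norm (\<phi> x) \<le> (\<Sum>n. norm ((1/2) ^ n * \<psi> n x))"
      unfolding \<phi>_def
      by (intro summable_norm summable_comparison_test'[OF sg[of "norm x"]]) (use \<psi>(2)[of _ x] in \<open>simp add: abs_mult divide_right_mono\<close>)
    also have "\<dots> \<le> (\<Sum>n. (1/2) ^ n * norm x)"
      by (intro suminf_le sg summable_comparison_test'[OF sg[of "norm x"]]) (use \<psi>(2)[of _ x] in \<open>simp_all add: abs_mult divide_right_mono\<close>)
    also have "\<dots> = norm x * 2" by (subst suminf_mult2[symmetric]) (auto simp: suminf_geometric intro: summable_geometric)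
    finally show "norm (\<phi> x) \<le> norm x * 2" .
  qed
  then have "positive_functional \<phi>" using pos suminf_nonneg[OF summ] by (simp add: positive_functional_def \<phi>_def)
  moreover have "\<psi> n v = 0" if "0 \<le> v" "\<phi> v = 0" for v n
    using suminf_eq_zero_iff[OF summ, of v] pos[OF that(1)] that(2) by (simp add: \<phi>_def)
  ultimately show thesis by (rule that)
qed

lemma split_at:
  fixes x :: "'a::banach_lattice"
  shows "x = inf (pprt x) u - inf (pprt (- x)) u + (pprt (pprt x - u) - pprt (pprt (- x) - u))"
  using inf_add_pprt_diff[of "pprt x" u] inf_add_pprt_diff[of "pprt (- x)" u] pprt_diff[of x]
  by (simp add: algebra_simps)

context
  fixes S T :: "'e::banach_lattice \<Rightarrow> 'f::banach_lattice"
  assumes S: "bounded_linear S" and T_Lwcc: "Lwcc T"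
    and S_pos: "\<And>x. 0 \<le> x \<Longrightarrow> 0 \<le> S x" and S_le_T: "\<And>x. 0 \<le> x \<Longrightarrow> S x \<le> T x"
    and F: "(oc_elements :: 'f set) = UNIV"
begin

text \<open>
  On the order bounded part of \<open>y\<close>, the operator \<open>S\<close> is replaced by the operator \<open>step\<close> up to a
  small error in \<open>\<phi>\<close>; the remaining part of \<open>y\<close> is small in norm, and \<open>step\<close> is dominated by \<open>T\<close>.
\<close>

lemma dominated_functional_null:
  fixes y :: "nat \<Rightarrow> 'e"
  assumes y: "weakly_null y" "L_weakly_compact (range y)" and \<phi>: "positive_functional \<phi>"
  shows "(\<lambda>n. \<phi> \<bar>S (y n)\<bar>) \<longlonglongrightarrow> 0"
proof (rule LIMSEQ_I)
  have Tb: "bounded_linear T" using T_Lwcc by (simp add: Lwcc_def)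
  have SL: "linear S" and TL: "linear T" and \<phi>L: "linear \<phi>"
    using S Tb \<phi> by (auto simp: bounded_linear.linear positive_functional_def)
  note mono = positive_functional_mono[OF \<phi>]
  obtain K where K: "K > 0" "\<And>v. norm (\<phi> v) \<le> norm v * K"
    using \<phi> bounded_linear.pos_bounded[of \<phi>] unfolding positive_functional_def by blast
  obtain K' where K': "K' > 0" "\<And>v. norm (T v) \<le> norm v * K'" using bounded_linear.pos_bounded[OF Tb] by blast
  fix e :: real assume e: "e > 0"
  \<comment> \<open>The two truncations cost \<open>2 \<delta>\<close> and the two tails \<open>4 \<delta> K K'\<close>; both shall be at most \<open>e / 4\<close>.\<close>
  define \<delta> where "\<delta> = min (e / 8) (e / (16 * (K * K')))"
  have \<delta>: "\<delta> > 0" "2 * \<delta> \<le> e / 4" "4 * (\<delta> * (K * K')) \<le> e / 4"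
    using e K K' by (auto simp: \<delta>_def min_def field_simps)
  obtain u where u: "u \<in> oc_elements" "0 \<le> u" "\<And>n. norm (pprt (\<bar>y n\<bar> - u)) \<le> \<delta>"
    using L_weakly_compact_almost_order_bounded[OF y(2) \<delta>(1)] by auto
  note u_tail = u(3)
  interpret dominated_operator S T \<phi> u
    by (rule dominated_operator.intro[OF S Tb S_pos S_le_T \<phi> F u(1,2)])
  obtain m P n B where P: "order_partition m P" and B: "order_partition n B" and
    small: "\<And>y. 0 \<le> y \<Longrightarrow> y \<le> u \<Longrightarrow> \<phi> \<bar>S y - step m P n B y\<bar> \<le> \<delta>"
    by (rule approximation[OF \<delta>(1)]) (rule that)
  define D where "D x = S x - step m P n B x" for x
  have D_linear: "linear_map_on oc_elements D"
    using step_linear[OF P B] by (simp add: linear_map_on_def D_def linear_add[OF S_linear] linear_scale[OF S_linear] scaleR_diff_right)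
  have yM: "y k \<in> oc_elements" for k using L_weakly_compact_imp_oc[OF y(2)] by blast
  have step_null: "(\<lambda>k. norm (step m P n B (y k))) \<longlonglongrightarrow> 0"
  proof (rule Lim_null_comparison)
    have "(\<lambda>k. norm (T (P i (y k)))) \<longlonglongrightarrow> 0" if i: "i < m" for i
    proof -
      note Pi = order_partitionD(1)[OF P i]
      have "weakly_null (\<lambda>k. P i (y k))" using weakly_null_order_projection[OF y(1) yM Pi] .
      moreover have "L_weakly_compact (range (\<lambda>k. P i (y k)))"
        using order_projection_abs(1)[OF Pi yM] by (intro L_weakly_compact_mono_solid[OF y(2)]) auto
      ultimately show ?thesis
        using T_Lwcc[unfolded Lwcc_def, THEN conjunct2, rule_format, of "\<lambda>k. P i (y k)"] by blast
    qed
    then have "(\<lambda>k. \<Sum>i<m. \<Sum>j<n. norm (T (P i (y k)))) \<longlonglongrightarrow> (\<Sum>i<m. \<Sum>j<n. 0)" by (intro tendsto_sum) auto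
    then show "(\<lambda>k. \<Sum>i<m. \<Sum>j<n. norm (T (P i (y k)))) \<longlonglongrightarrow> 0" by simp
    show "\<forall>\<^sub>F k in sequentially. norm (norm (step m P n B (y k))) \<le> (\<Sum>i<m. \<Sum>j<n. norm (T (P i (y k))))"
    proof (intro always_eventually allI)
      fix k
      have "norm (step m P n B (y k)) \<le> (\<Sum>i<m. \<Sum>j<n. norm (T (P i (y k))))"
        unfolding step_def
      proof (intro sum_norm_le)
        fix i j assume ij: "i \<in> {..<m}" "j \<in> {..<n}"
        let ?c = "\<sigma> (P i) (B j) / \<tau> (P i) (B j)"
        have c: "0 \<le> ?c" "?c \<le> 1" using coefficient_bounds[OF P B] ij by auto
        have "norm (?c *\<^sub>R B j (T (P i (y k)))) = ?c * norm (B j (T (P i (y k))))"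
          unfolding norm_scaleR using c(1) by (simp only: abs_of_nonneg)
        also have "\<dots> \<le> 1 * norm (T (P i (y k)))"
          using c ij F order_projection_abs(3)[OF order_partitionD(1)[OF B]] by (intro mult_mono) auto
        finally show "norm (?c *\<^sub>R B j (T (P i (y k)))) \<le> norm (T (P i (y k)))" by simp
      qed
      then show "norm (norm (step m P n B (y k))) \<le> (\<Sum>i<m. \<Sum>j<n. norm (T (P i (y k))))" by simp
    qed
  qed
  from LIMSEQ_D[OF this, of "e / (4 * K)"] e K obtain N where
    N: "\<And>k. k \<ge> N \<Longrightarrow> norm (step m P n B (y k)) < e / (4 * K)" by auto
  have tail: "\<phi> \<bar>D z\<bar> \<le> 2 * (\<delta> * (K * K'))" if z: "z \<in> oc_elements" "0 \<le> z" "norm z \<le> \<delta>" for z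
  proof -
    have "\<bar>D z\<bar> \<le> \<bar>S z\<bar> + \<bar>step m P n B z\<bar>" unfolding D_def by (rule abs_triangle_ineq4)
    also have "\<dots> \<le> T z + T z" using S_pos[OF z(2)] S_le_T[OF z(2)] step_bounds[OF P B z(1,2)] by (intro add_mono) auto
    finally have "\<phi> \<bar>D z\<bar> \<le> 2 * \<phi> (T z)" using mono[of "\<bar>D z\<bar>" "T z + T z"] by (simp add: linear_add[OF \<phi>_linear])
    also have "\<phi> (T z) \<le> norm (T z) * K" using K(2)[of "T z"] by simp
    also have "norm (T z) * K \<le> (\<delta> * K') * K"
      using K'(2)[of z] z(3) K K' by (intro mult_right_mono order_trans[OF K'(2)]) auto
    finally show ?thesis by (simp add: mult_ac)
  qed
  have "norm (\<phi> \<bar>S (y k)\<bar> - 0) < e" if k: "k \<ge> N" for k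
  proof -
    let ?a = "inf (pprt (y k)) u" and ?b = "inf (pprt (- y k)) u"
    let ?p = "pprt (pprt (y k) - u)" and ?q = "pprt (pprt (- y k) - u)"
    have p: "pprt (y k) \<in> oc_elements" "pprt (- y k) \<in> oc_elements"
      using yM oc_elements_pprt subspace_neg[OF subspace_oc_elements] by blast+
    have ab: "0 \<le> ?a" "?a \<le> u" "0 \<le> ?b" "?b \<le> u" using u by auto
    then have abM: "?a \<in> oc_elements" "?b \<in> oc_elements" using oc_elements_below[OF u(1)] by blast+
    have pqM: "?p \<in> oc_elements" "?q \<in> oc_elements" using p u by (auto intro: oc_elements_pprt oc_elements_diff)
    have "?p \<le> pprt (\<bar>y k\<bar> - u)" "?q \<le> pprt (\<bar>y k\<bar> - u)" by (intro pprt_mono diff_right_mono pprt_le_abs)+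
    then have pq: "norm ?p \<le> \<delta>" "norm ?q \<le> \<delta>" using u_tail[of k] norm_mono_nonneg[OF zero_le_pprt] order_trans by blast+
    have "D (y k) = D (?a - ?b + (?p - ?q))" using split_at[of "y k" u] by simp
    also have "\<dots> = D ?a - D ?b + (D ?p - D ?q)"
      using abM pqM linear_map_onD(1,5)[OF subspace_oc_elements D_linear] by (simp add: oc_elements_diff)
    finally have "\<bar>D (y k)\<bar> \<le> (\<bar>D ?a\<bar> + \<bar>D ?b\<bar>) + (\<bar>D ?p\<bar> + \<bar>D ?q\<bar>)"
      by (simp only:) (intro order_trans[OF abs_triangle_ineq] add_mono abs_triangle_ineq4)
    then have "\<phi> \<bar>D (y k)\<bar> \<le> (\<phi> \<bar>D ?a\<bar> + \<phi> \<bar>D ?b\<bar>) + (\<phi> \<bar>D ?p\<bar> + \<phi> \<bar>D ?q\<bar>)"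
      using mono by (simp only: linear_add[OF \<phi>_linear, symmetric])
    also have "\<dots> \<le> (\<delta> + \<delta>) + (2 * (\<delta> * (K * K')) + 2 * (\<delta> * (K * K')))"
      using small[of ?a] small[of ?b] ab tail[OF pqM(1) _ pq(1)] tail[OF pqM(2) _ pq(2)] by (intro add_mono) (auto simp: D_def)
    finally have 1: "\<phi> \<bar>D (y k)\<bar> \<le> e / 2" using \<delta>(2,3) by linarith
    have "\<phi> \<bar>step m P n B (y k)\<bar> \<le> norm (step m P n B (y k)) * K" using K(2)[of "\<bar>step m P n B (y k)\<bar>"] by (simp add: norm_abs_eq)
    also have "\<dots> < e / (4 * K) * K" using N[OF k] K by (intro mult_strict_right_mono) auto
    finally have 2: "\<phi> \<bar>step m P n B (y k)\<bar> < e / 4" using K by simp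
    have "\<bar>S (y k)\<bar> \<le> \<bar>D (y k)\<bar> + \<bar>step m P n B (y k)\<bar>" using abs_triangle_ineq[of "D (y k)" "step m P n B (y k)"] by (simp add: D_def)
    then have "\<phi> \<bar>S (y k)\<bar> \<le> \<phi> \<bar>D (y k)\<bar> + \<phi> \<bar>step m P n B (y k)\<bar>" using mono by (simp only: linear_add[OF \<phi>_linear, symmetric])
    moreover have "0 \<le> \<phi> \<bar>S (y k)\<bar>" using \<phi> by (simp add: positive_functional_def)
    ultimately show ?thesis using 1 2 e by simp
  qed
  then show "\<exists>N. \<forall>k\<ge>N. norm (\<phi> \<bar>S (y k)\<bar> - 0) < e" by blast
qed

text \<open>
  If the norms of \<open>S (y n)\<close> stay above \<open>e\<close>, choose norming functionals \<open>\<psi> n\<close> for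
  \<open>\<bar>S (y n)\<bar>\<close> and let \<open>\<phi>\<close> be their weighted sum. By \<open>dominated_functional_null\<close> and
  \<open>small_functional_dominated\<close>, a subsequence of \<open>\<bar>S (y n)\<bar>\<close>, truncated at \<open>T u\<close>, is dominated by
  a sequence that converges to some \<open>v\<close> with \<open>\<phi> v = 0\<close>. Each \<open>\<psi> n\<close> vanishes at \<open>v\<close>, so
  the norming values tend to 0.
\<close>

theorem Lwcc_dominated_order_continuous_range: "Lwcc S"
  unfolding Lwcc_def
proof (intro conjI allI impI S, elim conjE)
  fix x :: "nat \<Rightarrow> 'e" assume x: "weakly_null x" "L_weakly_compact (range x)"
  have Tb: "bounded_linear T" using T_Lwcc by (simp add: Lwcc_def)
  have SL: "linear S" and TL: "linear T" using S Tb by (auto simp: bounded_linear.linear)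
  have T_pos: "0 \<le> T v" if "0 \<le> v" for v using S_pos[OF that] S_le_T[OF that] by (rule order_trans)
  show "(\<lambda>n. norm (S (x n))) \<longlonglongrightarrow> 0"
  proof (rule ccontr)
    assume "\<not> ?thesis"
    then have "\<not> (\<lambda>n. S (x n)) \<longlonglongrightarrow> 0" using tendsto_norm_zero by blast
    then obtain e and r :: "nat \<Rightarrow> nat" where e: "e > 0" and r: "strict_mono r" "\<And>n. e \<le> norm (S (x (r n)))"
      using not_tendsto_zero_subseq[of "\<lambda>n. S (x n)"] by blast
    define y where "y n = x (r n)" for n
    have y: "weakly_null y" "L_weakly_compact (range y)"
      unfolding y_def using x r by (auto intro!: weakly_null_subseq L_weakly_compact_mono_solid[OF x(2)])
    have "\<forall>n. \<exists>\<psi>. positive_functional \<psi> \<and> (\<forall>v. \<bar>\<psi> v\<bar> \<le> norm v) \<and> \<psi> \<bar>S (y n)\<bar> = norm (S (y n))"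
      using positive_functional_norming[OF abs_ge_zero] by (metis norm_abs_eq)
    then obtain \<psi> where \<psi>: "\<And>n. positive_functional (\<psi> n)" "\<And>n v. \<bar>\<psi> n v\<bar> \<le> norm v" "\<And>n. \<psi> n \<bar>S (y n)\<bar> = norm (S (y n))"
      by metis
    obtain \<phi> where \<phi>: "positive_functional \<phi>" "\<And>v n. 0 \<le> v \<Longrightarrow> \<phi> v = 0 \<Longrightarrow> \<psi> n v = 0"
      using positive_functional_series[of \<psi>] \<psi>(1,2) by blast
    have null: "(\<lambda>n. \<phi> \<bar>S (y n)\<bar>) \<longlonglongrightarrow> 0" by (rule dominated_functional_null[OF y \<phi>(1)])
    obtain K where K: "K > 0" "\<And>v. norm (T v) \<le> norm v * K" using bounded_linear.pos_bounded[OF Tb] by blast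
    obtain u where u: "u \<in> oc_elements" "0 \<le> u" "\<And>n. norm (pprt (\<bar>y n\<bar> - u)) \<le> e / (2 * K)"
      using L_weakly_compact_almost_order_bounded[OF y(2), of "e / (2 * K)"] e K by auto
    define t where "t n = inf \<bar>S (y n)\<bar> (T u)" for n
    have t: "0 \<le> t n" "t n \<le> T u" "t n \<le> \<bar>S (y n)\<bar>" for n using T_pos[OF u(2)] by (auto simp: t_def)
    have t_null: "(\<lambda>n. \<phi> (t n)) \<longlonglongrightarrow> 0"
    proof (rule Lim_null_comparison[OF _ null], intro always_eventually allI)
      show "norm (\<phi> (t n)) \<le> \<phi> \<bar>S (y n)\<bar>" for n
        using positive_functional_mono[OF \<phi>(1) t(3)[of n]] \<phi>(1) t(1)[of n] by (simp add: positive_functional_def)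
    qed
    have "T u \<in> oc_elements" by (simp add: F)
    then obtain q :: "nat \<Rightarrow> nat" and w v where
      q: "strict_mono q" "\<And>n. t (q n) \<le> w n" "w \<longlonglongrightarrow> v" "0 \<le> v" "v \<le> T u" "\<phi> v = 0"
      by (rule small_functional_dominated[OF _ t(1,2) \<phi>(1) t_null]) (rule that)
    have rest: "norm (pprt (\<bar>S (y n)\<bar> - T u)) \<le> e / 2" for n
    proof -
      let ?z = "pprt (\<bar>y n\<bar> - u)"
      have "\<bar>y n\<bar> \<le> u + ?z" using inf_add_pprt_diff[of "\<bar>y n\<bar>" u] by (metis add_right_mono inf_le2)
      have "0 \<le> S \<bar>y n\<bar> - S (y n)"
        using S_pos[of "\<bar>y n\<bar> - y n"] abs_ge_self[of "y n"] by (simp add: linear_diff[OF SL])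
      moreover have "0 \<le> S \<bar>y n\<bar> - (- S (y n))"
        using S_pos[OF abs_add_self_nonneg[of "y n"]] by (simp add: linear_add[OF SL])
      ultimately have "S (y n) \<le> S \<bar>y n\<bar>" "- S (y n) \<le> S \<bar>y n\<bar>" by (simp_all only: diff_ge_0_iff_ge)
      then have "\<bar>S (y n)\<bar> \<le> S \<bar>y n\<bar>" by (rule abs_leI)
      also have "\<dots> \<le> T \<bar>y n\<bar>" by (rule S_le_T) simp
      also have "\<dots> \<le> T (u + ?z)"
        using T_pos[of "u + ?z - \<bar>y n\<bar>"] \<open>\<bar>y n\<bar> \<le> u + ?z\<close> by (simp add: linear_diff[OF TL])
      finally have "\<bar>S (y n)\<bar> - T u \<le> T ?z" by (simp add: linear_add[OF TL] algebra_simps)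
      then have "pprt (\<bar>S (y n)\<bar> - T u) \<le> T ?z" using T_pos[of ?z] by (simp add: pprt_def[of "\<bar>S (y n)\<bar> - T u"])
      then have "norm (pprt (\<bar>S (y n)\<bar> - T u)) \<le> norm (T ?z)" by (intro norm_mono_nonneg) auto
      also have "\<dots> \<le> norm ?z * K" by (rule K(2))
      also have "\<dots> \<le> e / (2 * K) * K" using u(3)[of n] K by (intro mult_right_mono) auto
      finally show ?thesis using K by simp
    qed
    have "e / 2 \<le> norm (w n - v)" for n
    proof -
      let ?k = "q n"
      have lin: "linear (\<psi> ?k)" using \<psi>(1) by (simp add: positive_functional_def bounded_linear.linear)
      have "e \<le> \<psi> ?k \<bar>S (y ?k)\<bar>" using r(2)[of ?k] \<psi>(3) by (simp add: y_def)
      also have "\<bar>S (y ?k)\<bar> = t ?k + pprt (\<bar>S (y ?k)\<bar> - T u)" unfolding t_def by (simp add: inf_add_pprt_diff)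
      also have "\<psi> ?k \<dots> = \<psi> ?k (t ?k) + \<psi> ?k (pprt (\<bar>S (y ?k)\<bar> - T u))" by (rule linear_add[OF lin])
      also have "\<psi> ?k (t ?k) \<le> \<psi> ?k (w n)" by (rule positive_functional_mono[OF \<psi>(1) q(2)])
      also have "\<psi> ?k (w n) = \<psi> ?k (w n - v)" using \<phi>(2)[OF q(4,6)] by (simp add: linear_diff[OF lin])
      also have "\<psi> ?k (w n - v) \<le> norm (w n - v)" using \<psi>(2)[of ?k "w n - v"] by simp
      also have "\<psi> ?k (pprt (\<bar>S (y ?k)\<bar> - T u)) \<le> e / 2"
        using \<psi>(2)[of ?k "pprt (\<bar>S (y ?k)\<bar> - T u)"] rest[of ?k] by linarith
      finally show ?thesis by simp
    qed
    moreover have "(\<lambda>n. norm (w n - v)) \<longlonglongrightarrow> 0" using q(3) by (intro tendsto_norm_zero) (rule LIM_zero)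
    ultimately have "e / 2 \<le> 0" by (intro LIMSEQ_le_const) auto
    with e show False by simp
  qed
qed

end

section \<open>Non-discrete order continuous part\<close>

text \<open>
  By Zorn's lemma there is a maximal disjoint set of atoms. If it is not complete, some \<open>y \<noteq> 0\<close> is disjoint
  from it, and no atom lies below \<open>\<bar>y\<bar>\<close>.
\<close>

lemma nonatomic_element:
  assumes "\<not> discrete_vector_lattice (oc_elements :: 'a::banach_lattice set)"
  obtains u :: "'a::banach_lattice" where "u \<in> oc_elements" "0 \<le> u" "u \<noteq> 0"
    "\<And>a. 0 \<le> a \<Longrightarrow> a \<le> u \<Longrightarrow> a \<noteq> 0 \<Longrightarrow> \<exists>y. 0 \<le> y \<and> y \<le> a \<and> (\<forall>c. y \<noteq> c *\<^sub>R a)"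
proof -
  define \<D> where "\<D> = {D :: 'a set. (\<forall>d\<in>D. discrete_element oc_elements d) \<and> pairwise lattice_disjoint D}"
  have "\<exists>D\<in>\<D>. \<forall>X\<in>\<D>. D \<subseteq> X \<longrightarrow> X = D"
  proof (rule subset_Zorn')
    fix C assume C: "subset.chain \<D> C"
    have "pairwise lattice_disjoint (\<Union>C)"
      using C by (intro pairwise_chain_Union) (auto simp: \<D>_def subset_chain_def chain_subset_def)
    then show "\<Union>C \<in> \<D>" using C by (auto simp: \<D>_def subset_chain_def)
  qed
  then obtain D where D: "D \<in> \<D>" "\<And>X. X \<in> \<D> \<Longrightarrow> D \<subseteq> X \<Longrightarrow> X = D" by blast
  have "\<not> (\<forall>y\<in>oc_elements. (\<forall>d\<in>D. lattice_disjoint y d) \<longrightarrow> y = 0)"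
  proof
    assume "\<forall>y\<in>oc_elements. (\<forall>d\<in>D. lattice_disjoint y d) \<longrightarrow> y = 0"
    then have "discrete_vector_lattice (oc_elements :: 'a set)"
      unfolding discrete_vector_lattice_def using D(1) by (intro exI[of _ D]) (simp add: \<D>_def)
    with assms show False ..
  qed
  then obtain y where y1: "y \<in> oc_elements" and y2: "\<forall>d\<in>D. lattice_disjoint y d" and y3: "y \<noteq> 0"
    by blast
  have "\<exists>z. 0 \<le> z \<and> z \<le> a \<and> (\<forall>c. z \<noteq> c *\<^sub>R a)" if a: "0 \<le> a" "a \<le> \<bar>y\<bar>" "a \<noteq> 0" for a
  proof (rule ccontr)
    assume neg: "\<not> ?thesis"
    have aM: "a \<in> oc_elements" using a y1 by (rule_tac oc_elements_below[of "\<bar>y\<bar>"]) (simp_all add: oc_elements_abs_iff)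
    define I where "I = {z \<in> oc_elements. \<exists>c. \<bar>z\<bar> \<le> c *\<^sub>R a}"
    have "order_ideal_in oc_elements I"
      unfolding order_ideal_in_def
    proof (intro conjI)
      show "I \<subseteq> oc_elements" by (auto simp: I_def)
      show "\<forall>x\<in>I. \<forall>y\<in>oc_elements. \<bar>y\<bar> \<le> \<bar>x\<bar> \<longrightarrow> y \<in> I" by (auto simp: I_def intro: order_trans)
      show "subspace I"
      proof (rule subspaceI)
        show "0 \<in> I" using a by (auto simp: I_def oc_elements_0 intro!: exI[of _ 1])
        show "v + w \<in> I" if "v \<in> I" "w \<in> I" for v w
        proof -
          from that obtain c c' where "\<bar>v\<bar> \<le> c *\<^sub>R a" "\<bar>w\<bar> \<le> c' *\<^sub>R a" by (auto simp: I_def)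
          then have "\<bar>v + w\<bar> \<le> (c + c') *\<^sub>R a"
            unfolding scaleR_left_distrib by (intro order_trans[OF abs_triangle_ineq] add_mono)
          then show ?thesis using that by (auto simp: I_def intro: oc_elements_add)
        qed
        show "t *\<^sub>R v \<in> I" if "v \<in> I" for t v
        proof -
          from that obtain c where "\<bar>v\<bar> \<le> c *\<^sub>R a" by (auto simp: I_def)
          then have "\<bar>t *\<^sub>R v\<bar> \<le> (\<bar>t\<bar> * c) *\<^sub>R a"
            unfolding abs_scaleR scaleR_scaleR[symmetric] by (intro scaleR_left_mono) auto
          then show ?thesis using that by (auto simp: I_def intro: oc_elements_scale)
        qed
      qed
    qed
    moreover have "a \<in> I" using a aM by (auto simp: I_def intro!: exI[of _ 1])
    ultimately have hull_I: "order_ideal_in oc_elements hull {a} \<subseteq> I" by (intro hull_minimal) auto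
    have pos_span: "z \<in> span {a}" if z: "0 \<le> z" "z \<le> c *\<^sub>R a" for z c
    proof (cases "c \<le> 0")
      case True
      then have "c *\<^sub>R a \<le> 0" using a(1) by (simp add: scaleR_nonpos_nonneg)
      then have "z = 0" using z by order
      then show ?thesis by (simp add: span_zero)
    next
      case False
      then have "0 \<le> inverse c *\<^sub>R z" "inverse c *\<^sub>R z \<le> a"
        using z by (auto simp: pos_divideR_le_eq intro: scaleR_nonneg_nonneg)
      then obtain t where "inverse c *\<^sub>R z = t *\<^sub>R a" using neg by blast
      then have "z = (c * t) *\<^sub>R a" using False by (metis scaleR_scaleR scaleR_one right_inverse order_refl)
      then show ?thesis by (simp add: span_base span_scale)
    qed
    have "I \<subseteq> span {a}"
    proof
      fix z assume "z \<in> I"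
      then obtain c where "\<bar>z\<bar> \<le> c *\<^sub>R a" by (auto simp: I_def)
      then have "pprt z \<in> span {a}" "pprt (- z) \<in> span {a}"
        using pprt_le_abs[of z] by (auto intro!: pos_span[of _ c] intro: order_trans)
      then have "pprt z - pprt (- z) \<in> span {a}" by (rule span_diff)
      then show "z \<in> span {a}" by (simp only: pprt_diff)
    qed
    with hull_I have 1: "order_ideal_in oc_elements hull {a} \<subseteq> span {a}" by blast
    have "span {a} \<subseteq> order_ideal_in oc_elements hull {a}"
    proof (clarsimp simp: span_singleton hull_def)
      fix c I assume "order_ideal_in oc_elements I" "a \<in> I"
      then show "c *\<^sub>R a \<in> I" by (simp add: order_ideal_in_def subspace_scale)
    qed
    with 1 have "discrete_element oc_elements a" using a aM by (auto simp: discrete_element_def)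
    moreover have ad: "lattice_disjoint a d" if "d \<in> D" for d
    proof -
      have "inf \<bar>y\<bar> \<bar>d\<bar> = 0" using bspec[OF y2 that] by (simp add: lattice_disjoint_def)
      then have "inf a \<bar>d\<bar> = 0" by (rule inf_eq_0_mono[OF a(1,2) abs_ge_zero order_refl])
      then show ?thesis using a by (simp add: lattice_disjoint_def)
    qed
    ultimately have "insert a D \<in> \<D>"
      using D(1) by (auto simp: \<D>_def pairwise_insert lattice_disjoint_def inf_commute)
    then have "insert a D = D" by (rule D(2)) blast
    then have "a \<in> D" by blast
    from ad[OF this] a show False by (simp add: lattice_disjoint_def)
  qed
  then show thesis
    using that[of "\<bar>y\<bar>"] y1 y3 by (simp add: oc_elements_abs_iff)
qed

text \<open>
  Among the elements of \<open>[0, u]\<close> on which \<open>g\<close> vanishes there is a largest one, and it is removed from \<open>u\<close>.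
\<close>

lemma strictly_positive_functional_exists:
  fixes u :: "'a::banach_lattice"
  assumes u: "u \<in> oc_elements" "0 \<le> u" "u \<noteq> 0"
  obtains g u' where "positive_functional g" "0 \<le> u'" "u' \<le> u" "0 < g u'"
    "\<And>v. 0 \<le> v \<Longrightarrow> v \<le> u' \<Longrightarrow> g v = 0 \<Longrightarrow> v = 0"
proof -
  obtain g where g: "positive_functional g" "g u = norm u" using positive_functional_norming[OF u(2)] by blast
  have gl: "linear g" and gb: "bounded_linear g" and gpos: "\<And>x. 0 \<le> x \<Longrightarrow> 0 \<le> g x"
    using g by (auto simp: positive_functional_def bounded_linear.linear)
  define N where "N = {y. 0 \<le> y \<and> y \<le> u \<and> g y = 0}"
  obtain s f where s: "\<And>a. a \<in> N \<Longrightarrow> a \<le> s" "0 \<le> s" "s \<le> u" "f \<longlonglongrightarrow> s" "\<And>n::nat. f n \<in> N"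
  proof (rule oc_directed_sup[OF u(1), of N])
    show "N \<noteq> {}" using u linear_0[OF gl] by (auto simp: N_def)
    show "0 \<le> a \<and> a \<le> u" if "a \<in> N" for a using that by (simp add: N_def)
    show "\<exists>c\<in>N. a \<le> c \<and> b \<le> c" if ab: "a \<in> N" "b \<in> N" for a b
    proof -
      have "sup a b \<le> a + b" using ab by (auto simp: N_def intro: add_increasing add_increasing2)
      then have "g (sup a b) \<le> g (a + b)" by (rule positive_functional_mono[OF g(1)])
      also have "\<dots> = 0" using ab by (simp add: N_def linear_add[OF gl])
      finally have "g (sup a b) = 0" using gpos[of "sup a b"] ab by (auto simp: N_def le_supI1 intro: order.antisym)
      then show ?thesis using ab by (intro bexI[of _ "sup a b"]) (auto simp: N_def le_supI1)
    qed
  qed (rule that)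
  have "(\<lambda>n. g (f n)) \<longlonglongrightarrow> g s" by (rule bounded_linear.tendsto[OF gb s(4)])
  then have gs: "g s = 0" using s(5) by (simp add: N_def LIMSEQ_const_iff)
  show thesis
  proof (rule that[of g "u - s"])
    show "0 < g (u - s)" using gs g(2) u(3) by (simp add: linear_diff[OF gl])
    show "v = 0" if v: "0 \<le> v" "v \<le> u - s" "g v = 0" for v
    proof -
      have "s + v \<in> N" using v s(2) gs by (simp add: N_def linear_add[OF gl] algebra_simps)
      then have "s + v \<le> s" by (rule s(1))
      then show ?thesis using v(1) by (simp add: order.antisym)
    qed
  qed (use g s in auto)
qed


subsection \<open>Halving components\<close>

definition component :: "'a::banach_lattice \<Rightarrow> 'a \<Rightarrow> bool" where
  "component a b \<longleftrightarrow> 0 \<le> b \<and> b \<le> a \<and> inf b (a - b) = 0"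

lemma component_0: "0 \<le> a \<Longrightarrow> component a 0"
  by (simp add: component_def inf_absorb1)

lemma component_compl: "component a b \<Longrightarrow> component a (a - b)"
  by (simp add: component_def inf_commute)

lemma component_trans:
  assumes "component a b" "component b c" shows "component a c"
proof -
  have "inf c (a - b) = 0" using assms by (intro inf_eq_0_mono[of c b "a - b" "a - b"]) (auto simp: component_def)
  then have "inf c ((a - b) + (b - c)) = 0" using assms by (intro inf_sum2_eq_0) (auto simp: component_def)
  then show ?thesis using assms by (auto simp: component_def)
qed

lemma component_add:
  assumes "component a b" "component (a - b) c" shows "component a (b + c)"
proof -
  let ?d = "a - b - c"
  have d: "0 \<le> ?d" "0 \<le> c" "0 \<le> b" using assms by (auto simp: component_def)
  have "inf ?d b = 0"
    using assms d by (rule_tac inf_eq_0_mono[of ?d "a - b" b b]) (auto simp: component_def inf_commute)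
  moreover have "inf ?d c = 0" using assms by (simp add: component_def inf_commute)
  ultimately have "inf ?d (b + c) = 0" using d by (intro inf_sum2_eq_0)
  then show ?thesis using d by (simp add: component_def inf_commute diff_diff_eq le_diff_eq algebra_simps)
qed

lemma component_projection:
  assumes Q: "order_projection Q" and a: "a \<in> oc_elements" "0 \<le> a" shows "component a (Q a)"
proof -
  have b: "0 \<le> Q a" "Q a \<le> a" using order_projection_pos[OF Q a] by auto
  have Qa: "Q a \<in> oc_elements" using order_projection_abs(2)[OF Q a(1)] .
  define z where "z = inf (Q a) (a - Q a)"
  have z: "0 \<le> z" "z \<le> Q a" "z \<le> a - Q a" using b by (auto simp: z_def)
  have zM: "z \<in> oc_elements" using oc_elements_below[OF Qa] z by blast
  have "0 \<le> Q ((a - Q a) - z)" using z zM a Qa by (intro order_projection_pos(1)[OF Q] oc_elements_diff) auto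
  also have "\<dots> = Q a - Q (Q a) - Q z" using a Qa zM by (simp add: order_projection_linear(3)[OF Q] oc_elements_diff)
  finally have "Q z \<le> 0" using order_projection_idem[OF Q a(1)] by simp
  have "Q (Q a - z) \<le> Q a - z" using z zM Qa by (intro order_projection_pos(2)[OF Q] oc_elements_diff) auto
  then have "z \<le> Q z" using order_projection_linear(3)[OF Q Qa zM] order_projection_idem[OF Q a(1)] by simp
  then have "z = 0" using \<open>Q z \<le> 0\<close> z(1) by order
  then show ?thesis using b by (simp add: component_def z_def)
qed

text \<open>
  The multiples of \<open>a\<close> below and above \<open>y\<close> form a cut of the real line.
\<close>

lemma multiple_if_comparable:
  fixes a y :: "'a::banach_lattice"
  assumes a: "0 \<le> a" "a \<noteq> 0" and y: "0 \<le> y" "y \<le> a" and comp: "\<And>t. y \<le> t *\<^sub>R a \<or> t *\<^sub>R a \<le> y"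
  shows "\<exists>t. y = t *\<^sub>R a"
proof -
  define X where "X = {t. t *\<^sub>R a \<le> y}"
  have le1: "t \<le> 1" if "t \<in> X" for t
  proof (rule ccontr)
    assume "\<not> t \<le> 1"
    have "t *\<^sub>R a \<le> 1 *\<^sub>R a" using that y by (simp add: X_def)
    then have "(t - 1) *\<^sub>R a \<le> 0" by (simp add: scaleR_diff_left)
    moreover have "0 \<le> (t - 1) *\<^sub>R a" using \<open>\<not> t \<le> 1\<close> a by (intro scaleR_nonneg_nonneg) auto
    ultimately have "(t - 1) *\<^sub>R a = 0" by order
    with \<open>\<not> t \<le> 1\<close> a show False by simp
  qed
  have ne: "X \<noteq> {}" using y by (auto simp: X_def intro: exI[of _ 0])
  have bdd: "bdd_above X" using le1 by (intro bdd_aboveI)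
  let ?s = "Sup X"
  have inv: "(\<lambda>n. inverse (real (Suc n))) \<longlonglongrightarrow> 0" by (rule LIMSEQ_inverse_real_of_nat)
  have "?s *\<^sub>R a \<le> y"
  proof (rule LIMSEQ_le_lattice[OF _ tendsto_const])
    show "(\<lambda>n. (?s - inverse (real (Suc n))) *\<^sub>R a) \<longlonglongrightarrow> ?s *\<^sub>R a"
      using tendsto_scaleR[OF tendsto_diff[OF tendsto_const inv] tendsto_const, of ?s a] by simp
    fix n
    have "?s - inverse (real (Suc n)) < ?s" by simp
    then obtain t where t: "t \<in> X" "?s - inverse (real (Suc n)) < t" using less_cSup_iff[OF ne bdd] by blast
    then have "(?s - inverse (real (Suc n))) *\<^sub>R a \<le> t *\<^sub>R a" using a by (intro scaleR_right_mono) auto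
    also have "\<dots> \<le> y" using t by (simp add: X_def)
    finally show "(?s - inverse (real (Suc n))) *\<^sub>R a \<le> y" .
  qed
  moreover have "y \<le> ?s *\<^sub>R a"
  proof (rule LIMSEQ_le_lattice[OF tendsto_const])
    show "(\<lambda>n. (?s + inverse (real (Suc n))) *\<^sub>R a) \<longlonglongrightarrow> ?s *\<^sub>R a"
      using tendsto_scaleR[OF tendsto_add[OF tendsto_const inv] tendsto_const, of ?s a] by simp
    fix n
    have "?s + inverse (real (Suc n)) \<notin> X"
    proof
      assume "?s + inverse (real (Suc n)) \<in> X"
      then have "?s + inverse (real (Suc n)) \<le> ?s" by (rule cSup_upper[OF _ bdd])
      moreover have "inverse (real (Suc n)) > 0" by simp
      ultimately show False by linarith
    qed
    then show "y \<le> (?s + inverse (real (Suc n))) *\<^sub>R a" using comp by (auto simp: X_def)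
  qed
  ultimately show ?thesis by (intro exI[of _ ?s] order.antisym)
qed

text \<open>
  On the components of \<open>u\<close>, the functional \<open>g\<close> is then an atomless measure.
\<close>

locale nonatomic =
  fixes u :: "'a::banach_lattice" and g :: "'a \<Rightarrow> real"
  assumes u: "u \<in> oc_elements" "0 \<le> u" and g: "positive_functional g"
    and strict: "\<And>v. 0 \<le> v \<Longrightarrow> v \<le> u \<Longrightarrow> g v = 0 \<Longrightarrow> v = 0"
    and nonatomic: "\<And>a. 0 \<le> a \<Longrightarrow> a \<le> u \<Longrightarrow> a \<noteq> 0 \<Longrightarrow> \<exists>y. 0 \<le> y \<and> y \<le> a \<and> (\<forall>c. y \<noteq> c *\<^sub>R a)"
    and gu: "0 < g u"
begin

lemma g_linear: "linear g" and g_bounded_linear: "bounded_linear g"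
  using g by (auto simp: positive_functional_def bounded_linear.linear)

lemma g_pos: "0 \<le> x \<Longrightarrow> 0 \<le> g x"
  using g by (simp add: positive_functional_def)

text \<open>
  Some element \<open>y\<close> below \<open>a\<close> is not a multiple of \<open>a\<close>, and hence is incomparable with some multiple
  \<open>t a\<close>. The band where \<open>y\<close> exceeds \<open>t a\<close> splits \<open>a\<close>.
\<close>

lemma proper_component:
  assumes a: "0 \<le> a" "a \<le> u" "a \<noteq> 0"
  obtains b where "component a b" "b \<noteq> 0" "b \<noteq> a"
proof -
  have aM: "a \<in> oc_elements" using oc_elements_below[OF u(1)] a by blast
  obtain y where y: "0 \<le> y" "y \<le> a" "\<And>c. y \<noteq> c *\<^sub>R a" using nonatomic[OF a] by blast
  obtain t where t: "\<not> y \<le> t *\<^sub>R a" "\<not> t *\<^sub>R a \<le> y"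
    using multiple_if_comparable[OF a(1,3) y(1,2)] y(3) by blast
  define w where "w = y - t *\<^sub>R a"
  have yM: "y \<in> oc_elements" using oc_elements_below[OF aM y(1,2)] .
  have wM: "w \<in> oc_elements" unfolding w_def using yM aM by (intro oc_elements_diff oc_elements_scale)
  have wp: "pprt w \<noteq> 0" "pprt (- w) \<noteq> 0"
    using t by (auto simp: w_def le_zero_iff_zero_pprt[symmetric])
  define K where "K = 1 + \<bar>t\<bar>"
  have "\<bar>w\<bar> \<le> \<bar>y\<bar> + \<bar>t *\<^sub>R a\<bar>" unfolding w_def by (rule abs_triangle_ineq4)
  also have "\<dots> \<le> K *\<^sub>R a" unfolding K_def scaleR_left_distrib abs_scaleR using a y by (intro add_mono) auto
  finally have wK: "\<bar>w\<bar> \<le> K *\<^sub>R a" .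
  have pK: "pprt w \<le> K *\<^sub>R a" "pprt (- w) \<le> K *\<^sub>R a" using pprt_le_abs[of w] wK by (auto intro: order_trans)
  have pM: "pprt w \<in> oc_elements" "pprt (- w) \<in> oc_elements"
    using wM oc_elements_pprt subspace_neg[OF subspace_oc_elements] by blast+
  have KM: "K *\<^sub>R a \<in> oc_elements" using aM by (rule oc_elements_scale)
  \<comment> \<open>The projection onto the band where \<open>y\<close> exceeds \<open>t a\<close>; both \<open>a\<close> and \<open>a - Q a\<close> have a nonzero part.\<close>
  define Q where "Q = band_proj (pprt w)"
  have Q: "order_projection Q" unfolding Q_def by (intro order_projection_band_proj) simp
  note lin = order_projection_linear[OF Q]
  have Qp: "Q (pprt w) = pprt w" "Q (pprt (- w)) = 0"
    unfolding Q_def using pM inf_pprt_pprt_minus[of w] by (auto intro!: band_proj_self band_proj_disjoint simp: inf_commute)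
  have "Q a \<noteq> 0"
  proof
    assume "Q a = 0"
    have "0 \<le> Q (K *\<^sub>R a - pprt w)" using pK pM KM by (intro order_projection_pos[OF Q] oc_elements_diff) auto
    also have "\<dots> = - pprt w" using \<open>Q a = 0\<close> pM KM aM by (simp add: lin(3,5) Qp)
    finally show False using wp by (simp add: order.antisym)
  qed
  moreover have "Q a \<noteq> a"
  proof
    assume "Q a = a"
    have "Q (K *\<^sub>R a - pprt (- w)) \<le> K *\<^sub>R a - pprt (- w)" using pK pM KM by (intro order_projection_pos[OF Q] oc_elements_diff) auto
    then have "pprt (- w) \<le> 0" using \<open>Q a = a\<close> pM KM aM by (simp add: lin(3,5) Qp)
    then show False using wp by (simp add: order.antisym)
  qed
  ultimately show thesis using that component_projection[OF Q aM a(1)] by blast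
qed

text \<open>
  Of the two parts of a proper splitting, one has at most half the mass; iterate.
\<close>

lemma small_component:
  assumes a: "0 \<le> a" "a \<le> u" "a \<noteq> 0" and e: "e > 0"
  obtains b where "component a b" "b \<noteq> 0" "g b \<le> e"
proof -
  have "\<exists>b. component a b \<and> b \<noteq> 0 \<and> g b \<le> g a * (1/2) ^ n" for n
  proof (induction n)
    case 0 show ?case using a by (intro exI[of _ a]) (auto simp: component_def inf_absorb2)
  next
    case (Suc n)
    then obtain b where b: "component a b" "b \<noteq> 0" "g b \<le> g a * (1/2) ^ n" by blast
    have "0 \<le> b" "b \<le> u" using b a by (auto simp: component_def)
    then obtain c where c: "component b c" "c \<noteq> 0" "c \<noteq> b" using proper_component[OF _ _ b(2)] by blast
    have "g c + g (b - c) = g b" by (simp add: linear_diff[OF g_linear])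
    then have "g c \<le> g b / 2 \<or> g (b - c) \<le> g b / 2" by linarith
    then obtain d where "component b d" "d \<noteq> 0" "g d \<le> g b / 2" using c component_compl[OF c(1)] by force
    then show ?case using component_trans[OF b(1)] b(3) by (intro exI[of _ d]) auto
  qed
  note ex = this
  have "(\<lambda>n. g a * (1/2) ^ n) \<longlonglongrightarrow> g a * 0" by (intro tendsto_intros LIMSEQ_realpow_zero) auto
  from LIMSEQ_D[OF this e] obtain n where "\<bar>g a * (1/2) ^ n\<bar> < e" by auto
  with ex[of n] show thesis using that by force
qed

text \<open>
  Sierpinski's theorem for this measure, by exhaustion: add at every step a component that is, up to a
  factor 2, the largest one allowed. If the limit \<open>b\<close> misses half of the mass, a small component of \<open>a - b\<close>
  was allowed at every step, so infinitely many steps had at least half its mass.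
\<close>

lemma halving_component:
  assumes a: "0 \<le> a" "a \<le> u"
  obtains b where "component a b" "g b = g a / 2"
proof -
  have aM: "a \<in> oc_elements" using oc_elements_below[OF u(1) a] .
  \<comment> \<open>The components that can be added to \<open>b\<close> without exceeding half of the mass.\<close>
  define X where "X b = {c. component (a - b) c \<and> g b + g c \<le> g a / 2}" for b
  define ok where "ok b \<longleftrightarrow> component a b \<and> g b \<le> g a / 2" for b
  have bdd: "bdd_above (g ` X b)" for b by (intro bdd_aboveI2[of _ _ "g a / 2 - g b"]) (auto simp: X_def)
  have "\<exists>c\<in>X b. \<forall>c'\<in>X b. g c' \<le> 2 * g c" if b: "ok b" for b
  proof (cases "\<exists>c\<in>X b. 0 < g c")
    case True
    then obtain c0 where c0: "c0 \<in> X b" "0 < g c0" by blast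
    then have pos: "0 < Sup (g ` X b)" using cSup_upper[OF _ bdd, of "g c0" b] by fastforce
    then have "Sup (g ` X b) / 2 < Sup (g ` X b)" by simp
    then obtain c where c: "c \<in> X b" "Sup (g ` X b) / 2 < g c"
      using c0 less_cSup_iff[OF _ bdd, of b "Sup (g ` X b) / 2"] by fastforce
    have "g c' \<le> 2 * g c" if "c' \<in> X b" for c' using cSup_upper[OF imageI[OF that] bdd] c(2) by linarith
    with c show ?thesis by blast
  next
    case False
    have "0 \<in> X b" using b by (auto simp: X_def ok_def component_def inf_absorb1 linear_0[OF g_linear])
    moreover have "g c \<le> 0" if "c \<in> X b" for c using False that by (meson not_le)
    ultimately show ?thesis by (intro bexI[of _ 0]) (auto simp: linear_0[OF g_linear])
  qed
  then obtain h where h: "\<And>b. ok b \<Longrightarrow> h b \<in> X b" "\<And>b c'. ok b \<Longrightarrow> c' \<in> X b \<Longrightarrow> g c' \<le> 2 * g (h b)" by metis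
  have ok_step: "ok (b + h b)" if "ok b" for b
    using that h(1)[OF that] component_add[of a b "h b"] by (auto simp: ok_def X_def linear_add[OF g_linear])
  define B where "B n = ((\<lambda>b. b + h b) ^^ n) 0" for n
  have BS: "B (Suc n) = B n + h (B n)" for n by (simp add: B_def)
  have ok0: "ok 0" using component_0[OF a(1)] g_pos[OF a(1)] by (simp add: ok_def linear_0[OF g_linear])
  have okB: "ok (B n)" for n by (induction n) (simp_all add: BS ok_step, simp add: B_def ok0)
  have h0: "0 \<le> h (B n)" for n using h(1)[OF okB] by (simp add: X_def component_def)
  have Bb: "0 \<le> B n" "B n \<le> a" for n using okB[of n] by (auto simp: ok_def component_def)
  have inc: "incseq B" using h0 by (simp add: incseq_Suc_iff BS)
  then have "convergent B" using Bb by (intro oc_elements_convergent[OF aM])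
  then obtain b where lim: "B \<longlonglongrightarrow> b" by (auto simp: convergent_def)
  have b: "0 \<le> b" by (rule LIMSEQ_nonneg_lattice[OF lim]) (rule Bb(1))
  have ba: "b \<le> a" by (rule LIMSEQ_le_lattice[OF lim tendsto_const]) (rule Bb(2))
  note b = b ba
  have "(\<lambda>n. inf (B n) (a - B n)) \<longlonglongrightarrow> inf b (a - b)" by (intro tendsto_inf_both tendsto_intros lim)
  moreover have "inf (B n) (a - B n) = 0" for n using okB by (simp add: ok_def component_def)
  ultimately have "inf b (a - b) = 0" by (simp add: LIMSEQ_const_iff)
  then have comp: "component a b" using b by (simp add: component_def)
  have glim: "(\<lambda>n. g (B n)) \<longlonglongrightarrow> g b" by (rule bounded_linear.tendsto[OF g_bounded_linear lim])
  have gb: "g b \<le> g a / 2" by (rule LIMSEQ_le_const2[OF glim]) (use okB in \<open>auto simp: ok_def\<close>)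
  have "g b = g a / 2"
  proof (rule ccontr)
    assume "g b \<noteq> g a / 2"
    with gb have gap: "0 < g a / 2 - g b" by simp
    have "a - b \<noteq> 0"
    proof
      assume "a - b = 0" then have "g b = g a" by simp
      with gap g_pos[OF a(1)] show False by simp
    qed
    moreover have "0 \<le> a - b" "a - b \<le> u" using a b by (auto intro: order_trans[of _ a])
    ultimately obtain c where c: "component (a - b) c" "c \<noteq> 0" "g c \<le> g a / 2 - g b"
      using small_component[OF _ _ _ gap, of "a - b"] by blast
    have c0: "0 \<le> c" "c \<le> a - b" using c by (auto simp: component_def)
    then have "c \<le> u" using \<open>a - b \<le> u\<close> by order
    then have "0 < g c" using strict[OF c0(1)] c(2) g_pos[OF c0(1)] by fastforce
    have Bn: "B n \<le> b" for n
      by (rule LIMSEQ_le_lattice[OF tendsto_const lim]) (use inc in \<open>auto simp: incseq_def\<close>)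
    have cX: "c \<in> X (B n)" for n
    proof -
      have "inf c (b - B n) = 0"
        using c0 Bn Bb comp by (rule_tac inf_eq_0_mono[of c "a - b" "b - B n" b]) (auto simp: component_def inf_commute)
      then have "inf c ((a - b - c) + (b - B n)) = 0"
        using c c0 Bn by (intro inf_sum2_eq_0) (auto simp: component_def)
      then have "inf c (a - B n - c) = 0" by (simp add: algebra_simps)
      moreover have "c \<le> a - B n" using c0(2) Bn[of n] by (meson diff_left_mono order_trans)
      moreover have "g (B n) \<le> g b" by (rule positive_functional_mono[OF g Bn])
      ultimately show ?thesis using c0 c(3) by (simp add: X_def component_def)
    qed
    have "g c / 2 \<le> g (B (Suc n)) - g (B n)" for n
      using h(2)[OF okB cX, of n] by (simp add: BS linear_add[OF g_linear])
    moreover have "(\<lambda>n. g (B (Suc n)) - g (B n)) \<longlonglongrightarrow> g b - g b"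
      by (intro tendsto_diff LIMSEQ_Suc glim)
    ultimately have "g c / 2 \<le> g b - g b" by (intro LIMSEQ_le_const) auto
    with \<open>0 < g c\<close> show False by simp
  qed
  with comp show thesis by (rule that)
qed

end

subsection \<open>Rademacher sequences\<close>

text \<open>
  Average \<open>K\<close> terms of modulus at least \<open>e\<close>, with signs.
\<close>

lemma not_tendsto_zero_averages:
  fixes z :: "nat \<Rightarrow> real"
  assumes "\<not> z \<longlonglongrightarrow> 0"
  obtains e where "e > 0"
    "\<And>K. 0 < K \<Longrightarrow> \<exists>c N. (\<Sum>m<N. \<bar>c m\<bar>) \<le> 1 \<and> (\<Sum>m<N. (c m)\<^sup>2) \<le> 1 / real K \<and> e \<le> (\<Sum>m<N. c m * z m)"
proof -
  obtain e and q :: "nat \<Rightarrow> nat" where e: "e > 0" and q: "strict_mono q" "\<And>n. e \<le> norm (z (q n))"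
    using not_tendsto_zero_subseq[OF assms] by blast
  have "\<exists>c N. (\<Sum>m<N. \<bar>c m\<bar>) \<le> 1 \<and> (\<Sum>m<N. (c m)\<^sup>2) \<le> 1 / real K \<and> e \<le> (\<Sum>m<N. c m * z m)" if K: "0 < K" for K
  proof (intro exI conjI)
    define c where "c m = (if m \<in> q ` {..<K} then sgn (z m) / real K else 0)" for m
    have sub: "q ` {..<K} \<subseteq> {..<q K}" using q(1) by (auto simp: strict_mono_less)
    have restr: "(\<Sum>m<q K. f m) = (\<Sum>i<K. f (q i))" if "\<And>m. m \<notin> q ` {..<K} \<Longrightarrow> f m = 0" for f :: "nat \<Rightarrow> real"
    proof -
      have "(\<Sum>m<q K. f m) = sum f (q ` {..<K})" using sub that by (intro sum.mono_neutral_right) auto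
      also have "\<dots> = (\<Sum>i<K. f (q i))"
        using strict_mono_imp_inj_on[OF q(1)] by (subst sum.reindex) (auto intro: inj_on_subset)
      finally show ?thesis .
    qed
    have cq: "c (q i) = sgn (z (q i)) / real K" if "i < K" for i using that by (simp add: c_def)
    have nz: "z (q i) \<noteq> 0" for i using q(2)[of i] e by auto
    have "(\<Sum>m<q K. \<bar>c m\<bar>) = (\<Sum>i<K. \<bar>c (q i)\<bar>)" by (rule restr) (simp add: c_def)
    also have "\<dots> = (\<Sum>i<K. 1 / real K)" by (intro sum.cong refl) (simp add: cq nz)
    finally have "(\<Sum>m<q K. \<bar>c m\<bar>) = (\<Sum>i<K. 1 / real K)" .
    then show "(\<Sum>m<q K. \<bar>c m\<bar>) \<le> 1" using K by simp
    have "(\<Sum>m<q K. (c m)\<^sup>2) = (\<Sum>i<K. (c (q i))\<^sup>2)" by (rule restr) (simp add: c_def)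
    also have "\<dots> = (\<Sum>i<K. (1 / real K)\<^sup>2)" by (intro sum.cong refl) (simp add: cq nz power_divide sgn_if)
    finally have "(\<Sum>m<q K. (c m)\<^sup>2) = (\<Sum>i<K. (1 / real K)\<^sup>2)" .
    then show "(\<Sum>m<q K. (c m)\<^sup>2) \<le> 1 / real K" using K by (simp add: power2_eq_square)
    have "(\<Sum>i<K. e / real K) \<le> (\<Sum>i<K. c (q i) * z (q i))"
    proof (intro sum_mono)
      fix i assume "i \<in> {..<K}"
      then have "c (q i) * z (q i) = \<bar>z (q i)\<bar> / real K" by (simp add: cq sgn_mult_self_eq abs_sgn mult.commute)
      then show "e / real K \<le> c (q i) * z (q i)" using q(2)[of i] by (simp add: divide_right_mono)
    qed
    also have "\<dots> = (\<Sum>m<q K. c m * z m)" by (subst restr) (auto simp: c_def)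
    finally show "e \<le> (\<Sum>m<q K. c m * z m)" using K by simp
  qed
  with e show thesis using that by blast
qed

text \<open>
  The indices of the cells at level \<open>n\<close> of the dyadic tree; the last choice is the head of the list.
\<close>

definition cubes :: "nat \<Rightarrow> bool list set" where "cubes n = {l. length l = n}"

lemma cubes_0: "cubes 0 = {[]}"
  by (auto simp: cubes_def)

lemma finite_cubes: "finite (cubes n)" and card_cubes: "card (cubes n) = 2 ^ n"
  using finite_lists_length_eq[of "UNIV :: bool set" n] card_lists_length_eq[of "UNIV :: bool set" n] by (auto simp: cubes_def)

lemma sum_cubes_Suc: "(\<Sum>l\<in>cubes (Suc n). f l) = (\<Sum>l\<in>cubes n. f (True # l) + f (False # l) :: 'b::comm_monoid_add)"
proof -
  have "cubes (Suc n) = (#) True ` cubes n \<union> (#) False ` cubes n"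
    by (auto simp: cubes_def length_Suc_conv)
  moreover have "(#) True ` cubes n \<inter> (#) False ` cubes n = {}" by auto
  ultimately have "(\<Sum>l\<in>cubes (Suc n). f l) = sum f ((#) True ` cubes n) + sum f ((#) False ` cubes n)"
    by (simp add: sum.union_disjoint finite_cubes)
  also have "\<dots> = (\<Sum>l\<in>cubes n. f (True # l)) + (\<Sum>l\<in>cubes n. f (False # l))"
    by (simp add: sum.reindex)
  finally show ?thesis by (simp add: sum.distrib)
qed

text \<open>
  The value of \<open>\<Sum> c m * r m\<close> on the cell \<open>l\<close>, where \<open>r m\<close> is the \<open>m\<close>-th Rademacher function.
\<close>

primrec walk :: "(nat \<Rightarrow> real) \<Rightarrow> bool list \<Rightarrow> real" where
  "walk c [] = 0"
| "walk c (x # l) = walk c l + (if x then c (length l) else - c (length l))"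

text \<open>
  Stated for every additive function on the cells, as it is needed for the Rademacher elements and
  for the functionals.
\<close>

lemma sum_walk:
  fixes \<beta> :: "bool list \<Rightarrow> 'b::real_vector"
  assumes \<beta>: "\<And>l. \<beta> (True # l) + \<beta> (False # l) = \<beta> l"
  shows "(\<Sum>m<N. c m *\<^sub>R (\<Sum>l\<in>cubes m. \<beta> (True # l) - \<beta> (False # l))) = (\<Sum>l\<in>cubes N. walk c l *\<^sub>R \<beta> l)"
proof (induction N)
  case (Suc N)
  have "(\<Sum>l\<in>cubes (Suc N). walk c l *\<^sub>R \<beta> l) =
    (\<Sum>l\<in>cubes N. walk c l *\<^sub>R \<beta> l + c N *\<^sub>R (\<beta> (True # l) - \<beta> (False # l)))"
    unfolding sum_cubes_Suc
  proof (intro sum.cong refl)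
    fix l assume "l \<in> cubes N"
    then have l: "length l = N" by (simp add: cubes_def)
    have "walk c l *\<^sub>R \<beta> l = walk c l *\<^sub>R \<beta> (True # l) + walk c l *\<^sub>R \<beta> (False # l)"
      by (subst \<beta>[symmetric]) (rule scaleR_right_distrib)
    then show "walk c (True # l) *\<^sub>R \<beta> (True # l) + walk c (False # l) *\<^sub>R \<beta> (False # l) =
      walk c l *\<^sub>R \<beta> l + c N *\<^sub>R (\<beta> (True # l) - \<beta> (False # l))"
      by (simp add: l algebra_simps)
  qed
  then show ?case using Suc by (simp add: sum.distrib scaleR_sum_right)
qed (simp add: cubes_0)

text \<open>
  Orthonormality of the Rademacher functions: the increments at the two children of a cell cancel in the mixed terms.
\<close>

lemma sum_walk_squares: "(\<Sum>l\<in>cubes N. (walk c l)\<^sup>2) = 2 ^ N * (\<Sum>m<N. (c m)\<^sup>2)"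
proof (induction N)
  case (Suc N)
  have "(\<Sum>l\<in>cubes (Suc N). (walk c l)\<^sup>2) = (\<Sum>l\<in>cubes N. 2 * (walk c l)\<^sup>2 + 2 * (c N)\<^sup>2)"
    unfolding sum_cubes_Suc by (intro sum.cong refl) (auto simp: cubes_def power2_eq_square algebra_simps)
  also have "\<dots> = 2 * (\<Sum>l\<in>cubes N. (walk c l)\<^sup>2) + 2 ^ N * (2 * (c N)\<^sup>2)"
    by (simp add: sum.distrib sum_distrib_left card_cubes)
  finally show ?case using Suc by (simp add: algebra_simps)
qed (simp add: cubes_0)

lemma sum_abs_walk: "(\<Sum>l\<in>cubes N. \<bar>walk c l\<bar>) / 2 ^ N \<le> sqrt (\<Sum>m<N. (c m)\<^sup>2)"
proof (rule real_le_rsqrt)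
  have "(\<Sum>l\<in>cubes N. \<bar>walk c l\<bar> * 1)\<^sup>2 \<le> (\<Sum>l\<in>cubes N. \<bar>walk c l\<bar>\<^sup>2) * (\<Sum>l\<in>cubes N. 1\<^sup>2)"
    by (rule Cauchy_Schwarz_ineq_sum)
  also have "\<dots> = (2 ^ N * (\<Sum>m<N. (c m)\<^sup>2)) * 2 ^ N"
    by (simp only: power2_abs sum_walk_squares) (simp add: card_cubes)
  also have "\<dots> = (\<Sum>m<N. (c m)\<^sup>2) * (2 ^ N)\<^sup>2" by (simp add: power2_eq_square)
  finally show "((\<Sum>l\<in>cubes N. \<bar>walk c l\<bar>) / 2 ^ N)\<^sup>2 \<le> (\<Sum>m<N. (c m)\<^sup>2)"
    by (simp add: power_divide divide_le_eq)
qed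

context nonatomic
begin

definition half :: "'a \<Rightarrow> 'a" where
  "half a = (SOME b. component a b \<and> g b = g a / 2)"

primrec dyadic :: "bool list \<Rightarrow> 'a" where
  "dyadic [] = u"
| "dyadic (x # l) = (if x then half (dyadic l) else dyadic l - half (dyadic l))"

lemma half:
  assumes "0 \<le> a" "a \<le> u" shows "component a (half a)" "g (half a) = g a / 2"
proof -
  have "\<exists>b. component a b \<and> g b = g a / 2" using halving_component[OF assms] by metis
  from someI_ex[OF this] show "component a (half a)" "g (half a) = g a / 2" by (auto simp: half_def)
qed

lemma dyadic_bounds: "0 \<le> dyadic l \<and> dyadic l \<le> u"
proof (induction l)
  case (Cons x l)
  have "component (dyadic l) (half (dyadic l))" using Cons half by blast
  then have "0 \<le> half (dyadic l)" "half (dyadic l) \<le> dyadic l" by (auto simp: component_def)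
  then have "0 \<le> dyadic (x # l) \<and> dyadic (x # l) \<le> dyadic l" by (simp add: le_diff_eq)
  then show ?case using Cons by (meson order_trans)
qed (use u in simp)

lemma dyadic_half: "component (dyadic l) (half (dyadic l))" "g (half (dyadic l)) = g (dyadic l) / 2"
  using half dyadic_bounds by blast+

lemma dyadic_Cons_le: "dyadic (x # l) \<le> dyadic l"
  using dyadic_half(1)[of l] by (auto simp: component_def)

lemma dyadic_split: "dyadic (True # l) + dyadic (False # l) = dyadic l" "inf (dyadic (True # l)) (dyadic (False # l)) = 0"
  using dyadic_half(1)[of l] by (auto simp: component_def)

lemma g_dyadic: "g (dyadic l) = g u / 2 ^ length l"
  by (induction l) (simp_all add: dyadic_half(2) linear_diff[OF g_linear] diff_divide_distrib[symmetric])

lemma dyadic_disjoint: "length k = length l \<Longrightarrow> k \<noteq> l \<Longrightarrow> inf (dyadic k) (dyadic l) = 0"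
proof (induction k arbitrary: l)
  case (Cons x k)
  then obtain y m where l: "l = y # m" "length k = length m" by (cases l) auto
  show ?case
  proof (cases "k = m")
    case True
    then have "x \<noteq> y" using Cons l by auto
    then show ?thesis using True l dyadic_split(2)[of m] by (cases x; cases y) (auto simp: inf_commute simp del: dyadic.simps(2))
  next
    case False
    have "inf (dyadic k) (dyadic m) = 0" using Cons.IH l(2) False by blast
    then show ?thesis unfolding l(1)
      by (rule inf_eq_0_mono[rotated 4]) (use dyadic_bounds dyadic_Cons_le in blast)+
  qed
qed simp

definition rademacher :: "nat \<Rightarrow> 'a" where
  "rademacher n = (\<Sum>l\<in>cubes n. dyadic (True # l) - dyadic (False # l))"

abbreviation part :: "bool list \<Rightarrow> 'a \<Rightarrow> real" where
  "part l \<equiv> band_part g (dyadic l)"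

text \<open>
  The functional \<open>x \<mapsto> g (r\<^sub>n x)\<close>, where \<open>r\<^sub>n\<close> acts as multiplication by a sign on each cell.
\<close>

definition rademacher_functional :: "nat \<Rightarrow> 'a \<Rightarrow> real" where
  "rademacher_functional n x = (\<Sum>l\<in>cubes n. part (True # l) x - part (False # l) x)"

lemma sum_dyadic: "(\<Sum>l\<in>cubes n. dyadic l) = u"
  by (induction n) (simp_all add: cubes_0 sum_cubes_Suc dyadic_split del: dyadic.simps(2))

lemma part_functional: "positive_functional (part l)"
  using g dyadic_bounds by (intro positive_functional_band_part) blast+

lemma part_linear: "linear (part l)"
  using part_functional by (simp add: positive_functional_def bounded_linear.linear)

lemma part_split: "part (True # l) x + part (False # l) x = part l x"
  using band_part_add[OF g, of "dyadic (True # l)" "dyadic (False # l)" x] dyadic_bounds dyadic_split by metis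

lemma sum_part: "(\<Sum>l\<in>cubes n. part l x) = band_part g u x"
  by (induction n) (simp_all add: cubes_0 sum_cubes_Suc part_split del: dyadic.simps(2))

lemma part_dyadic: "length k = length l \<Longrightarrow> part k (dyadic l) = (if k = l then g (dyadic l) else 0)"
  using dyadic_bounds dyadic_disjoint[of k l]
  by (auto simp: band_part_self[OF g] inf_commute intro!: band_part_disjoint[OF g])

lemma abs_rademacher: "\<bar>rademacher n\<bar> \<le> u"
proof -
  have "\<bar>rademacher n\<bar> \<le> (\<Sum>l\<in>cubes n. \<bar>dyadic (True # l) - dyadic (False # l)\<bar>)"
    unfolding rademacher_def by (rule abs_sum_le)
  also have "\<dots> \<le> (\<Sum>l\<in>cubes n. dyadic l)"
  proof (intro sum_mono)
    fix l
    have "\<bar>dyadic (True # l) - dyadic (False # l)\<bar> \<le> \<bar>dyadic (True # l)\<bar> + \<bar>dyadic (False # l)\<bar>" by (rule abs_triangle_ineq4)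
    also have "\<dots> = dyadic l" using dyadic_bounds dyadic_split(1)[of l] by (simp del: dyadic.simps(2))
    finally show "\<bar>dyadic (True # l) - dyadic (False # l)\<bar> \<le> dyadic l" .
  qed
  finally show ?thesis by (simp add: sum_dyadic)
qed

lemma g_rademacher: "g (rademacher n) = 0"
  by (simp add: rademacher_def linear_sum[OF g_linear] linear_diff[OF g_linear] g_dyadic del: dyadic.simps(2))

lemma rademacher_functional_self: "rademacher_functional n (rademacher n) = g u"
proof -
  have *: "part (x # l) (rademacher n) = (if x then g (dyadic (x # l)) else - g (dyadic (x # l)))" if l: "l \<in> cubes n" for x l
  proof -
    have "part (x # l) (rademacher n) = (\<Sum>m\<in>cubes n. part (x # l) (dyadic (True # m)) - part (x # l) (dyadic (False # m)))"
      by (simp only: rademacher_def linear_sum[OF part_linear] linear_diff[OF part_linear])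
    also have "\<dots> = (\<Sum>m\<in>cubes n. if m = l then (if x then g (dyadic (x # l)) else - g (dyadic (x # l))) else 0)"
      using l by (intro sum.cong refl) (auto simp: part_dyadic cubes_def simp del: dyadic.simps(2))
    also have "\<dots> = (if x then g (dyadic (x # l)) else - g (dyadic (x # l)))" using l by (simp add: finite_cubes del: dyadic.simps(2))
    finally show ?thesis .
  qed
  have "rademacher_functional n (rademacher n) = (\<Sum>l\<in>cubes n. g (dyadic (True # l)) + g (dyadic (False # l)))"
    unfolding rademacher_functional_def by (intro sum.cong refl) (simp add: * del: dyadic.simps(2))
  also have "\<dots> = g (\<Sum>l\<in>cubes n. dyadic l)"
    by (simp only: linear_add[OF g_linear, symmetric] dyadic_split linear_sum[OF g_linear])
  finally show ?thesis by (simp add: sum_dyadic)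
qed

lemma linear_rademacher_functional: "linear (rademacher_functional n)"
  unfolding rademacher_functional_def
  by (intro linear_compose_sum linear_compose_sub part_linear ballI)

lemma abs_rademacher_functional: "\<bar>rademacher_functional n x\<bar> \<le> band_part g u \<bar>x\<bar>"
proof -
  have "\<bar>rademacher_functional n x\<bar> \<le> (\<Sum>l\<in>cubes n. \<bar>part (True # l) x - part (False # l) x\<bar>)"
    unfolding rademacher_functional_def by (rule sum_abs)
  also have "\<dots> \<le> (\<Sum>l\<in>cubes n. part l \<bar>x\<bar>)"
  proof (intro sum_mono)
    fix l
    have "\<bar>part (True # l) x - part (False # l) x\<bar> \<le> \<bar>part (True # l) x\<bar> + \<bar>part (False # l) x\<bar>" by (rule abs_triangle_ineq4)
    also have "\<dots> \<le> part (True # l) \<bar>x\<bar> + part (False # l) \<bar>x\<bar>"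
      by (intro add_mono positive_functional_abs_le part_functional)
    finally show "\<bar>part (True # l) x - part (False # l) x\<bar> \<le> part l \<bar>x\<bar>" by (simp only: part_split)
  qed
  finally show ?thesis by (simp add: sum_part)
qed

text \<open>
  If \<open>f\<close> does not tend to 0 along the sequence, some signed averages \<open>s K\<close> have \<open>f (s K) \<ge> e\<close>. But
  \<open>g \<bar>s K\<bar>\<close> is at most \<open>g u / sqrt K\<close> by orthogonality, and on \<open>[-u, u]\<close> this forces \<open>s K \<rightarrow> 0\<close> in norm.
\<close>

lemma weakly_null_rademacher: "weakly_null rademacher"
  unfolding weakly_null_def
proof (intro allI impI)
  fix f :: "'a \<Rightarrow> real" assume f: "bounded_linear f"
  then have fl: "linear f" by (rule bounded_linear.linear)
  show "(\<lambda>n. f (rademacher n)) \<longlonglongrightarrow> 0"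
  proof (rule ccontr)
    assume "\<not> ?thesis"
    then obtain e where e: "e > 0" and ex: "\<And>K. 0 < K \<Longrightarrow> \<exists>c N. (\<Sum>m<N. \<bar>c m\<bar>) \<le> 1 \<and> (\<Sum>m<N. (c m)\<^sup>2) \<le> 1 / real K
        \<and> e \<le> (\<Sum>m<N. c m * f (rademacher m))"
      by (rule not_tendsto_zero_averages) (rule that)
    have "\<exists>s. \<bar>s\<bar> \<le> u \<and> g \<bar>s\<bar> \<le> g u * sqrt (1 / real (Suc K)) \<and> e \<le> f s" for K
    proof -
      obtain c N where c: "(\<Sum>m<N. \<bar>c m\<bar>) \<le> 1" "(\<Sum>m<N. (c m)\<^sup>2) \<le> 1 / real (Suc K)" "e \<le> (\<Sum>m<N. c m * f (rademacher m))"
        using ex[of "Suc K"] by blast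
      define s where "s = (\<Sum>m<N. c m *\<^sub>R rademacher m)"
      have "\<bar>s\<bar> \<le> (\<Sum>m<N. \<bar>c m *\<^sub>R rademacher m\<bar>)"
        unfolding s_def by (rule abs_sum_le)
      also have "\<dots> \<le> (\<Sum>m<N. \<bar>c m\<bar> *\<^sub>R u)" unfolding abs_scaleR by (intro sum_mono scaleR_left_mono abs_rademacher) auto
      also have "\<dots> = (\<Sum>m<N. \<bar>c m\<bar>) *\<^sub>R u" by (simp add: scaleR_left.sum)
      also have "\<dots> \<le> 1 *\<^sub>R u" using c u by (intro scaleR_right_mono) auto
      finally have su: "\<bar>s\<bar> \<le> u" by simp
      have s: "s = (\<Sum>l\<in>cubes N. walk c l *\<^sub>R dyadic l)"
        unfolding s_def rademacher_def by (rule sum_walk) (rule dyadic_split)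
      have "\<bar>s\<bar> \<le> (\<Sum>l\<in>cubes N. \<bar>walk c l *\<^sub>R dyadic l\<bar>)"
        unfolding s by (rule abs_sum_le)
      also have "\<dots> = (\<Sum>l\<in>cubes N. \<bar>walk c l\<bar> *\<^sub>R dyadic l)"
        unfolding abs_scaleR using dyadic_bounds by (intro sum.cong) auto
      finally have "g \<bar>s\<bar> \<le> g (\<Sum>l\<in>cubes N. \<bar>walk c l\<bar> *\<^sub>R dyadic l)" by (rule positive_functional_mono[OF g])
      also have "\<dots> = (\<Sum>l\<in>cubes N. \<bar>walk c l\<bar> * (g u / 2 ^ N))"
        unfolding linear_sum[OF g_linear] by (intro sum.cong refl) (simp add: linear_scale[OF g_linear] g_dyadic cubes_def)
      also have "\<dots> = g u * ((\<Sum>l\<in>cubes N. \<bar>walk c l\<bar>) / 2 ^ N)"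
        unfolding sum_distrib_right[symmetric] by simp
      also have "\<dots> \<le> g u * sqrt (1 / real (Suc K))"
        using sum_abs_walk[where c = c and N = N] c(2) gu by (intro mult_left_mono order_trans[OF sum_abs_walk] real_sqrt_le_mono) auto
      finally have "g \<bar>s\<bar> \<le> g u * sqrt (1 / real (Suc K))" .
      moreover have "e \<le> f s" using c(3) by (simp add: s_def linear_sum[OF fl] linear_scale[OF fl])
      ultimately show ?thesis using su by blast
    qed
    then obtain s where s: "\<And>K. \<bar>s K\<bar> \<le> u" "\<And>K. g \<bar>s K\<bar> \<le> g u * sqrt (1 / real (Suc K))" "\<And>K. e \<le> f (s K)" by metis
    have "(\<lambda>K. g u * sqrt (inverse (real (Suc K)))) \<longlonglongrightarrow> g u * sqrt 0"
      by (intro tendsto_intros LIMSEQ_inverse_real_of_nat)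
    then have lim0: "(\<lambda>K. g u * sqrt (1 / real (Suc K))) \<longlonglongrightarrow> 0" by (simp only: inverse_eq_divide real_sqrt_zero mult_zero_right)
    have gs: "(\<lambda>K. g \<bar>s K\<bar>) \<longlonglongrightarrow> 0"
      by (rule Lim_null_comparison[OF always_eventually lim0]) (use s(2) g_pos in \<open>auto simp del: of_nat_Suc\<close>)
    have "s \<longlonglongrightarrow> 0" by (rule strictly_positive_norm_control[OF u(1) g _ s(1) gs]) (rule strict)
    then have "(\<lambda>K. f (s K)) \<longlonglongrightarrow> f 0" by (rule bounded_linear.tendsto[OF f])
    then have "e \<le> f 0" using s(3) by (intro LIMSEQ_le_const) auto
    with e show False by (simp add: linear_0[OF fl])
  qed
qed

text \<open>
  The same averaging argument, now with \<open>g\<close> restricted to the cells and evaluated at \<open>x\<close>, which is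
  at most \<open>k\<close> times its value at \<open>u\<close>.
\<close>

lemma rademacher_functional_null_bounded:
  assumes x: "0 \<le> x" "x \<le> real k *\<^sub>R u"
  shows "(\<lambda>n. rademacher_functional n x) \<longlonglongrightarrow> 0"
proof (rule ccontr)
  assume "\<not> ?thesis"
  then obtain e where e: "e > 0" and ex: "\<And>K. 0 < K \<Longrightarrow> \<exists>c N. (\<Sum>m<N. \<bar>c m\<bar>) \<le> 1 \<and> (\<Sum>m<N. (c m)\<^sup>2) \<le> 1 / real K
      \<and> e \<le> (\<Sum>m<N. c m * rademacher_functional m x)"
    by (rule not_tendsto_zero_averages) (rule that)
  have le: "e \<le> real k * g u * sqrt (1 / real (Suc K))" for K
  proof -
    obtain c N where c: "(\<Sum>m<N. (c m)\<^sup>2) \<le> 1 / real (Suc K)" "e \<le> (\<Sum>m<N. c m * rademacher_functional m x)"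
      using ex[of "Suc K"] by blast
    have pb: "0 \<le> part l x" "part l x \<le> real k * (g u / 2 ^ N)" if "l \<in> cubes N" for l
    proof -
      show "0 \<le> part l x" using band_part_le(1)[OF g _ x(1)] dyadic_bounds by blast
      have "part l x \<le> part l (real k *\<^sub>R u)" by (rule positive_functional_mono[OF part_functional x(2)])
      also have "\<dots> = real k * (\<Sum>m\<in>cubes N. part l (dyadic m))"
        by (simp add: linear_scale[OF part_linear] linear_sum[OF part_linear, symmetric] sum_dyadic)
      also have "(\<Sum>m\<in>cubes N. part l (dyadic m)) = (\<Sum>m\<in>cubes N. if l = m then g (dyadic m) else 0)"
        using that by (intro sum.cong refl part_dyadic) (simp add: cubes_def)
      also have "\<dots> = g u / 2 ^ N" using that by (simp add: finite_cubes g_dyadic) (simp add: cubes_def)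
      finally show "part l x \<le> real k * (g u / 2 ^ N)" .
    qed
    have "(\<Sum>m<N. c m * rademacher_functional m x) = (\<Sum>l\<in>cubes N. walk c l * part l x)"
      unfolding rademacher_functional_def using sum_walk[of "\<lambda>l. part l x" c N] part_split by simp
    also have "\<dots> \<le> (\<Sum>l\<in>cubes N. \<bar>walk c l\<bar> * (real k * (g u / 2 ^ N)))"
      using pb by (intro sum_mono mult_mono) auto
    also have "\<dots> = real k * g u * ((\<Sum>l\<in>cubes N. \<bar>walk c l\<bar>) / 2 ^ N)"
        unfolding sum_distrib_right[symmetric] by simp
    also have "\<dots> \<le> real k * g u * sqrt (1 / real (Suc K))"
      using c(1) gu by (intro mult_left_mono order_trans[OF sum_abs_walk] real_sqrt_le_mono) auto
    finally show ?thesis using c(2) by simp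
  qed
  have "(\<lambda>K. real k * g u * sqrt (inverse (real (Suc K)))) \<longlonglongrightarrow> real k * g u * sqrt 0"
    by (intro tendsto_intros LIMSEQ_inverse_real_of_nat)
  then have "e \<le> real k * g u * sqrt 0"
    by (rule LIMSEQ_le_const) (use le in \<open>auto simp: inverse_eq_divide simp del: of_nat_Suc\<close>)
  with e show False by simp
qed

text \<open>
  All these functionals are dominated by the part of \<open>g\<close> in the band of \<open>u\<close>, for which truncating \<open>x\<close> at
  a large multiple of \<open>u\<close> loses little.
\<close>

lemma rademacher_functional_null: "(\<lambda>n. rademacher_functional n x) \<longlonglongrightarrow> 0"
proof -
  note lin = linear_rademacher_functional
  interpret tr: truncation UNIV u g by (rule truncation_functional[OF g u(2)])
  have pos: "(\<lambda>n. rademacher_functional n x) \<longlonglongrightarrow> 0" if x: "0 \<le> x" for x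
  proof (rule LIMSEQ_I)
    fix e :: real assume e: "e > 0"
    from LIMSEQ_D[OF tr.trunc_lim_LIMSEQ[OF UNIV_I x], of "e / 2"] e obtain k
      where k: "\<bar>g (inf x (real k *\<^sub>R u)) - band_part g u x\<bar> < e / 2" by auto
    let ?y = "inf x (real k *\<^sub>R u)"
    have y: "0 \<le> ?y" "?y \<le> real k *\<^sub>R u" "?y \<le> x" using x u by (auto intro: scaleR_nonneg_nonneg)
    have "g (inf ?y (real k *\<^sub>R u)) \<le> band_part g u ?y" by (rule tr.trunc_lim_upper) (use y in auto)
    then have "g ?y \<le> band_part g u ?y" by (simp add: inf_absorb1)
    moreover have "linear (band_part g u)"
      using positive_functional_band_part[OF g u(2)] by (simp add: positive_functional_def bounded_linear.linear)
    then have "band_part g u (x - ?y) = band_part g u x - band_part g u ?y" by (rule linear_diff)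
    ultimately have tail: "band_part g u (x - ?y) < e / 2" using k by (simp only: abs_less_iff) linarith
    from LIMSEQ_D[OF rademacher_functional_null_bounded[OF y(1,2)], of "e / 2"] e obtain N
      where N: "\<And>n. n \<ge> N \<Longrightarrow> \<bar>rademacher_functional n ?y\<bar> < e / 2" by auto
    have "norm (rademacher_functional n x - 0) < e" if "n \<ge> N" for n
    proof -
      have "rademacher_functional n x = rademacher_functional n ?y + rademacher_functional n (x - ?y)"
        by (simp add: linear_diff[OF lin])
      moreover have "\<bar>rademacher_functional n (x - ?y)\<bar> < e / 2"
        using abs_rademacher_functional[of n "x - ?y"] tail y(3) by simp
      ultimately show ?thesis using N[OF that] by simp
    qed
    then show "\<exists>N. \<forall>n\<ge>N. norm (rademacher_functional n x - 0) < e" by blast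
  qed
  have "(\<lambda>n. rademacher_functional n (pprt x) - rademacher_functional n (pprt (- x))) \<longlonglongrightarrow> 0 - 0"
    by (intro tendsto_diff pos) auto
  then show ?thesis by (simp add: linear_diff[OF lin, symmetric] pprt_diff)
qed

end

section \<open>The counterexample and the equivalence\<close>

locale bounded_disjoint_sequence =
  fixes f :: "nat \<Rightarrow> 'a::banach_lattice" and b :: 'a
  assumes f: "\<And>n. 0 \<le> f n" "\<And>n. f n \<le> b" and disj: "\<And>m n. m \<noteq> n \<Longrightarrow> inf (f m) (f n) = 0"
begin

lemma b0: "0 \<le> b"
  using f order_trans by blast

lemma combination_bound:
  assumes A: "finite A" and t: "\<And>n. n \<in> A \<Longrightarrow> \<bar>t n\<bar> \<le> C" and C: "0 \<le> C"
  shows "\<bar>\<Sum>n\<in>A. t n *\<^sub>R f n\<bar> \<le> C *\<^sub>R b"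
proof -
  have "\<bar>\<Sum>n\<in>A. t n *\<^sub>R f n\<bar> \<le> (\<Sum>n\<in>A. \<bar>t n *\<^sub>R f n\<bar>)" by (rule abs_sum_le)
  also have "\<dots> \<le> (\<Sum>n\<in>A. C *\<^sub>R f n)" unfolding abs_scaleR using t f by (intro sum_mono) (auto intro: scaleR_right_mono)
  also have "\<dots> = C *\<^sub>R sum f A" by (simp add: scaleR_sum_right)
  also have "\<dots> \<le> C *\<^sub>R b" using A f disj b0 C by (intro scaleR_left_mono sum_disjoint_le) auto
  finally show ?thesis .
qed

text \<open>
  The sums of the \<open>f n\<close> over finite sets stay below \<open>b\<close>, so small coefficients make the blocks of
  the series small.
\<close>

lemma summable_combination:
  assumes t: "t \<longlonglongrightarrow> 0" shows "summable (\<lambda>n. t n *\<^sub>R f n)"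
  unfolding summable_Cauchy
proof (intro allI impI)
  fix e :: real assume e: "e > 0"
  define d where "d = e / 2 / (norm b + 1)"
  have d: "d > 0" "d * norm b < e"
  proof -
    show "d > 0" using e by (simp add: d_def add_nonneg_pos)
    then have "d * norm b \<le> d * (norm b + 1)" by simp
    also have "\<dots> = e / 2"
      unfolding d_def using norm_ge_zero[of b] by (intro nonzero_eq_divide_eq[THEN iffD1, OF _ refl]) linarith
    finally show "d * norm b < e" using e by simp
  qed
  from LIMSEQ_D[OF t d(1)] obtain N where N: "\<And>n. n \<ge> N \<Longrightarrow> \<bar>t n\<bar> < d" by auto
  have "norm (\<Sum>n\<in>{m..<n}. t n *\<^sub>R f n) < e" if "m \<ge> N" for m n
  proof -
    have "\<bar>\<Sum>n\<in>{m..<n}. t n *\<^sub>R f n\<bar> \<le> d *\<^sub>R b" using N that d by (intro combination_bound) (auto intro: less_imp_le)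
    from norm_le_abs[OF this] show ?thesis using d by simp
  qed
  then show "\<exists>N. \<forall>m\<ge>N. \<forall>n. norm (\<Sum>n\<in>{m..<n}. t n *\<^sub>R f n) < e" by blast
qed

lemma suminf_combination_bound:
  assumes t: "t \<longlonglongrightarrow> 0" "\<And>n. \<bar>t n\<bar> \<le> C" shows "\<bar>\<Sum>n. t n *\<^sub>R f n\<bar> \<le> C *\<^sub>R b"
proof (rule LIMSEQ_le_lattice[OF tendsto_abs_lattice[OF summable_LIMSEQ[OF summable_combination[OF t(1)]]] tendsto_const])
  have "0 \<le> C" using t(2)[of 0] by (meson abs_ge_zero order_trans)
  then show "\<bar>\<Sum>i<n. t i *\<^sub>R f i\<bar> \<le> C *\<^sub>R b" for n using t(2) by (intro combination_bound) auto
qed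

text \<open>
  The other terms of the series are disjoint from the \<open>m\<close>-th one.
\<close>

lemma coordinate_le_suminf:
  assumes t: "t \<longlonglongrightarrow> 0" shows "\<bar>t m\<bar> *\<^sub>R f m \<le> \<bar>\<Sum>n. t n *\<^sub>R f n\<bar>"
proof (rule LIMSEQ_le_lattice[OF tendsto_const tendsto_abs_lattice[OF summable_LIMSEQ[OF summable_combination[OF t]]]])
  fix N assume N: "Suc m \<le> N"
  let ?rest = "\<Sum>n\<in>{..<N} - {m}. t n *\<^sub>R f n"
  have "inf (\<bar>t m\<bar> *\<^sub>R f m) (\<Sum>n\<in>{..<N} - {m}. \<bar>t n\<bar> *\<^sub>R f n) = 0"
    using f disj by (intro inf_sum_eq_0 conjI scaleR_nonneg_nonneg inf_scaleR_disjoint) auto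
  moreover have "\<bar>?rest\<bar> \<le> (\<Sum>n\<in>{..<N} - {m}. \<bar>t n *\<^sub>R f n\<bar>)" by (rule abs_sum_le)
  then have "\<bar>?rest\<bar> \<le> (\<Sum>n\<in>{..<N} - {m}. \<bar>t n\<bar> *\<^sub>R f n)" using f by (simp add: abs_scaleR)
  ultimately have "inf (\<bar>t m\<bar> *\<^sub>R f m) \<bar>?rest\<bar> = 0"
    using f by (rule_tac inf_eq_0_mono[of _ "\<bar>t m\<bar> *\<^sub>R f m" _ "\<Sum>n\<in>{..<N} - {m}. \<bar>t n\<bar> *\<^sub>R f n"])
      (auto intro: scaleR_nonneg_nonneg)
  then have "inf \<bar>t m *\<^sub>R f m\<bar> \<bar>?rest\<bar> = 0" using f by (simp add: abs_scaleR)
  then have "\<bar>t m *\<^sub>R f m\<bar> \<le> \<bar>t m *\<^sub>R f m + ?rest\<bar>" by (rule abs_le_abs_add_disjoint)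
  also have "t m *\<^sub>R f m + ?rest = (\<Sum>n<N. t n *\<^sub>R f n)" using N by (simp add: sum.remove[of _ m])
  finally show "\<bar>t m\<bar> *\<^sub>R f m \<le> \<bar>\<Sum>n<N. t n *\<^sub>R f n\<bar>" using f by (simp add: abs_scaleR)
qed

end

lemma not_order_continuous_disjoint_sequence:
  assumes "(oc_elements :: 'a::banach_lattice set) \<noteq> UNIV"
  obtains f :: "nat \<Rightarrow> 'a::banach_lattice" and b \<delta> where "bounded_disjoint_sequence f b" "\<delta> > 0" "\<And>n. \<delta> \<le> norm (f n)"
proof -
  obtain x :: 'a where "x \<notin> oc_elements" using assms by blast
  then obtain w where w: "\<And>n. 0 \<le> w n \<and> w n \<le> \<bar>x\<bar>" "\<And>m n. m \<noteq> n \<Longrightarrow> inf (w m) (w n) = 0" "\<not> (w :: nat \<Rightarrow> 'a) \<longlonglongrightarrow> 0"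
    using oc_elements_if_disjoint_null[of x] by blast
  obtain \<delta> and r :: "nat \<Rightarrow> nat" where r: "\<delta> > 0" "strict_mono r" "\<And>n. \<delta> \<le> norm (w (r n))"
    using not_tendsto_zero_subseq[OF w(3)] by blast
  have "bounded_disjoint_sequence (\<lambda>n. w (r n)) \<bar>x\<bar>"
    using w(1,2) strict_mono_eq[OF r(2)] by (intro bounded_disjoint_sequence.intro) auto
  then show thesis using that r by blast
qed

text \<open>
  The sign of \<open>h n\<close> varies, so the series alone is not a positive operator; adding \<open>g \<otimes> b\<close> makes it
  positive, and \<open>g (r\<^sub>n) = 0\<close> keeps this term from affecting the Rademacher sequence.
\<close>

theorem dominated_not_Lwcc:
  assumes E: "\<not> discrete_vector_lattice (oc_elements :: 'e::banach_lattice set)"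
    and F: "(oc_elements :: 'f::banach_lattice set) \<noteq> UNIV"
  obtains S T :: "'e::banach_lattice \<Rightarrow> 'f::banach_lattice" where "bounded_linear S" "bounded_linear T"
    "operator_le (\<lambda>_. 0) S" "operator_le S T" "Lwcc T" "\<not> Lwcc S"
proof -
  obtain u0 :: 'e where u0: "u0 \<in> oc_elements" "0 \<le> u0" "u0 \<noteq> 0"
    "\<And>a. 0 \<le> a \<Longrightarrow> a \<le> u0 \<Longrightarrow> a \<noteq> 0 \<Longrightarrow> \<exists>y. 0 \<le> y \<and> y \<le> a \<and> (\<forall>c. y \<noteq> c *\<^sub>R a)"
    by (rule nonatomic_element[OF E]) (rule that)
  obtain g u where g: "positive_functional g" and u: "0 \<le> u" "u \<le> u0" "0 < g u"
    and strict: "\<And>v. 0 \<le> v \<Longrightarrow> v \<le> u \<Longrightarrow> g v = 0 \<Longrightarrow> v = 0"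
    by (rule strictly_positive_functional_exists[OF u0(1,2,3)]) (rule that)
  interpret N: nonatomic u g
  proof (rule nonatomic.intro)
    show "\<exists>y. 0 \<le> y \<and> y \<le> a \<and> (\<forall>c. y \<noteq> c *\<^sub>R a)" if "0 \<le> a" "a \<le> u" "a \<noteq> 0" for a
      using u0(4)[OF that(1) order_trans[OF that(2) u(2)] that(3)] .
  qed (fact g u strict | rule oc_elements_below[OF u0(1) u(1,2)])+
  obtain f :: "nat \<Rightarrow> 'f" and b \<delta> where "bounded_disjoint_sequence f b" and \<delta>: "\<delta> > 0" "\<And>n. \<delta> \<le> norm (f n)"
    by (rule not_order_continuous_disjoint_sequence[OF F]) (rule that)
  then interpret D: bounded_disjoint_sequence f b by blast
  let ?h = N.rademacher_functional
  define S where "S x = g x *\<^sub>R b + (\<Sum>n. ?h n x *\<^sub>R f n)" for x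
  define T where "T x = (2 * g x) *\<^sub>R b" for x
  note null = N.rademacher_functional_null and hl = N.linear_rademacher_functional and gl = N.g_linear
  note summ = D.summable_combination[OF null]
  have h_le: "\<bar>?h n x\<bar> \<le> g \<bar>x\<bar>" for n x
    using N.abs_rademacher_functional[of n x] band_part_le(2)[OF g u(1), of "\<bar>x\<bar>"] by simp
  have series: "\<bar>\<Sum>n. ?h n x *\<^sub>R f n\<bar> \<le> g \<bar>x\<bar> *\<^sub>R b" for x
    by (rule D.suminf_combination_bound[OF null h_le])
  obtain K where K: "\<And>x. norm (g x) \<le> norm x * K" using bounded_linear.bounded[OF N.g_bounded_linear] by blast
  have Sb: "bounded_linear S"
  proof (rule bounded_linear_intro)
    show "S (x + y) = S x + S y" for x y
    proof -
      have "(\<Sum>n. ?h n (x + y) *\<^sub>R f n) = (\<Sum>n. ?h n x *\<^sub>R f n) + (\<Sum>n. ?h n y *\<^sub>R f n)"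
        by (subst suminf_add[OF summ summ]) (simp add: linear_add[OF hl] scaleR_left_distrib)
      then show ?thesis by (simp add: S_def linear_add[OF gl] scaleR_left_distrib)
    qed
    show "S (t *\<^sub>R x) = t *\<^sub>R S x" for t x
    proof -
      have "(\<Sum>n. ?h n (t *\<^sub>R x) *\<^sub>R f n) = t *\<^sub>R (\<Sum>n. ?h n x *\<^sub>R f n)"
        by (subst suminf_scaleR_right[OF summ]) (simp add: linear_scale[OF hl])
      then show ?thesis by (simp add: S_def linear_scale[OF gl] scaleR_right_distrib)
    qed
    fix x
    have gx: "\<bar>g x\<bar> \<le> norm x * K" "g \<bar>x\<bar> \<le> norm x * K" using K[of x] K[of "\<bar>x\<bar>"] by (auto simp: norm_abs_eq)
    have "norm (S x) \<le> norm (g x *\<^sub>R b) + norm (\<Sum>n. ?h n x *\<^sub>R f n)" unfolding S_def by (rule norm_triangle_ineq)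
    also have "\<dots> \<le> norm x * K * norm b + norm x * K * norm b"
    proof (intro add_mono)
      show "norm (g x *\<^sub>R b) \<le> norm x * K * norm b" using gx by (simp add: mult_right_mono)
      have "norm (\<Sum>n. ?h n x *\<^sub>R f n) \<le> norm (g \<bar>x\<bar> *\<^sub>R b)" by (rule norm_le_abs[OF series])
      also have "\<dots> \<le> norm x * K * norm b" using gx N.g_pos[of "\<bar>x\<bar>"] by (simp add: mult_right_mono)
      finally show "norm (\<Sum>n. ?h n x *\<^sub>R f n) \<le> norm x * K * norm b" .
    qed
    finally show "norm (S x) \<le> norm x * (2 * K * norm b)" by (simp add: algebra_simps)
  qed
  have Tb: "bounded_linear T"
    unfolding T_def using N.g_bounded_linear
    by (intro bounded_linear_compose[OF bounded_linear_scaleR_left] bounded_linear_compose[OF bounded_linear_mult_right])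
  have "operator_le (\<lambda>_. 0) S \<and> operator_le S T"
  proof -
    have "0 \<le> S x \<and> S x \<le> T x" if x: "0 \<le> x" for x
    proof -
      have s: "\<bar>\<Sum>n. ?h n x *\<^sub>R f n\<bar> \<le> g x *\<^sub>R b" using series[of x] x by simp
      have "- (\<Sum>n. ?h n x *\<^sub>R f n) \<le> g x *\<^sub>R b" using s abs_ge_minus_self order_trans by blast
      then have "0 \<le> S x" using add_right_mono[of "- (\<Sum>n. ?h n x *\<^sub>R f n)" "g x *\<^sub>R b" "\<Sum>n. ?h n x *\<^sub>R f n"] by (simp add: S_def)
      moreover have "(\<Sum>n. ?h n x *\<^sub>R f n) \<le> g x *\<^sub>R b" using s abs_ge_self order_trans by blast
      then have "S x \<le> T x" by (simp add: S_def T_def scaleR_2 flip: scaleR_scaleR)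
      ultimately show ?thesis ..
    qed
    then show ?thesis by (simp add: operator_le_def)
  qed
  moreover have "Lwcc T"
    unfolding Lwcc_def
  proof (intro conjI allI impI Tb, elim conjE)
    fix x :: "nat \<Rightarrow> 'e" assume "weakly_null x"
    then have "(\<lambda>n. g (x n)) \<longlonglongrightarrow> 0" using N.g_bounded_linear by (simp add: weakly_null_def)
    then have "(\<lambda>n. norm ((2 * g (x n)) *\<^sub>R b)) \<longlonglongrightarrow> norm ((2 * 0) *\<^sub>R b)" by (intro tendsto_intros)
    then show "(\<lambda>n. norm (T (x n))) \<longlonglongrightarrow> 0" by (simp add: T_def)
  qed
  moreover have "\<not> Lwcc S"
  proof
    assume "Lwcc S"
    moreover have "L_weakly_compact (range N.rademacher)"
      using N.abs_rademacher by (intro L_weakly_compact_subset_interval[OF N.u(1)]) auto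
    ultimately have lim: "(\<lambda>n. norm (S (N.rademacher n))) \<longlonglongrightarrow> 0"
      using N.weakly_null_rademacher unfolding Lwcc_def by blast
    have "g u * \<delta> \<le> norm (S (N.rademacher n))" for n
    proof -
      have "\<bar>?h n (N.rademacher n)\<bar> *\<^sub>R f n \<le> \<bar>\<Sum>k. ?h k (N.rademacher n) *\<^sub>R f k\<bar>" by (rule D.coordinate_le_suminf[OF null])
      then have "g u *\<^sub>R f n \<le> \<bar>S (N.rademacher n)\<bar>"
        using u(3) by (simp add: S_def N.g_rademacher N.rademacher_functional_self)
      then have "norm (g u *\<^sub>R f n) \<le> norm \<bar>S (N.rademacher n)\<bar>"
        using u(3) D.f(1) by (intro norm_mono_nonneg scaleR_nonneg_nonneg) auto
      moreover have "g u * \<delta> \<le> norm (g u *\<^sub>R f n)" using u(3) \<delta>(2)[of n] by simp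
      ultimately show ?thesis by (simp add: norm_abs_eq)
    qed
    then have "g u * \<delta> \<le> 0" using lim by (intro LIMSEQ_le_const) auto
    with u(3) \<delta>(1) show False by (simp add: mult_le_0_iff)
  qed
  ultimately show thesis using that Sb Tb by blast
qed

theorem theorem1p2:
  shows "(\<forall>S T :: 'e::banach_lattice \<Rightarrow> 'f::banach_lattice.
            bounded_linear S \<longrightarrow> bounded_linear T \<longrightarrow>
            operator_le (\<lambda>_. 0) S \<longrightarrow> operator_le S T \<longrightarrow> Lwcc T \<longrightarrow> Lwcc S)
         \<longleftrightarrow>
         (discrete_vector_lattice (order_continuous_part :: 'e set) \<or>
          order_continuous_norm_on (UNIV :: 'f set))"
  unfolding order_continuous_part_eq order_continuous_norm_on_UNIV_iff
proof
  assume dom: "\<forall>S T :: 'e \<Rightarrow> 'f. bounded_linear S \<longrightarrow> bounded_linear T \<longrightarrow>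
    operator_le (\<lambda>_. 0) S \<longrightarrow> operator_le S T \<longrightarrow> Lwcc T \<longrightarrow> Lwcc S"
  show "discrete_vector_lattice (oc_elements :: 'e set) \<or> (oc_elements :: 'f set) = UNIV"
  proof (rule ccontr)
    assume "\<not> ?thesis"
    then have "\<not> discrete_vector_lattice (oc_elements :: 'e set)" "(oc_elements :: 'f set) \<noteq> UNIV" by auto
    then obtain S T :: "'e \<Rightarrow> 'f" where "bounded_linear S" "bounded_linear T"
      "operator_le (\<lambda>_. 0) S" "operator_le S T" "Lwcc T" "\<not> Lwcc S"
      by (rule dominated_not_Lwcc) (rule that)
    with dom show False by blast
  qed
next
  assume "discrete_vector_lattice (oc_elements :: 'e set) \<or> (oc_elements :: 'f set) = UNIV"
  then show "\<forall>S T :: 'e \<Rightarrow> 'f. bounded_linear S \<longrightarrow> bounded_linear T \<longrightarrow>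
    operator_le (\<lambda>_. 0) S \<longrightarrow> operator_le S T \<longrightarrow> Lwcc T \<longrightarrow> Lwcc S"
  proof (elim disjE, intro allI impI)
    fix S T :: "'e \<Rightarrow> 'f"
    assume disc: "discrete_vector_lattice (oc_elements :: 'e set)" and S: "bounded_linear S"
    have "(\<lambda>n. norm (S (x n))) \<longlonglongrightarrow> 0" if "weakly_null x" "L_weakly_compact (range x)" for x
      using bounded_linear.tendsto_zero[OF S discrete_weakly_null_tendsto[OF disc that]] by (rule tendsto_norm_zero)
    then show "Lwcc S" using S by (simp add: Lwcc_def)
  next
    assume F: "(oc_elements :: 'f set) = UNIV"
    show ?thesis
    proof (intro allI impI)
      fix S T :: "'e \<Rightarrow> 'f"
      assume "bounded_linear S" "operator_le (\<lambda>_. 0) S" "operator_le S T" "Lwcc T"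
      then show "Lwcc S" using F by (intro Lwcc_dominated_order_continuous_range[of S T]) (auto simp: operator_le_def)
    qed
  qed
qed

end
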